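(* Let $X=(X_t)_{t\ge0}$ be the super-Brownian motion with branching mechanism $\psi$ described in the context, assume $\lambda_1>0$, and let $\mu$ be a finite, compactly supported measure on $\mathbb{R}$. For $R\ge0$ put $\mathcal{X}^{R}_{t}:=X_t\big((-R,R)^c\big)$. (1) For every $\delta>\sqrt{\lambda_1/2}$, $\lim_{t\to+\infty}\mathcal{X}^{\delta t}_{t}=0$ $\mathbb{P}_\mu$-almost surely. (2) For every $0\le\delta<\sqrt{\lambda_1/2}$, $$\lim_{t\to+\infty}\frac{\log\mathcal{X}^{\delta t}_{t}}{t}=\lambda_1-\sqrt{2\lambda_1}\,\delta\qquad \mathbb{P}_\mu\text{-a.s. on }\{W^h_\infty(X)>0\}.$$
   Context: Let $(B_t)_{t\ge0}$ be standard one-dimensional Brownian motion with laws $\Pi_x$ ($\Pi_x(B_0=x)=1$) and semigroup $P_t$. The branching mechanism is $\psi(x,\lambda)=-\beta(x)\lambda+\alpha(x)\lambda^2+\int_{(0,\infty)}(e^{-\lambda u}-1+\lambda u)\,\pi(x,du)$ for $x\in\mathbb{R},\lambda\ge0$, where $\beta$ is continuous with compact support, $\alpha\ge0$ is continuous, compactly supported and not identically zero, and $\pi$ is a kernel from $\mathbb{R}$ to $(0,\infty)$ with $x\mapsto\int u^2\pi(x,du)$ nonnegative, continuous and compactly supported. For a finite measure $\mu$ on $\mathbb{R}$, $\mathbb{P}_\mu$ is the law of the measure-valued Markov process $X$ with $X_0=\mu$ and $\mathbb{P}_\mu[e^{-\langle f,X_t\rangle}]=e^{-\langle u_f(t,\cdot),\mu\rangle}$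 for bounded nonnegative measurable $f$, where $u_f$ is the unique nonnegative locally bounded solution of $u_f(t,x)=P_tf(x)-\int_0^tP_s(\psi(\cdot,u_f(t-s,\cdot)))(x)\,ds$. Here $\langle f,\mu\rangle=\int f\,d\mu$. Let $\lambda_1:=\sup\sigma(\tfrac12\Delta+\beta)$ (top of the spectrum of the Schrödinger operator on $\mathbb{R}$), assumed $>0$; it is a simple eigenvalue with strictly positive bounded continuous eigenfunction $h$ normalized by $\int h^2=1$. Then $W^h_t(X):=e^{-\lambda_1 t}\langle h,X_t\rangle$ is a nonnegative $\mathbb{P}_\mu$-martingale and $W^h_\infty(X)$ denotes its almost sure limit. *)

theory Defs
  imports "HOL-Probability.Probability"
begin

definition compact_supp :: "(real \<Rightarrow> real) \<Rightarrow> bool" where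
  "compact_supp f \<longleftrightarrow> (\<exists>R. \<forall>x. \<bar>x\<bar> > R \<longrightarrow> f x = 0)"

definition C2c :: "(real \<Rightarrow> real) \<Rightarrow> bool" where
  "C2c \<phi> \<longleftrightarrow> (\<forall>x. \<phi> differentiable (at x)) \<and> (\<forall>x. deriv \<phi> differentiable (at x))
      \<and> continuous_on UNIV (deriv (deriv \<phi>)) \<and> compact_supp \<phi>"

section \<open>Top of the spectrum of 1/2 Delta + beta (quadratic form / Rayleigh quotient)\<close>

definition lambda1 :: "(real \<Rightarrow> real) \<Rightarrow> real" where
  "lambda1 \<beta> = Sup {(\<integral>x. (deriv (deriv \<phi>) x / 2 + \<beta> x * \<phi> x) * \<phi> x \<partial>lborel)
                      / (\<integral>x. (\<phi> x)\<^sup>2 \<partial>lborel) | \<phi>. C2c \<phi> \<and> \<phi> \<noteq> (\<lambda>_. 0)}"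

definition psi :: "(real \<Rightarrow> real) \<Rightarrow> (real \<Rightarrow> real) \<Rightarrow> (real \<Rightarrow> real measure) \<Rightarrow> real \<Rightarrow> real \<Rightarrow> real" where
  "psi \<beta> \<alpha> \<pi> x l = - \<beta> x * l + \<alpha> x * l\<^sup>2
      + (\<integral>u. (exp (- l * u) - 1 + l * u) \<partial>(\<pi> x))"

definition branching_params :: "(real \<Rightarrow> real) \<Rightarrow> (real \<Rightarrow> real) \<Rightarrow> (real \<Rightarrow> real measure) \<Rightarrow> bool" where
  "branching_params \<beta> \<alpha> \<pi> \<longleftrightarrow>
     continuous_on UNIV \<beta> \<and> compact_supp \<beta> \<and>
     continuous_on UNIV \<alpha> \<and> compact_supp \<alpha> \<and> (\<forall>x. \<alpha> x \<ge> 0) \<and> (\<exists>x. \<alpha> x \<noteq> 0) \<and>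
     (\<forall>x. sets (\<pi> x) = sets borel) \<and>
     (\<forall>x. emeasure (\<pi> x) {..0} = 0) \<and>
     (\<forall>A \<in> sets borel. (\<lambda>x. emeasure (\<pi> x) A) \<in> borel_measurable borel) \<and>
     (\<forall>x. (\<integral>\<^sup>+ u. ennreal (u\<^sup>2) \<partial>(\<pi> x)) < \<top>) \<and>
     continuous_on UNIV (\<lambda>x. \<integral>u. u\<^sup>2 \<partial>(\<pi> x)) \<and>
     compact_supp (\<lambda>x. \<integral>u. u\<^sup>2 \<partial>(\<pi> x))"

definition heat :: "real \<Rightarrow> (real \<Rightarrow> real) \<Rightarrow> real \<Rightarrow> real" where
  "heat t g x = (if t = 0 then g x else \<integral>y. g y * normal_density x (sqrt t) y \<partial>lborel)"

definition mild_solution :: "(real \<Rightarrow> real \<Rightarrow> real) \<Rightarrow> (real \<Rightarrow> real) \<Rightarrow> (real \<Rightarrow> real \<Rightarrow> real) \<Rightarrow> bool" where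
  "mild_solution \<Psi> f u \<longleftrightarrow>
     (\<forall>t x. t < 0 \<longrightarrow> u t x = 0) \<and>
     (\<forall>t x. t \<ge> 0 \<longrightarrow> u t x \<ge> 0) \<and>
     (\<lambda>(t, x). u t x) \<in> borel_measurable borel \<and>
     (\<forall>T. \<exists>C. \<forall>t \<in> {0..T}. \<forall>x. \<bar>u t x\<bar> \<le> C) \<and>
     (\<forall>t x. t \<ge> 0 \<longrightarrow>
        u t x = heat t f x - (\<integral>s \<in> {0..t}. heat s (\<lambda>y. \<Psi> y (u (t - s) y)) x \<partial>lborel))"

definition uf :: "(real \<Rightarrow> real \<Rightarrow> real) \<Rightarrow> (real \<Rightarrow> real) \<Rightarrow> real \<Rightarrow> real \<Rightarrow> real" where
  "uf \<Psi> f = (THE u. mild_solution \<Psi> f u)"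

definition nat_filtration :: "'w measure \<Rightarrow> (real \<Rightarrow> 'w \<Rightarrow> real measure) \<Rightarrow> real \<Rightarrow> 'w measure" where
  "nat_filtration P X s = sigma (space P)
     (\<Union>r \<in> {0..s}. \<Union>A \<in> sets borel. \<Union>B \<in> sets (borel :: real measure).
        {(\<lambda>\<omega>. measure (X r \<omega>) A) -` B \<inter> space P})"

definition bounded_nonneg_fun :: "(real \<Rightarrow> real) \<Rightarrow> bool" where
  "bounded_nonneg_fun f \<longleftrightarrow> f \<in> borel_measurable borel \<and> (\<forall>x. f x \<ge> 0) \<and> bounded (range f)"

definition cadlag_on_nonneg :: "(real \<Rightarrow> real) \<Rightarrow> bool" where
  "cadlag_on_nonneg g \<longleftrightarrow> (\<forall>t \<ge> 0. continuous (at_right t) g) \<and>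
                          (\<forall>t > 0. \<exists>l. (g \<longlongrightarrow> l) (at_left t))"

definition superBM :: "'w measure \<Rightarrow> (real \<Rightarrow> 'w \<Rightarrow> real measure) \<Rightarrow>
    (real \<Rightarrow> real) \<Rightarrow> (real \<Rightarrow> real) \<Rightarrow> (real \<Rightarrow> real measure) \<Rightarrow> real measure \<Rightarrow> bool" where
  "superBM P X \<beta> \<alpha> \<pi> \<mu> \<longleftrightarrow>
     prob_space P \<and>
     (\<forall>t \<ge> 0. \<forall>\<omega> \<in> space P. finite_measure (X t \<omega>) \<and> sets (X t \<omega>) = sets borel) \<and>
     (\<forall>t \<ge> 0. \<forall>A \<in> sets borel. (\<lambda>\<omega>. measure (X t \<omega>) A) \<in> borel_measurable P) \<and>
     (\<forall>\<omega> \<in> space P. \<forall>f. continuous_on UNIV f \<and> bounded (range f) \<longrightarrow>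
        cadlag_on_nonneg (\<lambda>t. \<integral>x. f x \<partial>(X t \<omega>))) \<and>
     (AE \<omega> in P. X 0 \<omega> = \<mu>) \<and>
     (\<forall>s \<ge> 0. \<forall>t \<ge> 0. \<forall>f. bounded_nonneg_fun f \<longrightarrow>
        (AE \<omega> in P. real_cond_exp P (nat_filtration P X s)
                        (\<lambda>\<omega>'. exp (- (\<integral>x. f x \<partial>(X (s + t) \<omega>')))) \<omega>
                    = exp (- (\<integral>x. uf (psi \<beta> \<alpha> \<pi>) f t x \<partial>(X s \<omega>)))))"

definition ground_state :: "(real \<Rightarrow> real) \<Rightarrow> (real \<Rightarrow> real) \<Rightarrow> bool" where
  "ground_state \<beta> h \<longleftrightarrow>
     (\<forall>x. h x > 0) \<and> bounded (range h) \<and> continuous_on UNIV h \<and>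
     (\<forall>x. h differentiable (at x)) \<and> (\<forall>x. deriv h differentiable (at x)) \<and>
     (\<forall>x. deriv (deriv h) x / 2 + \<beta> x * h x = lambda1 \<beta> * h x) \<and>
     integrable lborel (\<lambda>x. (h x)\<^sup>2) \<and> (\<integral>x. (h x)\<^sup>2 \<partial>lborel) = 1"

end

theory Submission
  imports Defs "HOL-Real_Asymp.Real_Asymp"
begin

text \<open>
  Upper bounds. For \<open>\<lambda> > \<lambda>\<^sub>1\<close> and large \<open>A\<close> the function \<open>g = A h + cosh (\<surd>(2\<lambda>) x)\<close> satisfies
  \<open>g''/2 + \<beta> g \<le> \<lambda> g\<close>. Since \<open>\<psi>(x,l) \<ge> - \<beta>(x) l\<close>, comparison of mild solutions shows that
  \<open>1 - exp (- \<theta> e\<^sup>-\<^sup>\<lambda>\<^sup>t \<langle>g, X\<^sub>t\<rangle>)\<close> is a bounded supermartingale. The maximal inequality and \<open>\<theta> \<rightarrow> 0\<close> give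
  \<open>sup\<^sub>t e\<^sup>-\<^sup>\<lambda>\<^sup>t \<langle>g, X\<^sub>t\<rangle> < \<infinity>\<close> almost surely, so the mass outside \<open>(-r, r)\<close> is at most
  \<open>C exp (\<lambda> t - \<surd>(2\<lambda>) r)\<close> for all \<open>t\<close> and \<open>r\<close>; then let \<open>\<lambda> \<rightarrow> \<lambda>\<^sub>1\<close>.

  Lower bounds. The branching mechanism vanishes outside some \<open>[-R, R]\<close>, where the process is a
  deterministic heat flow. Hence \<open>\<langle>f, X\<^sub>s\<^sub>+\<^sub>t\<rangle> \<ge> \<langle>Q\<^sub>t f, X\<^sub>s\<rangle>\<close> almost surely, with \<open>Q\<close> the heat semigroup killed
  on \<open>[-R, R]\<close>: the killed flow of \<open>\<theta> f\<close> is a subsolution for every \<open>\<theta>\<close>, and \<open>\<theta> \<rightarrow> \<infinity>\<close> turns the Laplace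
  functional into a pathwise inequality. A Borel--Cantelli argument at integer times shows that a fixed
  proportion of the total mass, which grows like \<open>exp (\<lambda>\<^sub>1 t)\<close>, sits outside \<open>[-R-1, R+1]\<close>. Letting this
  mass flow during the last \<open>a t\<close> units of time, \<open>a = \<delta> / \<surd>(2\<lambda>\<^sub>1)\<close>, yields
  \<open>\<lambda>\<^sub>1 (1 - a) - \<delta>\<^sup>2 / (2 a) = \<lambda>\<^sub>1 - \<surd>(2\<lambda>\<^sub>1) \<delta>\<close>.
\<close>

section \<open>The Gaussian heat semigroup\<close>

text \<open>Since \<open>uf\<close> is a definite description, nothing is known about a Laplace
  exponent until mild equations are shown to have exactly one solution. In the mild equation the
  reaction enters with a minus sign, which blocks comparison. Discounting the heat flow by exp (- k
  s) and adding \<open>k u\<close> to the source gives an equivalent equation whose source is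
  nonnegative for large k; comparison then reduces to a one-sided Gronwall lemma for integral
  equations, without regularity theory. The Markov property speaks of one pair of times and one
  bounded test function, while the conclusions concern all real times. Almost sure statements are
  therefore proved at countably many times and extended by right continuity, which holds for bounded
  continuous test functions only. Hence ramps replace indicators and truncations replace the
  unbounded \<open>g\<close>. The weight cosh appears because the heat flow multiplies it by exp
  (\<lambda> t); the term \<open>A h\<close> pays for the compact region where \<beta> acts. The
  value of a maximizes \<lambda>1 (1 - a) - \<delta>^2 / (2 a), the balance of growing longer
  against travelling longer.\<close>

abbreviation jointly_measurable :: "(real \<Rightarrow> real \<Rightarrow> real) \<Rightarrow> bool" where
  "jointly_measurable H \<equiv> case_prod H \<in> borel_measurable (borel \<Otimes>\<^sub>M borel)"

definition gauss :: "real measure" where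
  "gauss = density lborel std_normal_density"

interpretation gauss: prob_space gauss
  unfolding gauss_def by (rule prob_space_normal_density) simp

lemma sets_gauss [simp, measurable_cong]: "sets gauss = sets borel"
  by (simp add: gauss_def)

lemma space_gauss [simp]: "space gauss = UNIV"
  by (simp add: gauss_def)

lemma integral_gauss:
  assumes [measurable]: "f \<in> borel_measurable borel"
  shows "(\<integral>z. f z \<partial>gauss) = (\<integral>z. std_normal_density z * (f z::real) \<partial>lborel)"
  unfolding gauss_def by (subst integral_real_density) auto

lemma integrable_gauss_iff:
  assumes [measurable]: "f \<in> borel_measurable borel"
  shows "integrable gauss f \<longleftrightarrow> integrable lborel (\<lambda>z. std_normal_density z * (f z::real))"
  unfolding gauss_def by (subst integrable_real_density) auto

lemma gauss_uminus: "distr gauss borel uminus = gauss"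
proof -
  have "emeasure (distr gauss borel uminus) A = emeasure gauss A" if [measurable]: "A \<in> sets borel" for A
  proof -
    have "emeasure (distr gauss borel uminus) A = (\<integral>\<^sup>+x. indicator A x \<partial>distr gauss borel uminus)"
      by simp
    also have "\<dots> = (\<integral>\<^sup>+x. indicator A (- x) \<partial>gauss)"
      by (rule nn_integral_distr) auto
    also have "\<dots> = (\<integral>\<^sup>+x. ennreal (std_normal_density x) * indicator A (-x) \<partial>lborel)"
      unfolding gauss_def by (subst nn_integral_density) auto
    also have "\<dots> = (\<integral>\<^sup>+x. ennreal (std_normal_density (-x)) * indicator A x \<partial>lborel)"
      by (subst nn_integral_real_affine[where c="-1" and t=0]) auto
    also have "\<dots> = emeasure gauss A"
      unfolding gauss_def by (subst emeasure_density) (auto simp: normal_density_def)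
    finally show ?thesis .
  qed
  then show ?thesis by (intro measure_eqI) auto
qed

lemma gauss_integral_uminus:
  assumes [measurable]: "f \<in> borel_measurable borel"
  shows "(\<integral>z. f (- z) \<partial>gauss) = (\<integral>z. (f z::real) \<partial>gauss)"
  by (subst (2) gauss_uminus[symmetric], subst integral_distr) auto

text \<open>Writing the heat semigroup as an expectation over one fixed Gaussian law makes time 0 an
  ordinary value and reduces joint measurability in all parameters to that of the integrand.\<close>

definition gheat :: "real \<Rightarrow> (real \<Rightarrow> real) \<Rightarrow> real \<Rightarrow> real" where
  "gheat t f x = (\<integral>z. f (x + sqrt t * z) \<partial>gauss)"

lemma heat_eq_hs:
  assumes [measurable]: "f \<in> borel_measurable borel" and "t \<ge> 0"
  shows "heat t f x = gheat t f x"
proof (cases "t = 0")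
  case True
  then show ?thesis by (simp add: heat_def gheat_def gauss.prob_space[simplified])
next
  case False
  then have t: "t > 0" using assms by auto
  have nd: "normal_density x (sqrt t) (x + sqrt t * z) * sqrt t = std_normal_density z" for z
    using t by (simp add: normal_density_def real_sqrt_mult power_mult_distrib field_simps)
  have "heat t f x = (\<integral>y. f y * normal_density x (sqrt t) y \<partial>lborel)"
    using False by (simp add: heat_def)
  also have "\<dots> = sqrt t * (\<integral>z. f (x + sqrt t * z) * normal_density x (sqrt t) (x + sqrt t * z) \<partial>lborel)"
    using t by (subst lborel_integral_real_affine[where c="sqrt t" and t=x]) auto
  also have "\<dots> = (\<integral>z. std_normal_density z * f (x + sqrt t * z) \<partial>lborel)"
    unfolding nd[symmetric] by (subst integral_mult_right_zero[symmetric]) (simp add: mult_ac)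
  also have "\<dots> = gheat t f x"
    unfolding gheat_def by (subst integral_gauss) auto
  finally show ?thesis .
qed

text \<open>Time, function and point may all move with the parameter, as they do in the Duhamel
  integrand \<open>gheat s (H (t - s)) x\<close>.\<close>

lemma gheat_measurable:
  assumes [measurable]: "jointly_measurable H"
     "a \<in> borel_measurable M" "b \<in> borel_measurable M" "c \<in> borel_measurable M"
  shows "(\<lambda>w. gheat (a w) (H (b w)) (c w)) \<in> borel_measurable M"
  unfolding gheat_def by measurable

lemma gheat_measurable1 [measurable]:
  assumes [measurable]: "f \<in> borel_measurable borel"
  shows "gheat t f \<in> borel_measurable borel"
  unfolding gheat_def by measurable

lemma gauss_integrable_bounded:
  fixes f :: "real \<Rightarrow> real"
  assumes [measurable]: "f \<in> borel_measurable borel" and "\<And>x. \<bar>f x\<bar> \<le> C"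
  shows "integrable gauss f"
  using assms by (intro gauss.integrable_const_bound[where B=C]) auto

lemma gheat_bound:
  assumes "\<And>x. \<bar>f x\<bar> \<le> C"
  shows "\<bar>gheat t f x\<bar> \<le> C"
proof (cases "integrable gauss (\<lambda>z. f (x + sqrt t * z))")
  case True
  have "\<bar>gheat t f x\<bar> \<le> (\<integral>z. \<bar>f (x + sqrt t * z)\<bar> \<partial>gauss)"
    unfolding gheat_def by (rule integral_abs_bound)
  also have "\<dots> \<le> (\<integral>z. C \<partial>gauss)"
    using True assms by (intro integral_mono) auto
  finally show ?thesis using gauss.prob_space by simp
next
  case False
  \<comment> \<open>A non-integrable function has Bochner integral 0, so the bound holds without any
    measurability assumption.\<close>
  then have "gheat t f x = 0" by (simp add: gheat_def not_integrable_integral_eq)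
  then show ?thesis using assms[of x] by simp
qed

lemma gheat_const [simp]: "gheat t (\<lambda>_. c) x = c"
  using gauss.prob_space by (simp add: gheat_def)

lemma gheat_0 [simp]: "gheat 0 f x = f x"
  using gauss.prob_space by (simp add: gheat_def)

lemma gheat_nonneg: "(\<And>x. f x \<ge> 0) \<Longrightarrow> gheat t f x \<ge> 0"
  unfolding gheat_def by (intro Bochner_Integration.integral_nonneg) auto

lemma gheat_mono_integrable:
  assumes "integrable gauss (\<lambda>z. f (x + sqrt t * z))" "integrable gauss (\<lambda>z. g (x + sqrt t * z))"
     "\<And>x. f x \<le> g x"
  shows "gheat t f x \<le> gheat t g x"
  unfolding gheat_def using assms by (intro integral_mono) auto

lemma gauss_integrable_shift:
  fixes f :: "real \<Rightarrow> real"
  assumes [measurable]: "f \<in> borel_measurable borel" and "\<And>x. \<bar>f x\<bar> \<le> C"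
  shows "integrable gauss (\<lambda>z. f (x + sqrt t * z))"
  using assms by (intro gauss_integrable_bounded) auto

lemma gheat_mono:
  assumes [measurable]: "f \<in> borel_measurable borel" "g \<in> borel_measurable borel"
    and "\<And>x. \<bar>f x\<bar> \<le> C" "\<And>x. \<bar>g x\<bar> \<le> D" "\<And>x. f x \<le> g x"
  shows "gheat t f x \<le> gheat t g x"
  using assms by (intro gheat_mono_integrable gauss_integrable_shift[where C=C] gauss_integrable_shift[where C=D]) auto

lemma gauss_scale: "\<sigma> > 0 \<Longrightarrow> distr gauss borel (\<lambda>z. \<sigma> * z) = density lborel (normal_density 0 \<sigma>)"
proof -
  assume s: "\<sigma> > 0"
  have "emeasure (distr gauss borel (\<lambda>z. \<sigma> * z)) A = emeasure (density lborel (normal_density 0 \<sigma>)) A"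
     if [measurable]: "A \<in> sets borel" for A
  proof -
    have "emeasure (density lborel (normal_density 0 \<sigma>)) A = (\<integral>\<^sup>+x. ennreal (normal_density 0 \<sigma> x) * indicator A x \<partial>lborel)"
      by (subst emeasure_density) auto
    also have "\<dots> = ennreal \<sigma> * (\<integral>\<^sup>+x. ennreal (normal_density 0 \<sigma> (\<sigma> * x)) * indicator A (\<sigma> * x) \<partial>lborel)"
      using s by (subst nn_integral_real_affine[where c="\<sigma>" and t=0]) auto
    also have "\<dots> = (\<integral>\<^sup>+x. ennreal (\<sigma> * normal_density 0 \<sigma> (\<sigma> * x)) * indicator A (\<sigma> * x) \<partial>lborel)"
      using s by (subst nn_integral_cmult[symmetric]) (auto simp: ennreal_mult' mult_ac)
    also have "(\<lambda>x. \<sigma> * normal_density 0 \<sigma> (\<sigma> * x)) = std_normal_density"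
      using s by (auto simp: normal_density_def fun_eq_iff real_sqrt_mult field_simps)
    also have "(\<integral>\<^sup>+x. ennreal (std_normal_density x) * indicator A (\<sigma> * x) \<partial>lborel) = (\<integral>\<^sup>+x. indicator A (\<sigma> * x) \<partial>gauss)"
      unfolding gauss_def by (subst nn_integral_density) auto
    also have "\<dots> = (\<integral>\<^sup>+x. indicator A x \<partial>distr gauss borel (\<lambda>z. \<sigma> * z))"
      by (rule nn_integral_distr[symmetric]) auto
    also have "\<dots> = emeasure (distr gauss borel (\<lambda>z. \<sigma> * z)) A"
      by simp
    finally show ?thesis by simp
  qed
  then show ?thesis by (intro measure_eqI) auto
qed

text \<open>Independent centred Gaussians add by convolution. Time 0 is treated apart because a
  normal density with standard deviation 0 is no Gaussian law.\<close>

lemma gheat_gheat: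
  assumes [measurable]: "f \<in> borel_measurable borel" and b: "\<And>x. \<bar>f x\<bar> \<le> C"
    and s: "s \<ge> 0" and t: "t \<ge> 0"
  shows "gheat s (gheat t f) x = gheat (s + t) f x"
proof (cases "s = 0 \<or> t = 0")
  case True
  then show ?thesis
  proof
    assume "t = 0"
    then have "gheat t f = f" by (auto simp: fun_eq_iff)
    then show ?thesis using \<open>t = 0\<close> by simp
  qed simp
next
  case False
  then have s: "s > 0" and t: "t > 0" using s t by auto
  let ?A = "distr gauss borel (\<lambda>z. sqrt s * z)"
  let ?B = "distr gauss borel (\<lambda>z. sqrt t * z)"
  let ?C = "distr gauss borel (\<lambda>z. sqrt (s + t) * z)"
  have pA: "prob_space ?A" "prob_space ?B" by (auto intro: gauss.prob_space_distr)
  interpret A: prob_space ?A by fact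
  interpret B: prob_space ?B by fact
  interpret AB: pair_prob_space ?A ?B ..
  have fm: "finite_measure ?A" "finite_measure ?B" by unfold_locales
  have conv: "?A \<star> ?B = ?C"
  proof -
    have "?A \<star> ?B = density lborel (\<lambda>x. \<integral>\<^sup>+y. normal_density 0 (sqrt s) (x - y) * ennreal (normal_density 0 (sqrt t) y) \<partial>lborel)"
      using s t fm by (simp add: gauss_scale convolution_density)
    also have "(\<lambda>x. \<integral>\<^sup>+y. normal_density 0 (sqrt s) (x - y) * ennreal (normal_density 0 (sqrt t) y) \<partial>lborel) = normal_density 0 (sqrt (s + t))"
      using conv_normal_density_zero_mean[of "sqrt s" "sqrt t"] s t by (simp add: ennreal_mult')
    finally show ?thesis using s t by (simp add: gauss_scale)
  qed
  have int: "integrable (?A \<Otimes>\<^sub>M ?B) (\<lambda>(a, b). f (x + a + b))"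
    using b by (intro AB.integrable_const_bound[where B=C]) auto
  have "gheat (s + t) f x = (\<integral>y. f (x + y) \<partial>?C)"
    unfolding gheat_def by (subst integral_distr) auto
  also have "\<dots> = (\<integral>p. f (x + (fst p + snd p)) \<partial>(?A \<Otimes>\<^sub>M ?B))"
    unfolding conv[symmetric] convolution_def by (subst integral_distr) (auto simp: split_beta')
  also have "\<dots> = (\<integral>a. \<integral>b. f (x + a + b) \<partial>?B \<partial>?A)"
    using AB.integral_fst'[OF int] by (simp add: split_beta' add_ac)
  also have "\<dots> = gheat s (gheat t f) x"
    unfolding gheat_def by (subst integral_distr, simp, simp, subst integral_distr) auto
  finally show ?thesis by simp
qed

section \<open>Duhamel integrals and a Gronwall lemma\<close>

text \<open>Supplies the integrability behind the exchanges of integrals in Duhamel terms, which are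
  bounded and live on bounded time ranges.\<close>

lemma integrable_pair_bounded_rectangle:
  fixes f :: "'a \<Rightarrow> 'b \<Rightarrow> real"
  assumes "sigma_finite_measure M" "sigma_finite_measure N"
    and [measurable]: "case_prod f \<in> borel_measurable (M \<Otimes>\<^sub>M N)" "A \<in> sets M" "B \<in> sets N"
    and fin: "emeasure M A < \<infinity>" "emeasure N B < \<infinity>"
    and bnd: "\<And>x y. x \<in> A \<Longrightarrow> y \<in> B \<Longrightarrow> \<bar>f x y\<bar> \<le> C"
    and out: "\<And>x y. \<not> (x \<in> A \<and> y \<in> B) \<Longrightarrow> f x y = 0"
  shows "integrable (M \<Otimes>\<^sub>M N) (case_prod f)"
proof -
  interpret M: sigma_finite_measure M by fact
  interpret N: sigma_finite_measure N by fact
  interpret pair_sigma_finite M N ..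
  have "emeasure (M \<Otimes>\<^sub>M N) (A \<times> B) < \<infinity>"
    using fin by (subst N.emeasure_pair_measure_Times) (auto simp: ennreal_mult_less_top)
  then show ?thesis
    using bnd out by (intro integrableI_bounded_set[where A="A \<times> B" and B=C]) (auto intro!: AE_I2)
qed

lemma set_integrable_Icc_bounded:
  fixes f :: "real \<Rightarrow> real"
  assumes "f \<in> borel_measurable borel" "\<And>s. s \<in> {a..b} \<Longrightarrow> \<bar>f s\<bar> \<le> C"
  shows "set_integrable lborel {a..b} f"
  unfolding set_integrable_def
  using assms by (intro integrableI_bounded_set_indicator[where B=C]) (auto simp: emeasure_lborel_Icc_eq)

lemma exp_mult_le:
  fixes a s t :: real
  assumes "0 \<le> s" "s \<le> t"
  shows "exp (- a * s) \<le> exp (\<bar>a\<bar> * t)"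
proof -
  have "- a * s \<le> \<bar>a\<bar> * s" using assms by (intro mult_right_mono) auto
  also have "\<dots> \<le> \<bar>a\<bar> * t" using assms by (intro mult_left_mono) auto
  finally show ?thesis by simp
qed

text \<open>Here \<open>a\<close> is a discount rate: rate 0 gives the integral of the mild
  equation, a positive rate the same flow with killing at that rate.\<close>

definition duhamel :: "real \<Rightarrow> (real \<Rightarrow> real \<Rightarrow> real) \<Rightarrow> real \<Rightarrow> real \<Rightarrow> real" where
  "duhamel a H t x = (\<integral>s\<in>{0..t}. exp (- a * s) * gheat s (H (t - s)) x \<partial>lborel)"

definition locally_bdd :: "(real \<Rightarrow> real \<Rightarrow> real) \<Rightarrow> bool" where
  "locally_bdd H \<longleftrightarrow> (\<forall>T. \<exists>C. \<forall>t\<in>{0..T}. \<forall>x. \<bar>H t x\<bar> \<le> C)"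

lemma duhamel_measurable [measurable]:
  assumes [measurable]: "jointly_measurable H"
  shows "jointly_measurable (duhamel a H)"
proof -
  have [measurable]: "(\<lambda>(p, s). gheat s (H (fst p - s)) (snd p)) \<in> borel_measurable ((borel \<Otimes>\<^sub>M borel) \<Otimes>\<^sub>M borel)"
    unfolding split_beta' by (rule gheat_measurable) measurable
  \<comment> \<open>The condition that s lies in [0, t] is split into indicators of s and of t - s,
    so that the moving upper limit depends measurably on the pair.\<close>
  have "(\<lambda>p. \<integral>s. (indicator {0..} s * indicator {0..} (fst p - s)) * (exp (- a * s) * gheat s (H (fst p - s)) (snd p)) \<partial>lborel)
     \<in> borel_measurable (borel \<Otimes>\<^sub>M borel)"
    by measurable
  also have "(\<lambda>p. \<integral>s. (indicator {0..} s * indicator {0..} (fst p - s)) * (exp (- a * s) * gheat s (H (fst p - s)) (snd p)) \<partial>lborel)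
      = case_prod (duhamel a H)"
    unfolding duhamel_def set_lebesgue_integral_def fun_eq_iff
    by (auto intro!: Bochner_Integration.integral_cong simp: indicator_def)
  finally show ?thesis .
qed

lemma duhamel_integrand_measurable:
  assumes [measurable]: "jointly_measurable H"
  shows "(\<lambda>s. gheat s (H (t - s)) x) \<in> borel_measurable borel"
  by (rule gheat_measurable) measurable

lemma duhamel_integrable:
  assumes [measurable]: "jointly_measurable H"
    and b: "\<And>r y. 0 \<le> r \<Longrightarrow> r \<le> t \<Longrightarrow> \<bar>H r y\<bar> \<le> C"
  shows "set_integrable lborel {0..t} (\<lambda>s. exp (- a * s) * gheat s (H (t - s)) x)"
proof (rule set_integrable_Icc_bounded)
  note duhamel_integrand_measurable[OF assms(1), measurable]
  show "(\<lambda>s. exp (- a * s) * gheat s (H (t - s)) x) \<in> borel_measurable borel" by measurable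
  fix s assume s: "s \<in> {0..t}"
  have "\<bar>gheat s (H (t - s)) x\<bar> \<le> C" using s by (intro gheat_bound b) auto
  moreover have "exp (- a * s) \<le> exp (\<bar>a\<bar> * t)" using s by (intro exp_mult_le) auto
  ultimately show "\<bar>exp (- a * s) * gheat s (H (t - s)) x\<bar> \<le> exp (\<bar>a\<bar> * t) * C"
    by (auto simp: abs_mult intro!: mult_mono)
qed

lemma duhamel_mono:
  assumes [measurable]: "jointly_measurable H"
     "jointly_measurable G"
    and b: "\<And>r y. 0 \<le> r \<Longrightarrow> r \<le> t \<Longrightarrow> \<bar>H r y\<bar> \<le> C"
    and b': "\<And>r y. 0 \<le> r \<Longrightarrow> r \<le> t \<Longrightarrow> \<bar>G r y\<bar> \<le> D"
    and le: "\<And>r y. 0 \<le> r \<Longrightarrow> r \<le> t \<Longrightarrow> H r y \<le> G r y"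
  shows "duhamel a H t x \<le> duhamel a G t x"
  unfolding duhamel_def
proof (rule set_integral_mono)
  fix s assume s: "s \<in> {0..t}"
  have "gheat s (H (t - s)) x \<le> gheat s (G (t - s)) x"
    using s by (intro gheat_mono[where C=C and D=D] b b' le) auto
  then show "exp (- a * s) * gheat s (H (t - s)) x \<le> exp (- a * s) * gheat s (G (t - s)) x"
    by simp
qed (intro duhamel_integrable[where C=C] duhamel_integrable[where C=D] assms; assumption)+

lemma duhamel_bound:
  assumes b: "\<And>r y. 0 \<le> r \<Longrightarrow> r \<le> t \<Longrightarrow> \<bar>H r y\<bar> \<le> C" 
    and [measurable]: "jointly_measurable H" and "t \<ge> 0"
  shows "\<bar>duhamel 0 H t x\<bar> \<le> C * t"
proof -
  have "\<bar>duhamel 0 H t x\<bar> \<le> (\<integral>s\<in>{0..t}. C \<partial>lborel)"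
    unfolding duhamel_def set_lebesgue_integral_def
  proof (rule order_trans[OF integral_abs_bound], rule integral_mono)
    show "integrable lborel (\<lambda>s. \<bar>indicat_real {0..t} s *\<^sub>R (exp (- 0 * s) * gheat s (H (t - s)) x)\<bar>)"
      using duhamel_integrable[of H t C 0 x, OF assms(2) b] unfolding set_integrable_def by (rule integrable_abs)
    show "integrable lborel (\<lambda>s. indicat_real {0..t} s *\<^sub>R C)"
      using set_integrable_Icc_bounded[of "\<lambda>_. C" 0 t "\<bar>C\<bar>"] unfolding set_integrable_def by simp
    show "\<bar>indicat_real {0..t} s *\<^sub>R (exp (- 0 * s) * gheat s (H (t - s)) x)\<bar> \<le> indicat_real {0..t} s *\<^sub>R C" for s
      by (auto simp: indicator_def intro!: gheat_bound b)
  qed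
  also have "\<dots> = C * t" using \<open>t \<ge> 0\<close> by (simp add: set_integral_const)
  finally show ?thesis .
qed

lemma gheat_add:
  assumes "f \<in> borel_measurable borel" "\<And>x. \<bar>f x\<bar> \<le> C" "g \<in> borel_measurable borel" "\<And>x. \<bar>g x\<bar> \<le> D"
  shows "gheat t (\<lambda>y. f y + g y) x = gheat t f x + gheat t g x"
  unfolding gheat_def using assms by (intro Bochner_Integration.integral_add gauss_integrable_shift)

lemma gheat_cmult: "gheat t (\<lambda>y. c * f y) x = c * gheat t f x"
  unfolding gheat_def by simp

lemma duhamel_cmult: "duhamel a (\<lambda>t y. c * H t y) t x = c * duhamel a H t x"
  unfolding duhamel_def gheat_cmult by (subst set_integral_mult_right[symmetric]) (simp add: mult_ac)

lemma duhamel_add: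
  assumes [measurable]: "jointly_measurable H"
     "jointly_measurable G"
    and b: "\<And>r y. 0 \<le> r \<Longrightarrow> r \<le> t \<Longrightarrow> \<bar>H r y\<bar> \<le> C"
    and b': "\<And>r y. 0 \<le> r \<Longrightarrow> r \<le> t \<Longrightarrow> \<bar>G r y\<bar> \<le> D"
  shows "duhamel a (\<lambda>t y. H t y + G t y) t x = duhamel a H t x + duhamel a G t x"
proof -
  have "duhamel a (\<lambda>t y. H t y + G t y) t x = 
    (\<integral>s\<in>{0..t}. exp (- a * s) * gheat s (H (t - s)) x + exp (- a * s) * gheat s (G (t - s)) x \<partial>lborel)"
    unfolding duhamel_def
  proof (rule set_lebesgue_integral_cong)
    show "\<forall>s. s \<in> {0..t} \<longrightarrow> exp (- a * s) * gheat s (\<lambda>y. H (t - s) y + G (t - s) y) x =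
        exp (- a * s) * gheat s (H (t - s)) x + exp (- a * s) * gheat s (G (t - s)) x"
    proof safe
      fix s assume s: "s \<in> {0..t}"
      have "gheat s (\<lambda>y. H (t - s) y + G (t - s) y) x = gheat s (H (t - s)) x + gheat s (G (t - s)) x"
        using s by (intro gheat_add[where C=C and D=D] b b') auto
      then show "exp (- a * s) * gheat s (\<lambda>y. H (t - s) y + G (t - s) y) x =
        exp (- a * s) * gheat s (H (t - s)) x + exp (- a * s) * gheat s (G (t - s)) x"
        by (simp add: distrib_left)
    qed
  qed simp
  also have "\<dots> = duhamel a H t x + duhamel a G t x"
    unfolding duhamel_def
    by (intro set_integral_add duhamel_integrable[where C=C] duhamel_integrable[where C=D] b b') auto
  finally show ?thesis .
qed

lemma duhamel_cong: "(\<And>r y. 0 \<le> r \<Longrightarrow> r \<le> t \<Longrightarrow> H r y = G r y) \<Longrightarrow> duhamel a H t x = duhamel a G t x"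
  unfolding duhamel_def by (intro set_lebesgue_integral_cong) (auto simp: gheat_def)


section \<open>Changing the discount rate of a Duhamel equation\<close>

lemma FTC_exp_resolvent:
  fixes a b q :: real
  assumes "q \<ge> 0"
  shows "(b - a) * (\<integral>s\<in>{0..q}. exp (- b * s) * exp (- a * (q - s)) \<partial>lborel) = exp (- a * q) - exp (- b * q)"
proof -
  \<comment> \<open>The antiderivative of the convolution of two exponentials. The factor
    \<open>b - a\<close> is kept on the left so that equal rates need no separate case.\<close>
  define F where "F = (\<lambda>s. - exp (- b * s - a * (q - s)))"
  have "(\<integral>s. ((b - a) * (exp (- b * s) * exp (- a * (q - s)))) * indicator {0..q} s \<partial>lborel) = F q - F 0"
  proof (rule integral_FTC_Icc_real[OF assms])
    fix s show "(F has_real_derivative (b - a) * (exp (- b * s) * exp (- a * (q - s)))) (at s)"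
      unfolding F_def by (auto intro!: derivative_eq_intros simp: exp_add[symmetric] algebra_simps)
  qed (auto intro!: continuous_intros)
  then show ?thesis
    unfolding set_lebesgue_integral_def F_def
    by (subst integral_mult_right_zero[symmetric]) (simp add: mult_ac)
qed

text \<open>Fubini moves the outer flow under the time integral, where it merges with the inner flow
  by the semigroup law.\<close>

lemma gheat_duhamel:
  assumes [measurable]: "jointly_measurable H"
    and b: "\<And>r y. 0 \<le> r \<Longrightarrow> r \<le> T \<Longrightarrow> \<bar>H r y\<bar> \<le> C" and s: "s \<ge> 0" 
  shows "gheat s (duhamel a H T) x = (\<integral>r\<in>{0..T}. exp (- a * r) * gheat (s + r) (H (T - r)) x \<partial>lborel)"
proof -
  interpret pair_sigma_finite gauss lborel ..
  define K where "K z r = indicator {0..T} r * (exp (- a * r) * gheat r (H (T - r)) (x + sqrt s * z))" for z r :: real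
  have [measurable]: "(\<lambda>p. gheat (snd p) (H (T - snd p)) (x + sqrt s * fst p)) \<in> borel_measurable (borel \<Otimes>\<^sub>M borel)"
    by (rule gheat_measurable) measurable
  have mK: "case_prod K \<in> borel_measurable (gauss \<Otimes>\<^sub>M lborel)"
    unfolding K_def split_beta' by measurable
  have "integrable (gauss \<Otimes>\<^sub>M lborel) (case_prod K)"
  proof (rule integrable_pair_bounded_rectangle[OF _ _ mK, where A=UNIV and B="{0..T}" and C="exp (\<bar>a\<bar> * T) * C"])
    fix z r assume r: "r \<in> {0..T}"
    have "\<bar>gheat r (H (T - r)) (x + sqrt s * z)\<bar> \<le> C" using r by (intro gheat_bound b) auto
    moreover have "exp (- a * r) \<le> exp (\<bar>a\<bar> * T)" using r by (intro exp_mult_le) auto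
    ultimately show "\<bar>K z r\<bar> \<le> exp (\<bar>a\<bar> * T) * C"
      using r by (auto simp: K_def abs_mult intro!: mult_mono)
  qed (auto simp: K_def gauss.emeasure_eq_measure emeasure_lborel_Icc_eq intro: gauss.sigma_finite_measure_axioms lborel.sigma_finite_measure_axioms)
  then have "(\<integral>r. (\<integral>z. K z r \<partial>gauss) \<partial>lborel) = (\<integral>z. (\<integral>r. K z r \<partial>lborel) \<partial>gauss)"
    by (rule Fubini_integral)
  also have "\<dots> = gheat s (duhamel a H T) x"
    unfolding gheat_def[of s] duhamel_def K_def set_lebesgue_integral_def by simp
  finally have "gheat s (duhamel a H T) x = (\<integral>r. (\<integral>z. K z r \<partial>gauss) \<partial>lborel)" ..
  also have "\<dots> = (\<integral>r\<in>{0..T}. exp (- a * r) * gheat (s + r) (H (T - r)) x \<partial>lborel)"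
    unfolding set_lebesgue_integral_def
  proof (rule Bochner_Integration.integral_cong)
    fix r show "(\<integral>z. K z r \<partial>gauss) = indicat_real {0..T} r *\<^sub>R (exp (- a * r) * gheat (s + r) (H (T - r)) x)"
    proof (cases "r \<in> {0..T}")
      case True
      then have "gheat (s + r) (H (T - r)) x = gheat s (gheat r (H (T - r))) x"
        using s by (intro gheat_gheat[symmetric, where C=C] b) auto
      then show ?thesis using True unfolding K_def gheat_def[of s] by simp
    qed (simp add: K_def)
  qed simp
  finally show ?thesis .
qed

text \<open>The substitution q = s + r turns the nested integral into one over the triangle s <= q;
  swapping the order isolates the convolution of the two exponentials, which is known in closed
  form.\<close>

lemma triangle_Fubini:
  fixes G :: "real \<Rightarrow> real"
  assumes [measurable]: "G \<in> borel_measurable borel" and b: "\<And>q. 0 \<le> q \<Longrightarrow> q \<le> t \<Longrightarrow> \<bar>G q\<bar> \<le> C" 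
  shows "(\<integral>s\<in>{0..t}. exp (- b * s) * (\<integral>r\<in>{0..t - s}. exp (- a * r) * G (s + r) \<partial>lborel) \<partial>lborel)
       = (\<integral>q\<in>{0..t}. (\<integral>s\<in>{0..q}. exp (- b * s) * exp (- a * (q - s)) \<partial>lborel) * G q \<partial>lborel)"
proof -
  define K where "K s q = indicator {0..t} s * (indicator {0..t} q * (indicator {0..} (q - s) * (exp (- b * s) * exp (- a * (q - s)) * G q)))" for s q :: real
  have mK: "case_prod K \<in> borel_measurable (lborel \<Otimes>\<^sub>M lborel)"
    unfolding K_def split_beta' by measurable
  have "integrable (lborel \<Otimes>\<^sub>M lborel) (case_prod K)"
  proof (rule integrable_pair_bounded_rectangle[OF _ _ mK, where A="{0..t}" and B="{0..t}" and C="exp (\<bar>b\<bar> * t) * exp (\<bar>a\<bar> * t) * C"])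
    fix s q assume sq: "s \<in> {0..t}" "q \<in> {0..t}"
    then have C: "\<bar>G q\<bar> \<le> C" "0 \<le> C" using b[of q] by auto
    show "\<bar>K s q\<bar> \<le> exp (\<bar>b\<bar> * t) * exp (\<bar>a\<bar> * t) * C"
    proof (cases "q \<ge> s")
      case True
      have "exp (- b * s) * exp (- a * (q - s)) * \<bar>G q\<bar> \<le> exp (\<bar>b\<bar> * t) * exp (\<bar>a\<bar> * t) * C"
        using sq True by (intro mult_mono C exp_mult_le mult_nonneg_nonneg) auto
      then show ?thesis using sq True by (simp add: K_def abs_mult)
    qed (use C in \<open>simp add: K_def\<close>)
  qed (auto simp: K_def emeasure_lborel_Icc_eq intro: lborel.sigma_finite_measure_axioms)
  then have F: "(\<integral>q. (\<integral>s. K s q \<partial>lborel) \<partial>lborel) = (\<integral>s. (\<integral>q. K s q \<partial>lborel) \<partial>lborel)"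
    by (rule lborel_pair.Fubini_integral)
  have "(\<integral>s. K s q \<partial>lborel) = indicator {0..t} q * ((\<integral>s\<in>{0..q}. exp (- b * s) * exp (- a * (q - s)) \<partial>lborel) * G q)" for q
  proof -
    have "(\<integral>s. K s q \<partial>lborel) = (\<integral>s. (indicator {0..t} q * G q) * (indicator {0..q} s * (exp (- b * s) * exp (- a * (q - s)))) \<partial>lborel)"
      by (intro Bochner_Integration.integral_cong) (auto simp: K_def indicator_def)
    then show ?thesis unfolding set_lebesgue_integral_def by (subst (asm) integral_mult_right_zero) simp
  qed
  moreover have "(\<integral>q. K s q \<partial>lborel) = indicator {0..t} s * (exp (- b * s) * (\<integral>r\<in>{0..t - s}. exp (- a * r) * G (s + r) \<partial>lborel))" for s
  proof -
    have "(\<integral>q. K s q \<partial>lborel) = (\<integral>r. K s (s + 1 * r) \<partial>lborel)"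
      by (subst lborel_integral_real_affine[where c=1 and t=s]) auto
    also have "\<dots> = (\<integral>r. (indicator {0..t} s * exp (- b * s)) * (indicator {0..t - s} r * (exp (- a * r) * G (s + r))) \<partial>lborel)"
      by (intro Bochner_Integration.integral_cong) (auto simp: K_def indicator_def)
    finally show ?thesis unfolding set_lebesgue_integral_def by (subst (asm) integral_mult_right_zero) simp
  qed
  ultimately show ?thesis using F unfolding set_lebesgue_integral_def by simp
qed

text \<open>With \<open>a = 0\<close> and large \<open>b\<close> this moves enough of the reaction term to the other side to make the Duhamel kernel positive, so that comparison arguments apply.\<close>

lemma resolvent_change:
  assumes H[measurable]: "jointly_measurable H" and bH: "locally_bdd H"
    and f[measurable]: "f \<in> borel_measurable borel" and bf: "\<And>x. \<bar>f x\<bar> \<le> F"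
    and u[measurable]: "jointly_measurable u" and bu: "locally_bdd u"
    and eq: "\<And>t x. t \<ge> 0 \<Longrightarrow> u t x = exp (- a * t) * gheat t f x + duhamel a H t x"
    and t: "t \<ge> 0"
  shows "u t x = exp (- b * t) * gheat t f x + duhamel b (\<lambda>t x. H t x + (b - a) * u t x) t x"
proof -
  obtain C where C: "\<And>r y. 0 \<le> r \<Longrightarrow> r \<le> t \<Longrightarrow> \<bar>H r y\<bar> \<le> C"
    using bH unfolding locally_bdd_def by (meson atLeastAtMost_iff)
  obtain D where D: "\<And>r y. 0 \<le> r \<Longrightarrow> r \<le> t \<Longrightarrow> \<bar>u r y\<bar> \<le> D"
    using bu unfolding locally_bdd_def by (meson atLeastAtMost_iff)
  define G where "G q = gheat q (H (t - q)) x" for q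
  have G[measurable]: "G \<in> borel_measurable borel"
    unfolding G_def by (rule duhamel_integrand_measurable) simp
  have bG: "\<bar>G q\<bar> \<le> C" if "0 \<le> q" "q \<le> t" for q
    unfolding G_def using that by (intro gheat_bound C) auto
  define E where "E q = (\<integral>s\<in>{0..q}. exp (- b * s) * exp (- a * (q - s)) \<partial>lborel)" for q
  have E: "(b - a) * E q = exp (- a * q) - exp (- b * q)" if "q \<ge> 0" for q
    unfolding E_def by (rule FTC_exp_resolvent[OF that])
  define J where "J s = (\<integral>r\<in>{0..t - s}. exp (- a * r) * G (s + r) \<partial>lborel)" for s
  \<comment> \<open>The equation at time \<open>t - s\<close> is pushed forward by time s: the heat
    terms merge into \<open>gheat t f x\<close>, and the source contributes only through
    \<open>J s\<close>.\<close>
  have hsu: "gheat s (u (t - s)) x = exp (- a * (t - s)) * gheat t f x + J s" if "0 \<le> s" "s \<le> t" for s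
  proof -
    have "u (t - s) = (\<lambda>y. exp (- a * (t - s)) * gheat (t - s) f y + duhamel a H (t - s) y)"
      using that by (auto simp: eq)
    then have "gheat s (u (t - s)) x = gheat s (\<lambda>y. exp (- a * (t - s)) * gheat (t - s) f y + duhamel a H (t - s) y) x"
      by simp
    also have "\<dots> = gheat s (\<lambda>y. exp (- a * (t - s)) * gheat (t - s) f y) x + gheat s (duhamel a H (t - s)) x"
    proof (rule gheat_add)
      show "\<bar>exp (- a * (t - s)) * gheat (t - s) f y\<bar> \<le> exp (- a * (t - s)) * F" for y
        by (auto simp: abs_mult intro!: mult_left_mono gheat_bound bf)
      \<comment> \<open>The Duhamel term is bounded as the difference of the bounded
        \<open>u\<close> and the heat term.\<close>
      then have "\<bar>duhamel a H (t - s) y\<bar> \<le> D + exp (- a * (t - s)) * F" for y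
        using that D[of "t - s" y] eq[of "t - s" y] by (smt (verit))
      then show "\<bar>duhamel a H (t - s) y\<bar> \<le> D + exp (- a * (t - s)) * F" for y .
    qed measurable
    also have "gheat s (\<lambda>y. exp (- a * (t - s)) * gheat (t - s) f y) x = exp (- a * (t - s)) * gheat t f x"
      using that by (simp add: gheat_cmult gheat_gheat[OF f bf])
    also have "gheat s (duhamel a H (t - s)) x = (\<integral>r\<in>{0..t - s}. exp (- a * r) * gheat (s + r) (H (t - s - r)) x \<partial>lborel)"
      using that by (intro gheat_duhamel[where C=C] C) auto
    also have "\<dots> = J s"
      unfolding J_def G_def by (simp add: algebra_simps)
    finally show ?thesis .
  qed
  have "duhamel b u t x = (\<integral>s\<in>{0..t}. exp (- b * s) * (exp (- a * (t - s)) * gheat t f x + J s) \<partial>lborel)"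
    unfolding duhamel_def by (intro set_lebesgue_integral_cong) (auto simp: hsu)
  also have "\<dots> = (\<integral>s\<in>{0..t}. (exp (- b * s) * exp (- a * (t - s))) * gheat t f x + exp (- b * s) * J s \<partial>lborel)"
    by (simp add: algebra_simps)
  also have "\<dots> = (\<integral>s\<in>{0..t}. (exp (- b * s) * exp (- a * (t - s))) * gheat t f x \<partial>lborel) + (\<integral>s\<in>{0..t}. exp (- b * s) * J s \<partial>lborel)"
  proof (rule set_integral_add)
    show i1: "set_integrable lborel {0..t} (\<lambda>s. (exp (- b * s) * exp (- a * (t - s))) * gheat t f x)"
      by (intro borel_integrable_atLeastAtMost' continuous_intros)
    have "set_integrable lborel {0..t} (\<lambda>s. exp (- b * s) * gheat s (u (t - s)) x)"
      by (intro duhamel_integrable[where C=D] D u)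
    from set_integral_diff(1)[OF this i1]
    show "set_integrable lborel {0..t} (\<lambda>s. exp (- b * s) * J s)"
      by (rule set_integrable_cong[THEN iffD1, rotated 3]) (auto simp: hsu algebra_simps)
  qed
  also have "\<dots> = E t * gheat t f x + (\<integral>q\<in>{0..t}. E q * G q \<partial>lborel)"
    unfolding J_def E_def using triangle_Fubini[OF G bG, of t b a] by simp
  finally have 1: "(b - a) * duhamel b u t x = (exp (- a * t) - exp (- b * t)) * gheat t f x + (\<integral>q\<in>{0..t}. (exp (- a * q) - exp (- b * q)) * G q \<partial>lborel)"
  proof -
    assume "duhamel b u t x = E t * gheat t f x + (\<integral>q\<in>{0..t}. E q * G q \<partial>lborel)"
    then have "(b - a) * duhamel b u t x = (b - a) * E t * gheat t f x + (b - a) * (\<integral>q\<in>{0..t}. E q * G q \<partial>lborel)"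
      by (simp add: algebra_simps)
    also have "(b - a) * (\<integral>q\<in>{0..t}. E q * G q \<partial>lborel) = (\<integral>q\<in>{0..t}. (b - a) * (E q * G q) \<partial>lborel)"
      by simp
    also have "\<dots> = (\<integral>q\<in>{0..t}. (exp (- a * q) - exp (- b * q)) * G q \<partial>lborel)"
      using E by (intro set_lebesgue_integral_cong) auto
    finally show ?thesis using E[OF t] by simp
  qed
  have i: "set_integrable lborel {0..t} (\<lambda>q. exp (- c * q) * G q)" for c
    unfolding G_def by (intro duhamel_integrable[where C=C] C H)
  have "(\<integral>q\<in>{0..t}. (exp (- a * q) - exp (- b * q)) * G q \<partial>lborel) = duhamel a H t x - duhamel b H t x"
    unfolding duhamel_def G_def[symmetric] unfolding set_integral_diff(2)[OF i i, symmetric] left_diff_distrib ..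
  moreover have "duhamel b (\<lambda>t x. H t x + (b - a) * u t x) t x = duhamel b H t x + (b - a) * duhamel b u t x"
    unfolding duhamel_cmult[symmetric]
  proof (rule duhamel_add)
    show "\<bar>(b - a) * u r y\<bar> \<le> \<bar>b - a\<bar> * D" if "0 \<le> r" "r \<le> t" for r y
      unfolding abs_mult using that by (intro mult_left_mono D) auto
  qed (use C in auto)
  ultimately show ?thesis using eq[OF t, of x] 1 by (simp add: algebra_simps)
qed

section \<open>Gronwall lemma by Picard iteration\<close>

lemma integral_power_shift:
  fixes k t :: real
  assumes "t \<ge> 0"
  shows "(\<integral>s\<in>{0..t}. k * ((k * (t - s)) ^ n / fact n) \<partial>lborel) = (k * t) ^ Suc n / fact (Suc n)"
proof -
  define F where "F s = - ((k * (t - s)) ^ Suc n / fact (Suc n))" for s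
  have "(\<integral>s. (k * ((k * (t - s)) ^ n / fact n)) * indicator {0..t} s \<partial>lborel) = F t - F 0"
  proof (rule integral_FTC_Icc_real[OF assms])
    fix s :: real
    have "(F has_real_derivative (real (Suc n) * (k * (t - s)) ^ n * k / fact (Suc n))) (at s)"
      unfolding F_def by (auto intro!: derivative_eq_intros simp: algebra_simps simp del: of_nat_Suc fact_Suc power_Suc)
    also have "real (Suc n) * (k * (t - s)) ^ n * k / fact (Suc n) = k * ((k * (t - s)) ^ n / fact n)"
      by (simp add: field_simps del: of_nat_Suc)
    finally show "(F has_real_derivative k * ((k * (t - s)) ^ n / fact n)) (at s)" .
  qed (auto intro!: continuous_intros)
  then show ?thesis
    unfolding set_lebesgue_integral_def F_def by (simp add: mult_ac)
qed

text \<open>One Picard step: integrating k (k r)^n / n! over time produces the next term of the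
  exponential series. It serves both to iterate a Gronwall inequality and to sum the differences of
  Picard iterates.\<close>

lemma duhamel_power_bound:
  assumes H[measurable]: "jointly_measurable H"
    and a: "a \<ge> 0" and t: "t \<ge> 0" and k: "k \<ge> 0" and B: "B \<ge> 0"
    and H0: "\<And>r y. 0 \<le> r \<Longrightarrow> r \<le> t \<Longrightarrow> \<bar>H r y\<bar> \<le> k * (B * ((k * r) ^ n / fact n))"
  shows "\<bar>duhamel a H t x\<bar> \<le> B * ((k * t) ^ Suc n / fact (Suc n))"
proof -
  let ?C = "k * (B * ((k * t) ^ n / fact n))"
  have bC: "\<bar>H r y\<bar> \<le> ?C" if "0 \<le> r" "r \<le> t" for r y
    using H0[OF that, of y] k B that
    by (elim order_trans) (intro mult_left_mono divide_right_mono power_mono, auto)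
  have ii: "set_integrable lborel {0..t} (\<lambda>s. B * (k * ((k * (t - s)) ^ n / fact n)))"
    by (intro borel_integrable_atLeastAtMost' continuous_intros) auto
  have "\<bar>duhamel a H t x\<bar> \<le> (\<integral>s\<in>{0..t}. B * (k * ((k * (t - s)) ^ n / fact n)) \<partial>lborel)"
    unfolding duhamel_def set_lebesgue_integral_def
  proof (rule order_trans[OF integral_abs_bound], rule integral_mono)
    show "integrable lborel (\<lambda>s. \<bar>indicat_real {0..t} s *\<^sub>R (exp (- a * s) * gheat s (H (t - s)) x)\<bar>)"
      using duhamel_integrable[of H t ?C a x, OF H bC] unfolding set_integrable_def by (rule integrable_abs)
    show "integrable lborel (\<lambda>s. indicat_real {0..t} s *\<^sub>R (B * (k * ((k * (t - s)) ^ n / fact n))))"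
      using ii unfolding set_integrable_def .
    show "\<bar>indicat_real {0..t} s *\<^sub>R (exp (- a * s) * gheat s (H (t - s)) x)\<bar> \<le> indicat_real {0..t} s *\<^sub>R (B * (k * ((k * (t - s)) ^ n / fact n)))" for s
    proof (cases "s \<in> {0..t}")
      case True
      then have "\<bar>gheat s (H (t - s)) x\<bar> \<le> k * (B * ((k * (t - s)) ^ n / fact n))"
        by (intro gheat_bound H0) auto
      then have "exp (- a * s) * \<bar>gheat s (H (t - s)) x\<bar> \<le> 1 * (k * (B * ((k * (t - s)) ^ n / fact n)))"
        using True a by (intro mult_mono) auto
      then show ?thesis using True by (simp add: abs_mult mult_ac)
    qed simp
  qed
  also have "\<dots> = B * ((k * t) ^ Suc n / fact (Suc n))"
    by (subst set_integral_mult_right) (use integral_power_shift[OF t, of k n] in simp)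
  finally show ?thesis .
qed

lemma power_over_fact_small:
  fixes z B d :: real
  assumes "\<And>n. d \<le> B * (z ^ n / fact n)"
  shows "d \<le> 0"
proof -
  have "(\<lambda>n. B * (z ^ n / fact n)) \<longlonglongrightarrow> B * 0"
    using summable_LIMSEQ_zero[OF summable_exp[of z]]
    by (intro tendsto_mult_left) (simp add: field_simps)
  then show ?thesis using assms by (intro LIMSEQ_le_const[of _ "0"]) auto
qed

text \<open>Only the positive part of \<open>d\<close> is fed back, so the lemma acts as a
  comparison principle. The upper bound \<open>B\<close> seeds an iteration whose bounds B' (k t)^n
  / n! tend to 0; no lower bound on \<open>d\<close> enters, which lets \<open>d\<close> contain an
  unbounded supersolution with a minus sign.\<close>

lemma gronwall:
  assumes d[measurable]: "jointly_measurable d"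
    and a: "a \<ge> 0" and k: "k \<ge> 0"
    and B: "\<And>t x. 0 \<le> t \<Longrightarrow> t \<le> T \<Longrightarrow> d t x \<le> B"
    and ineq: "\<And>t x. 0 \<le> t \<Longrightarrow> t \<le> T \<Longrightarrow> d t x \<le> duhamel a (\<lambda>t x. k * max 0 (d t x)) t x"
    and t: "0 \<le> t" "t \<le> T"
  shows "d t x \<le> 0"
proof -
  define B' where "B' = max 0 B"
  have "\<forall>t x. 0 \<le> t \<longrightarrow> t \<le> T \<longrightarrow> d t x \<le> B' * ((k * t) ^ n / fact n)" for n
  proof (induction n)
    case 0
    have "d t x \<le> B'" if "0 \<le> t" "t \<le> T" for t x
      using B[OF that, of x] by (auto simp: B'_def)
    then show ?case by simp
  next
    case (Suc n)
    show ?case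
    proof (intro allI impI)
      fix t x assume t: "0 \<le> t" "t \<le> T"
      have "d t x \<le> \<bar>duhamel a (\<lambda>t x. k * max 0 (d t x)) t x\<bar>"
        using ineq[OF t, of x] by simp
      also have "\<dots> \<le> B' * ((k * t) ^ Suc n / fact (Suc n))"
      proof (rule duhamel_power_bound)
        fix r y assume r: "0 \<le> r" "r \<le> t"
        have "0 \<le> B' * ((k * r) ^ n / fact n)"
          using r k by (auto simp: B'_def)
        then have "max 0 (d r y) \<le> B' * ((k * r) ^ n / fact n)"
          using Suc r t by auto
        then show "\<bar>k * max 0 (d r y)\<bar> \<le> k * (B' * ((k * r) ^ n / fact n))"
          using k by (subst abs_of_nonneg) (auto intro!: mult_left_mono simp del: times_divide_eq_right)
      qed (use t a k in \<open>auto simp: B'_def\<close>)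
      finally show "d t x \<le> B' * ((k * t) ^ Suc n / fact (Suc n))" .
    qed
  qed
  then show ?thesis using t by (intro power_over_fact_small[of _ B' "k * t"]) auto
qed

section \<open>Existence and uniqueness of mild solutions\<close>

text \<open>Dominated convergence twice, in the Gaussian variable and then in time; it identifies
  the limit of the Picard iterates.\<close>

lemma duhamel_tendsto:
  assumes [measurable]: "\<And>n. case_prod (H n) \<in> borel_measurable (borel \<Otimes>\<^sub>M borel)"
    "jointly_measurable G"
    and b: "\<And>n r y. 0 \<le> r \<Longrightarrow> r \<le> t \<Longrightarrow> \<bar>H n r y\<bar> \<le> C"
    and lim: "\<And>r y. 0 \<le> r \<Longrightarrow> r \<le> t \<Longrightarrow> (\<lambda>n. H n r y) \<longlonglongrightarrow> G r y"
  shows "(\<lambda>n. duhamel a (H n) t x) \<longlonglongrightarrow> duhamel a G t x"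
proof -
  have hl: "(\<lambda>n. gheat s (H n (t - s)) x) \<longlonglongrightarrow> gheat s (G (t - s)) x" if "0 \<le> s" "s \<le> t" for s
    unfolding gheat_def
  proof (rule integral_dominated_convergence[where w="\<lambda>_. C"])
    show "AE z in gauss. (\<lambda>n. H n (t - s) (x + sqrt s * z)) \<longlonglongrightarrow> G (t - s) (x + sqrt s * z)"
      using that by (intro AE_I2 lim) auto
    show "AE z in gauss. norm (H n (t - s) (x + sqrt s * z)) \<le> C" for n
      using that by (intro AE_I2) (auto intro!: b)
  qed auto
  note duhamel_integrand_measurable[measurable]
  show ?thesis
    unfolding duhamel_def set_lebesgue_integral_def
  proof (rule integral_dominated_convergence[where w="\<lambda>s. indicator {0..t} s * (exp (- a * s) * C)"])
    have "set_integrable lborel {0..t} (\<lambda>s. exp (- a * s) * C)"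
      by (intro borel_integrable_atLeastAtMost' continuous_intros)
    then show "integrable lborel (\<lambda>s. indicator {0..t} s * (exp (- a * s) * C))"
      unfolding set_integrable_def by simp
    show "AE s in lborel. (\<lambda>n. indicat_real {0..t} s *\<^sub>R (exp (- a * s) * gheat s (H n (t - s)) x))
       \<longlonglongrightarrow> indicat_real {0..t} s *\<^sub>R (exp (- a * s) * gheat s (G (t - s)) x)"
      by (intro AE_I2) (auto simp: indicator_def intro!: tendsto_intros hl)
    show "AE s in lborel. norm (indicat_real {0..t} s *\<^sub>R (exp (- a * s) * gheat s (H n (t - s)) x))
        \<le> indicator {0..t} s * (exp (- a * s) * C)" for n
      by (intro AE_I2) (auto simp: indicator_def abs_mult intro!: gheat_bound b)
  qed measurable
qed

text \<open>What existence and comparison use of the branching mechanism. It grows quadratically,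
  hence Lipschitz bounds on bounded ranges only; it is controlled for nonnegative arguments, hence
  \<open>max 0\<close> in the measurability clause; the linear lower bound excludes blow-up.\<close>

locale mechanism =
  fixes \<Psi> :: "real \<Rightarrow> real \<Rightarrow> real" and K :: real
  assumes Psi_meas: "(\<lambda>(x, l). \<Psi> x (max 0 l)) \<in> borel_measurable (borel \<Otimes>\<^sub>M borel)"
    and Psi_0 [simp]: "\<Psi> x 0 = 0"
    and Psi_lower: "l \<ge> 0 \<Longrightarrow> - K * l \<le> \<Psi> x l"
    and K_nonneg: "K \<ge> 0"
    and Psi_Lip: "M \<ge> 0 \<Longrightarrow> \<exists>L\<ge>0. \<forall>x. \<forall>l\<in>{0..M}. \<forall>l'\<in>{0..M}. \<bar>\<Psi> x l - \<Psi> x l'\<bar> \<le> L * \<bar>l - l'\<bar>"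
begin

lemma Psi_comp_measurable:
  assumes [measurable]: "jointly_measurable u" and nn: "\<And>t x. u t x \<ge> 0"
  shows "jointly_measurable (\<lambda>t x. \<Psi> x (u t x))"
proof -
  have "(\<lambda>p. (\<lambda>(x, l). \<Psi> x (max 0 l)) (snd p, u (fst p) (snd p))) \<in> borel_measurable (borel \<Otimes>\<^sub>M borel)"
    by (rule measurable_compose[OF _ Psi_meas]) measurable
  then show ?thesis using nn by (simp add: split_beta' max_def)
qed

lemma Psi_comp_locally_bdd:
  assumes "\<And>t x. u t x \<ge> 0" "locally_bdd u"
  shows "locally_bdd (\<lambda>t x. \<Psi> x (u t x))"
  unfolding locally_bdd_def
proof
  fix T
  obtain C where C: "\<And>t x. t \<in> {0..T} \<Longrightarrow> \<bar>u t x\<bar> \<le> C"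
    using assms(2) unfolding locally_bdd_def by blast
  obtain L where L: "L \<ge> 0" "\<And>x l l'. l\<in>{0..max 0 C} \<Longrightarrow> l'\<in>{0..max 0 C} \<Longrightarrow> \<bar>\<Psi> x l - \<Psi> x l'\<bar> \<le> L * \<bar>l - l'\<bar>"
    using Psi_Lip[of "max 0 C"] by auto
  have "\<bar>\<Psi> x (u t x)\<bar> \<le> L * C" if "t \<in> {0..T}" for t x
    using L(2)[of "u t x" 0 x] C[OF that, of x] assms(1)[of t x] L(1)
    by (auto intro: order_trans mult_left_mono)
  then show "\<exists>C. \<forall>t\<in>{0..T}. \<forall>x. \<bar>\<Psi> x (u t x)\<bar> \<le> C" by blast
qed

lemma mild_duhamel_eq:
  assumes [measurable]: "jointly_measurable u" and nn: "\<And>t x. u t x \<ge> 0"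
    and [measurable]: "f \<in> borel_measurable borel" and t: "t \<ge> 0"
  shows "heat t f x - (\<integral>s \<in> {0..t}. heat s (\<lambda>y. \<Psi> y (u (t - s) y)) x \<partial>lborel)
     = gheat t f x - duhamel 0 (\<lambda>t x. \<Psi> x (u t x)) t x"
proof -
  note Psi_comp_measurable[OF assms(1) nn, measurable]
  have "(\<integral>s \<in> {0..t}. heat s (\<lambda>y. \<Psi> y (u (t - s) y)) x \<partial>lborel) = duhamel 0 (\<lambda>t x. \<Psi> x (u t x)) t x"
    unfolding duhamel_def by (intro set_lebesgue_integral_cong) (auto intro!: heat_eq_hs)
  then show ?thesis using t by (simp add: heat_eq_hs)
qed

lemma mild_solutionD:
  assumes "mild_solution \<Psi> f u" and [measurable]: "f \<in> borel_measurable borel"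
  shows mild_nonneg: "u t x \<ge> 0" and mild_measurable: "jointly_measurable u"
    and mild_locally_bdd: "locally_bdd u" 
    and mild_eq: "t \<ge> 0 \<Longrightarrow> u t x = gheat t f x - duhamel 0 (\<lambda>t x. \<Psi> x (u t x)) t x"
proof -
  show nn: "u t x \<ge> 0" for t x
    using assms(1) unfolding mild_solution_def by (cases "t < 0") (auto simp: not_less)
  show m: "jointly_measurable u"
    using assms(1) unfolding mild_solution_def borel_prod by (simp add: split_beta')
  show "locally_bdd u" using assms(1) unfolding mild_solution_def locally_bdd_def by blast
  show "u t x = gheat t f x - duhamel 0 (\<lambda>t x. \<Psi> x (u t x)) t x" if "t \<ge> 0"
    using assms that unfolding mild_duhamel_eq[OF m nn assms(2) that, symmetric] mild_solution_def by blast
qed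

text \<open>When \<open>k\<close> is at least a Lipschitz constant of \<open>\<Psi>\<close> on the
  range of \<open>u\<close>, the new source \<open>k * u t x - \<Psi> x (u t x)\<close> is
  nonnegative, so sign information passes through the flow.\<close>

lemma mild_kform:
  assumes u: "mild_solution \<Psi> f u" and [measurable]: "f \<in> borel_measurable borel" and bf: "\<And>x. \<bar>f x\<bar> \<le> F"
    and t: "t \<ge> 0"
  shows "u t x = exp (- k * t) * gheat t f x + duhamel k (\<lambda>t x. k * u t x - \<Psi> x (u t x)) t x"
proof -
  note [measurable] = mild_measurable[OF u assms(2)]
  note nn = mild_nonneg[OF u assms(2)]
  note [measurable] = Psi_comp_measurable[OF mild_measurable[OF u assms(2)] nn]
  have 1: "locally_bdd (\<lambda>t x. - \<Psi> x (u t x))"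
    using Psi_comp_locally_bdd[OF nn mild_locally_bdd[OF u assms(2)]] by (simp add: locally_bdd_def)
  have "u t x = exp (- k * t) * gheat t f x + duhamel k (\<lambda>t x. - \<Psi> x (u t x) + (k - 0) * u t x) t x"
  proof (rule resolvent_change[OF _ 1 _ bf])
    fix t x :: real assume "t \<ge> 0"
    then show "u t x = exp (- 0 * t) * gheat t f x + duhamel 0 (\<lambda>t x. - \<Psi> x (u t x)) t x"
      using mild_eq[OF u assms(2)] duhamel_cmult[of 0 "-1"] by simp
  qed (use t mild_locally_bdd[OF u assms(2)] in auto)
  then show ?thesis by (simp add: algebra_simps)
qed

text \<open>Both solutions are bounded on [0, T], which gives a common Lipschitz constant
  \<open>L\<close>; the absolute value of their difference then satisfies a Gronwall
  inequality.\<close>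

lemma mild_unique:
  assumes u: "mild_solution \<Psi> f u" and v: "mild_solution \<Psi> f v" and [measurable]: "f \<in> borel_measurable borel"
  shows "u = v"
proof (intro ext)
  fix T x
  note mu[measurable] = mild_measurable[OF u assms(3)] and mv[measurable] = mild_measurable[OF v assms(3)]
  note nu = mild_nonneg[OF u assms(3)] and nv = mild_nonneg[OF v assms(3)]
  note bu = mild_locally_bdd[OF u assms(3)] and bv = mild_locally_bdd[OF v assms(3)]
  note mPu[measurable] = Psi_comp_measurable[OF mu nu] and mPv[measurable] = Psi_comp_measurable[OF mv nv]
  show "u T x = v T x"
  proof (cases "T \<ge> 0")
    case True
    obtain C where C: "\<And>t x. t \<in> {0..T} \<Longrightarrow> \<bar>u t x\<bar> \<le> C" using bu unfolding locally_bdd_def by blast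
    obtain D where D: "\<And>t x. t \<in> {0..T} \<Longrightarrow> \<bar>v t x\<bar> \<le> D" using bv unfolding locally_bdd_def by blast
    define M where "M = max 0 (max C D)"
    have inM: "u t x \<in> {0..M}" "v t x \<in> {0..M}" if "t \<in> {0..T}" for t x
      using C[OF that, of x] D[OF that, of x] nu[of t x] nv[of t x] by (auto simp: M_def)
    obtain L where L: "L \<ge> 0" "\<And>x l l'. l\<in>{0..M} \<Longrightarrow> l'\<in>{0..M} \<Longrightarrow> \<bar>\<Psi> x l - \<Psi> x l'\<bar> \<le> L * \<bar>l - l'\<bar>"
      using Psi_Lip[of M] by (auto simp: M_def)
    have bnd: "\<bar>\<Psi> x l\<bar> \<le> L * M" if "l \<in> {0..M}" for x l
      using L(2)[OF that, of 0 x] that L(1) by (auto intro: order_trans mult_left_mono)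
    have "\<bar>u T x - v T x\<bar> \<le> 0"
    proof (rule gronwall[where a=0 and k=L and T=T and B=M and d="\<lambda>t x. \<bar>u t x - v t x\<bar>"])
      fix t x assume t: "0 \<le> t" "t \<le> T"
      show "\<bar>u t x - v t x\<bar> \<le> M" using inM[of t x] t by auto
      define D where "D t x = \<Psi> x (v t x) + (-1) * \<Psi> x (u t x)" for t x
      have eq: "u t x - v t x = duhamel 0 D t x"
        unfolding D_def mild_eq[OF u assms(3) t(1)] mild_eq[OF v assms(3) t(1)]
        by (subst duhamel_add[where C="L * M" and D="L * M"]; (subst duhamel_cmult)?; use t in \<open>auto intro!: bnd inM\<close>)
      have mD[measurable]: "jointly_measurable D"
        unfolding D_def by measurable
      have DL: "\<bar>D r y\<bar> \<le> L * \<bar>u r y - v r y\<bar>" if "0 \<le> r" "r \<le> t" for r y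
        using L(2)[of "v r y" "u r y" y] inM[of r y] that t by (auto simp: D_def abs_minus_commute)
      have DM: "L * \<bar>u r y - v r y\<bar> \<le> L * M" if "0 \<le> r" "r \<le> t" for r y
        using inM[of r y] that t L(1) by (intro mult_left_mono) auto
      have D1: "\<bar>D r y\<bar> \<le> L * M" "D r y \<le> L * \<bar>u r y - v r y\<bar>" "- D r y \<le> L * \<bar>u r y - v r y\<bar>" if "0 \<le> r" "r \<le> t" for r y
        using DL[OF that, of y] DM[OF that, of y] by auto
      have "duhamel 0 D t x \<le> duhamel 0 (\<lambda>t x. L * max 0 \<bar>u t x - v t x\<bar>) t x"
        by (rule duhamel_mono[where C="L * M" and D="L * M"]) (use D1 DM L(1) in \<open>auto simp: abs_mult\<close>)
      moreover have "duhamel 0 (\<lambda>t x. (-1) * D t x) t x \<le> duhamel 0 (\<lambda>t x. L * max 0 \<bar>u t x - v t x\<bar>) t x"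
        by (rule duhamel_mono[where C="L * M" and D="L * M"]) (use D1 DM L(1) in \<open>auto simp: abs_mult\<close>)
      ultimately show "\<bar>u t x - v t x\<bar> \<le> duhamel 0 (\<lambda>t x. L * max 0 \<bar>u t x - v t x\<bar>) t x"
        unfolding eq duhamel_cmult by auto
    qed (use True L in auto)
    then show ?thesis by simp
  next
    case False
    \<comment> \<open>Mild solutions vanish at negative times by definition, which makes them unique
      as functions on the whole line.\<close>
    then show ?thesis using u v unfolding mild_solution_def by auto
  qed
qed


text \<open>Picard iteration wants a globally Lipschitz source, so the argument of the mechanism is
  clipped to [0, m t]. The solution of the clipped equation is then shown to stay in that range,
  where clipping does nothing.\<close>

lemma mild_exists:
  assumes f[measurable]: "f \<in> borel_measurable borel" and f0: "\<And>x. 0 \<le> f x" and fF: "\<And>x. f x \<le> F"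
  shows "\<exists>u. mild_solution \<Psi> f u"
proof -
  have F: "F \<ge> 0" using f0[of 0] fF[of 0] by simp
  \<comment> \<open>The solution of m' = K m started from F, which is the fastest growth that the
    lower bound on \<open>\<Psi>\<close> allows.\<close>
  define m where "m t = F * exp (K * t)" for t :: real
  define \<Phi> where "\<Phi> t x l = \<Psi> x (max 0 (min l (m t)))" for t x l
  have m0: "m t \<ge> 0" for t using F by (simp add: m_def)
  have m_mono: "m r \<le> m T" if "r \<le> T" for r T
    using that F K_nonneg by (auto simp: m_def intro!: mult_left_mono)
  have \<Phi>_meas: "jointly_measurable (\<lambda>t x. \<Phi> t x (u t x))"
    if [measurable]: "jointly_measurable u" for u
  proof -
    have [measurable]: "m \<in> borel_measurable borel" unfolding m_def by measurable
    have "(\<lambda>p. (\<lambda>(x, l). \<Psi> x (max 0 l)) (snd p, min (u (fst p) (snd p)) (m (fst p)))) \<in> borel_measurable (borel \<Otimes>\<^sub>M borel)"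
      by (rule measurable_compose[OF _ Psi_meas]) measurable
    then show ?thesis by (simp add: split_beta' \<Phi>_def)
  qed
  have \<Phi>_Lip: "\<exists>L\<ge>0. \<forall>t\<in>{0..T}. \<forall>x l l'. \<bar>\<Phi> t x l - \<Phi> t x l'\<bar> \<le> L * \<bar>l - l'\<bar>" for T
  proof -
    obtain L where L: "L \<ge> 0" "\<And>x l l'. l\<in>{0..m T} \<Longrightarrow> l'\<in>{0..m T} \<Longrightarrow> \<bar>\<Psi> x l - \<Psi> x l'\<bar> \<le> L * \<bar>l - l'\<bar>"
      using Psi_Lip[OF m0, of T] by auto
    have "\<bar>\<Phi> t x l - \<Phi> t x l'\<bar> \<le> L * \<bar>l - l'\<bar>" if "t \<in> {0..T}" for t x l l'
    proof -
      have "m t \<le> m T" using that by (intro m_mono) auto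
      then have "\<bar>\<Phi> t x l - \<Phi> t x l'\<bar> \<le> L * \<bar>max 0 (min l (m t)) - max 0 (min l' (m t))\<bar>"
        unfolding \<Phi>_def using m0[of t] by (intro L) auto
      also have "\<dots> \<le> L * \<bar>l - l'\<bar>" using L(1) by (intro mult_left_mono) auto
      finally show ?thesis .
    qed
    then show ?thesis using L(1) by blast
  qed
  have \<Phi>_bdd: "\<exists>C\<ge>0. \<forall>t\<in>{0..T}. \<forall>x l. \<bar>\<Phi> t x l\<bar> \<le> C" for T
  proof -
    obtain L where L: "L \<ge> 0" "\<And>t x l l'. t\<in>{0..T} \<Longrightarrow> \<bar>\<Phi> t x l - \<Phi> t x l'\<bar> \<le> L * \<bar>l - l'\<bar>"
      using \<Phi>_Lip[of T] by blast
    have "\<bar>\<Phi> t x l\<bar> \<le> L * m T" if "t \<in> {0..T}" for t x l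
    proof -
      have "\<Phi> t x 0 = 0" "\<Phi> t x l = \<Phi> t x (max 0 (min l (m t)))"
        using m0[of t] by (auto simp: \<Phi>_def)
      then have "\<bar>\<Phi> t x l\<bar> \<le> L * \<bar>max 0 (min l (m t))\<bar>"
        using L(2)[OF that, of x "max 0 (min l (m t))" 0] by simp
      also have "\<dots> \<le> L * m T"
        using m_mono[of t T] m0[of t] that L(1) by (intro mult_left_mono) auto
      finally show ?thesis .
    qed
    then show ?thesis using L(1) m0[of T] by (meson mult_nonneg_nonneg)
  qed
  define U where "U = rec_nat (\<lambda>t x. 0) (\<lambda>n v t x. gheat t f x - duhamel 0 (\<lambda>t x. \<Phi> t x (v t x)) t x)"
  have U0: "U 0 = (\<lambda>t x. 0)" and US: "U (Suc n) t x = gheat t f x - duhamel 0 (\<lambda>t x. \<Phi> t x (U n t x)) t x" for n t x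
    by (auto simp: U_def)
  have hsf[measurable]: "jointly_measurable (\<lambda>t. gheat t f)"
    unfolding split_beta' by (rule gheat_measurable[where H="\<lambda>_. f"]) measurable
  have U_meas[measurable]: "jointly_measurable (U n)" for n
  proof (induction n)
    case (Suc n)
    note \<Phi>_meas[OF Suc, measurable]
    have "jointly_measurable (\<lambda>t x. gheat t f x - duhamel 0 (\<lambda>t x. \<Phi> t x (U n t x)) t x)"
      by measurable
    then show ?case by (simp add: US split_beta')
  qed (simp add: U0)
  note PU[measurable] = \<Phi>_meas[OF U_meas]
  have conv: "convergent (\<lambda>n. U n t x)" if t: "t \<ge> 0" for t x
  proof -
    obtain L where L: "L \<ge> 0" "\<And>s x l l'. s\<in>{0..t} \<Longrightarrow> \<bar>\<Phi> s x l - \<Phi> s x l'\<bar> \<le> L * \<bar>l - l'\<bar>"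
      using \<Phi>_Lip[of t] by blast
    obtain C where C: "C \<ge> 0" "\<And>s x l. s\<in>{0..t} \<Longrightarrow> \<bar>\<Phi> s x l\<bar> \<le> C"
      using \<Phi>_bdd[of t] by blast
    \<comment> \<open>\<open>F\<close> bounds the heat term of the first iterate and
      \<open>C * t\<close> its Duhamel term.\<close>
    define B where "B = F + C * t"
    have step: "\<forall>r y. 0 \<le> r \<longrightarrow> r \<le> t \<longrightarrow> \<bar>U (Suc n) r y - U n r y\<bar> \<le> B * ((L * r) ^ n / fact n)" for n
    proof (induction n)
      case 0
      have "\<bar>U (Suc 0) r y - U 0 r y\<bar> \<le> B * ((L * r) ^ 0 / fact 0)" if r: "0 \<le> r" "r \<le> t" for r y
      proof -
        have "\<bar>gheat r f y\<bar> \<le> F" using f0 fF by (intro gheat_bound) auto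
        moreover have "\<bar>duhamel 0 (\<lambda>t x. \<Phi> t x (U 0 t x)) r y\<bar> \<le> C * r"
          using r by (intro duhamel_bound C) auto
        moreover have "C * r \<le> C * t" using r C by (intro mult_left_mono)
        ultimately show ?thesis
          unfolding US B_def U0 by simp
      qed
      then show ?case by blast
    next
      case (Suc n)
      show ?case
      proof (intro allI impI)
        fix r y assume r: "0 \<le> r" "r \<le> t"
        define D where "D t x = \<Phi> t x (U n t x) + (-1) * \<Phi> t x (U (Suc n) t x)" for t x
        have [measurable]: "jointly_measurable D" unfolding D_def by measurable
        have "U (Suc (Suc n)) r y - U (Suc n) r y = duhamel 0 D r y"
          unfolding D_def US[of "Suc n" r y] US[of n r y]
          by (subst duhamel_add[where C=C and D=C]; (subst duhamel_cmult)?; use r in \<open>auto intro!: C\<close>)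
        also have "\<bar>duhamel 0 D r y\<bar> \<le> B * ((L * r) ^ Suc n / fact (Suc n))"
        proof (rule duhamel_power_bound)
          fix s z assume s: "0 \<le> s" "s \<le> r"
          have "\<bar>D s z\<bar> \<le> L * \<bar>U n s z - U (Suc n) s z\<bar>"
            using L(2)[of s z "U n s z" "U (Suc n) s z"] s r by (auto simp: D_def)
          also have "\<dots> \<le> L * (B * ((L * s) ^ n / fact n))"
            using Suc s r L(1) by (intro mult_left_mono) (auto simp: abs_minus_commute)
          finally show "\<bar>D s z\<bar> \<le> L * (B * ((L * s) ^ n / fact n))" .
        qed (use r L(1) F C(1) in \<open>auto simp: B_def\<close>)
        finally show "\<bar>U (Suc (Suc n)) r y - U (Suc n) r y\<bar> \<le> B * ((L * r) ^ Suc n / fact (Suc n))" .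
      qed
    qed
    have "\<bar>U (Suc n) t x - U n t x\<bar> \<le> B * ((L * t) ^ n / fact n)" for n
      using step[of n] t by simp
    then have bd: "norm (U (Suc n) t x - U n t x) \<le> B * (inverse (fact n) * (L * t) ^ n)" for n
      by (simp add: divide_inverse mult.commute)
    have "summable (\<lambda>n. B * (inverse (fact n) * (L * t) ^ n))"
      by (intro summable_mult summable_exp)
    then have "summable (\<lambda>n. U (Suc n) t x - U n t x)"
      by (rule summable_comparison_test'[where N=0]) (rule bd)
    then have "(\<lambda>n. \<Sum>i<n. U (Suc i) t x - U i t x) \<longlonglongrightarrow> (\<Sum>n. U (Suc n) t x - U n t x)"
      by (rule summable_LIMSEQ)
    then show ?thesis
      using sum_lessThan_telescope[of "\<lambda>n. U n t x"] by (auto simp: U0 convergent_def)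
  qed
  define u where "u t x = (if t < 0 then 0 else lim (\<lambda>n. U n t x))" for t x
  have u_lim: "(\<lambda>n. U n t x) \<longlonglongrightarrow> u t x" if "t \<ge> 0" for t x
    using conv[OF that, of x] that by (simp add: u_def convergent_LIMSEQ_iff)
  have u_meas[measurable]: "jointly_measurable u"
  proof -
    have "(\<lambda>p. if fst p < 0 then 0 else lim (\<lambda>n. U n (fst p) (snd p))) \<in> borel_measurable (borel \<Otimes>\<^sub>M borel)"
      by measurable
    then show ?thesis by (simp add: u_def split_beta')
  qed
  note Pu[measurable] = \<Phi>_meas[OF u_meas]
  have u_eq: "u t x = gheat t f x - duhamel 0 (\<lambda>t x. \<Phi> t x (u t x)) t x" if t: "t \<ge> 0" for t x
  proof -
    obtain L where L: "L \<ge> 0" "\<And>s x l l'. s\<in>{0..t} \<Longrightarrow> \<bar>\<Phi> s x l - \<Phi> s x l'\<bar> \<le> L * \<bar>l - l'\<bar>"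
      using \<Phi>_Lip[of t] by blast
    obtain C where C: "C \<ge> 0" "\<And>s x l. s\<in>{0..t} \<Longrightarrow> \<bar>\<Phi> s x l\<bar> \<le> C"
      using \<Phi>_bdd[of t] by blast
    have "(\<lambda>n. gheat t f x - duhamel 0 (\<lambda>t x. \<Phi> t x (U n t x)) t x) \<longlonglongrightarrow> gheat t f x - duhamel 0 (\<lambda>t x. \<Phi> t x (u t x)) t x"
    proof (intro tendsto_intros duhamel_tendsto[where C=C])
      fix r y assume r: "0 \<le> r" "r \<le> t"
      have "(\<lambda>n. L * \<bar>U n r y - u r y\<bar>) \<longlonglongrightarrow> L * 0"
        using u_lim[OF r(1), of y] by (intro tendsto_mult_left tendsto_rabs_zero) (simp add: LIM_zero)
      then have lim0: "(\<lambda>n. L * \<bar>U n r y - u r y\<bar>) \<longlonglongrightarrow> 0" by simp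
      have "norm (\<Phi> r y (U n r y) - \<Phi> r y (u r y)) \<le> L * \<bar>U n r y - u r y\<bar>" for n
        unfolding real_norm_def using r by (intro L(2)) simp
      then show "(\<lambda>n. \<Phi> r y (U n r y)) \<longlonglongrightarrow> \<Phi> r y (u r y)"
        by (intro LIM_zero_cancel[OF Lim_null_comparison[OF _ lim0]] always_eventually allI)
    qed (use C(2) in simp_all)
    then have "(\<lambda>n. U (Suc n) t x) \<longlonglongrightarrow> gheat t f x - duhamel 0 (\<lambda>t x. \<Phi> t x (u t x)) t x"
      by (simp add: US)
    then show ?thesis using LIMSEQ_Suc[OF u_lim[OF t, of x]] LIMSEQ_unique by blast
  qed
  have P_locally_bdd: "locally_bdd (\<lambda>t x. - \<Phi> t x (u t x))"
    using \<Phi>_bdd unfolding locally_bdd_def by (metis abs_minus_cancel)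
  have u_locally_bdd: "locally_bdd u"
    unfolding locally_bdd_def
  proof
    fix T
    obtain C where C: "C \<ge> 0" "\<And>s x l. s\<in>{0..T} \<Longrightarrow> \<bar>\<Phi> s x l\<bar> \<le> C"
      using \<Phi>_bdd[of T] by blast
    have "\<bar>u t x\<bar> \<le> F + C * T" if "t \<in> {0..T}" for t x
    proof -
      have "\<bar>gheat t f x\<bar> \<le> F" using f0 fF by (intro gheat_bound) auto
      moreover have "\<bar>duhamel 0 (\<lambda>t x. \<Phi> t x (u t x)) t x\<bar> \<le> C * t"
        using that by (intro duhamel_bound C) auto
      moreover have "C * t \<le> C * T" using that C(1) by (intro mult_left_mono) auto
      ultimately show ?thesis using u_eq[of t x] that by auto
    qed
    then show "\<exists>C. \<forall>t\<in>{0..T}. \<forall>x. \<bar>u t x\<bar> \<le> C" by blast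
  qed
  have u_k: "u t x = exp (- k * t) * gheat t f x + duhamel k (\<lambda>t x. - \<Phi> t x (u t x) + k * u t x) t x" if "t \<ge> 0" for t x k
  proof -
    have "u t x = exp (- k * t) * gheat t f x + duhamel k (\<lambda>t x. - \<Phi> t x (u t x) + (k - 0) * u t x) t x"
    proof (rule resolvent_change[OF _ P_locally_bdd f _ u_meas u_locally_bdd _ that])
      show "\<bar>f x\<bar> \<le> F" for x using f0 fF by simp
      fix t x :: real assume "t \<ge> 0"
      then show "u t x = exp (- 0 * t) * gheat t f x + duhamel 0 (\<lambda>t x. - \<Phi> t x (u t x)) t x"
        using u_eq duhamel_cmult[of 0 "-1"] by simp
    qed measurable
    then show ?thesis by simp
  qed
  have bounds: "0 \<le> u T x \<and> u T x \<le> m T" if T: "T \<ge> 0" for T x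
  proof -
    obtain L where L: "L \<ge> 0" "\<And>s x l l'. s\<in>{0..T} \<Longrightarrow> \<bar>\<Phi> s x l - \<Phi> s x l'\<bar> \<le> L * \<bar>l - l'\<bar>"
      using \<Phi>_Lip[of T] by blast
    obtain C where C: "C \<ge> 0" "\<And>s x l. s\<in>{0..T} \<Longrightarrow> \<bar>\<Phi> s x l\<bar> \<le> C"
      using \<Phi>_bdd[of T] by blast
    obtain D where D: "\<And>s x. s\<in>{0..T} \<Longrightarrow> \<bar>u s x\<bar> \<le> D"
      using u_locally_bdd unfolding locally_bdd_def by blast
    \<comment> \<open>The source after discounting at the Lipschitz constant \<open>L\<close>; with
      this rate it is nonnegative wherever \<open>u\<close> is.\<close>
    define G where "G t x = - \<Phi> t x (u t x) + L * u t x" for t x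
    have [measurable]: "jointly_measurable G" unfolding G_def by measurable
    have GB: "\<bar>G s x\<bar> \<le> C + L * D" if "s \<in> {0..T}" for s x
    proof -
      have "\<bar>L * u s x\<bar> \<le> L * D" unfolding abs_mult using L(1) D[OF that] by (auto intro: mult_left_mono)
      then show ?thesis using C(2)[OF that, of x "u s x"] unfolding G_def by linarith
    qed
    have ab: "\<bar>L * max 0 z\<bar> \<le> L * B" if "z \<le> B" "0 \<le> B" for z B
      unfolding abs_mult using that L(1) by (auto intro!: mult_left_mono)
    have D0: "D \<ge> 0" using D[of 0 0] T by auto
    have u0: "0 \<le> u t x" if t: "0 \<le> t" "t \<le> T" for t x
    proof -
      have "- u t x \<le> 0"
      proof (rule gronwall[where a=L and k=L and T=T and B=D and d="\<lambda>t x. - u t x"])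
        show "- u t x \<le> D" if "0 \<le> t" "t \<le> T" for t x using D[of t x] that by auto
        fix t x :: real assume t: "0 \<le> t" "t \<le> T"
        have "0 \<le> gheat t f x" by (intro gheat_nonneg f0)
        then have "- u t x \<le> - duhamel L G t x"
          using u_k[OF t(1), of x L, folded G_def] by simp
        also have "\<dots> = duhamel L (\<lambda>t x. (-1) * G t x) t x" unfolding duhamel_cmult by simp
        also have "\<dots> \<le> duhamel L (\<lambda>t x. L * max 0 (- u t x)) t x"
        proof (rule duhamel_mono[where C="C + L * D" and D="L * D"])
          fix r y assume r: "0 \<le> r" "r \<le> t"
          then have rT: "r \<in> {0..T}" using t by auto
          show "\<bar>-1 * G r y\<bar> \<le> C + L * D" using GB[OF rT, of y] by simp
          show "\<bar>L * max 0 (- u r y)\<bar> \<le> L * D" using D[OF rT, of y] D0 by (intro ab) auto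
          show "-1 * G r y \<le> L * max 0 (- u r y)"
          proof (cases "u r y \<ge> 0")
            case True
            have "\<Phi> r y (u r y) \<le> L * u r y"
              using L(2)[OF rT, of y "u r y" 0] True by (simp add: \<Phi>_def m0 max_def)
            then show ?thesis using True by (simp add: G_def)
          next
            case False
            \<comment> \<open>Below zero the clipped mechanism vanishes, so \<open>G\<close> equals
              \<open>L * u\<close> and only the negative part of \<open>u\<close> feeds
              back.\<close>
            then have "\<Phi> r y (u r y) = 0" using m0[of r] by (auto simp: \<Phi>_def)
            then show ?thesis using False by (simp add: G_def)
          qed
        qed measurable
        finally show "- u t x \<le> duhamel L (\<lambda>t x. L * max 0 (- u t x)) t x" .
      qed (use t L in auto)
      then show ?thesis by simp
    qed
    have mT: "jointly_measurable (\<lambda>t x. (L + K) * m t)"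
      unfolding m_def by measurable
    have um: "u t x - m t \<le> 0" if t: "0 \<le> t" "t \<le> T" for t x
    proof (rule gronwall[where a=L and k=L and T=T and B=D and d="\<lambda>t x. u t x - m t"])
      show "jointly_measurable (\<lambda>t x. u t x - m t)"
        unfolding m_def by measurable
      show "u t x - m t \<le> D" if "0 \<le> t" "t \<le> T" for t x using D[of t x] that m0[of t] by auto
      fix t x :: real assume t: "0 \<le> t" "t \<le> T"
      have "gheat t f x \<le> gheat t (\<lambda>_. F) x"
        using f0 fF F by (intro gheat_mono[where C=F and D=F]) auto
      then have 1: "u t x \<le> exp (- L * t) * F + duhamel L G t x"
        using u_k[OF t(1), of x L, folded G_def] by simp
      \<comment> \<open>\<open>m\<close> solves the same discounted equation with source
        \<open>(L + K) * m\<close>; comparing it with the equation of \<open>u\<close> leaves only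
        the excess of \<open>u\<close> over \<open>m\<close>.\<close>
      have 2: "m t = exp (- L * t) * F + duhamel L (\<lambda>t x. (L + K) * m t) t x"
      proof -
        have "duhamel L (\<lambda>t x. (L + K) * m t) t x = (\<integral>s\<in>{0..t}. F * (L - - K) * (exp (- L * s) * exp (- (- K) * (t - s))) \<partial>lborel)"
          unfolding duhamel_def by (simp add: m_def mult_ac)
        also have "\<dots> = F * ((L - - K) * (\<integral>s\<in>{0..t}. exp (- L * s) * exp (- (- K) * (t - s)) \<partial>lborel))"
          by (simp only: set_integral_mult_right mult.assoc)
        also have "\<dots> = F * (exp (K * t) - exp (- L * t))"
          unfolding FTC_exp_resolvent[OF t(1)] by simp
        finally show ?thesis by (simp add: m_def algebra_simps)
      qed
      have "duhamel L (\<lambda>t x. (L + K) * m t + L * max 0 (u t x - m t)) t x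
        = duhamel L (\<lambda>t x. (L + K) * m t) t x + duhamel L (\<lambda>t x. L * max 0 (u t x - m t)) t x"
      proof (rule duhamel_add[where C="(L + K) * m t" and D="L * D", OF mT])
        fix r y assume r: "0 \<le> r" "r \<le> t"
        then have rT: "r \<in> {0..T}" using t by auto
        show "\<bar>L * max 0 (u r y - m r)\<bar> \<le> L * D" using D[OF rT, of y] D0 m0[of r] by (intro ab) auto
        show "\<bar>(L + K) * m r\<bar> \<le> (L + K) * m t"
          unfolding abs_mult using L(1) K_nonneg m0[of r] m_mono[OF r(2)] by (auto intro!: mult_left_mono)
      qed (unfold m_def, measurable)
      moreover have "duhamel L G t x \<le> duhamel L (\<lambda>t x. (L + K) * m t + L * max 0 (u t x - m t)) t x"
      proof (rule duhamel_mono[where C="C + L * D" and D="(L + K) * m t + L * D"])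
        fix r y assume r: "0 \<le> r" "r \<le> t"
        then have rT: "r \<in> {0..T}" using t by auto
        show "\<bar>G r y\<bar> \<le> C + L * D" using GB[OF rT] .
        have "\<bar>L * max 0 (u r y - m r)\<bar> \<le> L * D" using D[OF rT, of y] D0 m0[of r] by (intro ab) auto
        moreover have "\<bar>(L + K) * m r\<bar> \<le> (L + K) * m t"
          unfolding abs_mult using L(1) K_nonneg m0[of r] m_mono[OF r(2)] by (auto intro!: mult_left_mono)
        ultimately show "\<bar>(L + K) * m r + L * max 0 (u r y - m r)\<bar> \<le> (L + K) * m t + L * D" by linarith
        \<comment> \<open>Because of the clipping from above, the mechanism sees at most
          \<open>m r\<close>, and its negative part contributes at most
          \<open>K * m r\<close>.\<close>
        define c where "c = min (u r y) (m r)"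
        have c: "c \<ge> 0" "c \<le> m r" using u0[of r y] rT m0[of r] by (auto simp: c_def)
        have "\<Phi> r y (u r y) = \<Psi> y c" using c by (simp add: \<Phi>_def c_def)
        then have "- \<Phi> r y (u r y) \<le> K * c" using Psi_lower[OF c(1), of y] by simp
        also have "\<dots> \<le> K * m r" using c K_nonneg by (intro mult_left_mono)
        finally have "G r y \<le> K * m r + L * u r y" by (simp add: G_def)
        also have "L * u r y \<le> L * (m r + max 0 (u r y - m r))"
          using L(1) by (intro mult_left_mono) auto
        finally show "G r y \<le> (L + K) * m r + L * max 0 (u r y - m r)" by (simp add: algebra_simps)
      qed (unfold m_def, measurable)
      ultimately show "u t x - m t \<le> duhamel L (\<lambda>t x. L * max 0 (u t x - m t)) t x"
        using 1 2 by linarith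
    qed (use t L in auto)
    show ?thesis using u0[of T x] um[of T x] T by auto
  qed
  have nn: "u t x \<ge> 0" for t x
    using bounds[of t x] by (cases "t < 0") (auto simp: u_def)
  have eqP: "duhamel 0 (\<lambda>t x. \<Phi> t x (u t x)) t x = duhamel 0 (\<lambda>t x. \<Psi> x (u t x)) t x" for t x
    by (rule duhamel_cong) (use bounds in \<open>auto simp: \<Phi>_def min_def max_def\<close>)
  have "mild_solution \<Psi> f u"
    unfolding mild_solution_def
  proof (intro conjI allI impI)
    fix t x :: real assume "0 \<le> t"
    then show "u t x = heat t f x - (\<integral>s \<in> {0..t}. heat s (\<lambda>y. \<Psi> y (u (t - s) y)) x \<partial>lborel)"
      unfolding mild_duhamel_eq[OF u_meas nn f \<open>0 \<le> t\<close>] using u_eq[of t x] eqP by simp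
  next
    show "(\<lambda>(t, x). u t x) \<in> borel_measurable borel" using u_meas by (simp add: borel_prod)
    show "\<exists>C. \<forall>t\<in>{0..T}. \<forall>x. \<bar>u t x\<bar> \<le> C" for T using u_locally_bdd by (auto simp: locally_bdd_def)
  next
    show "u t x = 0" if "t < 0" for t x using that by (simp add: u_def)
  qed (rule nn)
  then show ?thesis by blast
qed

text \<open>Existence and uniqueness together give the definite description in \<open>uf\<close> its
  meaning; every later property of the Laplace exponent enters through this fact.\<close>

lemma uf_mild:
  assumes "bounded_nonneg_fun f"
  shows "mild_solution \<Psi> f (uf \<Psi> f)"
proof -
  have f: "f \<in> borel_measurable borel" "\<And>x. 0 \<le> f x" using assms by (auto simp: bounded_nonneg_fun_def)
  obtain F where "\<And>x. f x \<le> F"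
    using assms unfolding bounded_nonneg_fun_def bounded_iff by (auto dest: abs_le_D1)
  from mild_exists[OF f this] obtain u where u: "mild_solution \<Psi> f u" by blast
  show ?thesis
    unfolding uf_def by (rule theI[where P="mild_solution \<Psi> f", OF u]) (rule mild_unique[OF _ u f(1)])
qed

end

section \<open>Dynkin's formula and exponential moments\<close>

lemma std_normal_density_deriv: "(std_normal_density has_real_derivative - z * std_normal_density z) (at z)"
  unfolding std_normal_density_def[abs_def]
  by (auto intro!: derivative_eq_intros simp: field_simps power2_eq_square)

lemma std_normal_density_at_top: "(std_normal_density \<longlongrightarrow> 0) at_top"
  unfolding std_normal_density_def[abs_def] by real_asymp

lemma std_normal_density_at_bot: "(std_normal_density \<longlongrightarrow> 0) at_bot"
  unfolding std_normal_density_def[abs_def] by real_asymp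

lemma tendsto_0_mult_bounded:
  fixes f g :: "real \<Rightarrow> real"
  assumes "(g \<longlongrightarrow> 0) F" "\<And>x. \<bar>f x\<bar> \<le> C"
  shows "((\<lambda>x. f x * g x) \<longlongrightarrow> 0) F"
proof (rule Lim_null_comparison)
  show "\<forall>\<^sub>F x in F. norm (f x * g x) \<le> C * \<bar>g x\<bar>"
    using assms(2) by (auto simp: abs_mult intro!: always_eventually mult_right_mono)
  show "((\<lambda>x. C * \<bar>g x\<bar>) \<longlongrightarrow> 0) F"
    using tendsto_mult_right_zero[OF tendsto_rabs_zero[OF assms(1)]] by simp
qed

text \<open>Stein's identity: the Gaussian density has derivative -z times itself, and f times the
  density vanishes at both ends of the line.\<close>

lemma gauss_integral_by_parts:
  fixes f f' :: "real \<Rightarrow> real"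
  assumes d: "\<And>z. (f has_real_derivative f' z) (at z)" and c: "\<And>z. isCont f' z"
    and b: "\<And>z. \<bar>f z\<bar> \<le> C" and b': "\<And>z. \<bar>f' z\<bar> \<le> D"
  shows "(\<integral>z. f z * z \<partial>gauss) = (\<integral>z. f' z \<partial>gauss)"
proof -
  have cf: "isCont f z" for z using d by (rule DERIV_isCont)
  have [measurable]: "f \<in> borel_measurable borel" "f' \<in> borel_measurable borel"
    using cf c by (auto intro!: borel_measurable_continuous_onI continuous_at_imp_continuous_on)
  have cn: "isCont std_normal_density z" for z
    using std_normal_density_deriv by (rule DERIV_isCont)
  have i1: "integrable lborel (\<lambda>z. std_normal_density z * f' z)"
    using gauss_integrable_bounded[of f' D] b' by (subst (asm) integrable_gauss_iff) auto
  have i2: "integrable lborel (\<lambda>z. std_normal_density z * (f z * z))"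
  proof (rule Bochner_Integration.integrable_bound)
    show "integrable lborel (\<lambda>z. C * (std_normal_density z * \<bar>z\<bar> ^ 1))"
      by (intro integrable_mult_right integrable_std_normal_moment_abs)
    show "AE z in lborel. norm (std_normal_density z * (f z * z)) \<le> norm (C * (std_normal_density z * \<bar>z\<bar> ^ 1))"
    proof (rule AE_I2)
      fix z
      have "C \<ge> 0" using b[of 0] by linarith
      have "\<bar>f z\<bar> * (std_normal_density z * \<bar>z\<bar>) \<le> C * (std_normal_density z * \<bar>z\<bar>)"
        by (intro mult_right_mono b) auto
      then show "norm (std_normal_density z * (f z * z)) \<le> norm (C * (std_normal_density z * \<bar>z\<bar> ^ 1))"
        using \<open>C \<ge> 0\<close> by (simp add: abs_mult mult_ac)
    qed
  qed measurable
  have "(LBINT z=-\<infinity>..\<infinity>. std_normal_density z * f' z - std_normal_density z * (f z * z)) = 0 - 0"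
  proof (rule interval_integral_FTC_integrable)
    show "((\<lambda>z. f z * std_normal_density z) has_vector_derivative
       std_normal_density z * f' z - std_normal_density z * (f z * z)) (at z)" for z
      unfolding has_real_derivative_iff_has_vector_derivative[symmetric]
      by (auto intro!: derivative_eq_intros d std_normal_density_deriv simp: algebra_simps)
    show "isCont (\<lambda>z. std_normal_density z * f' z - std_normal_density z * (f z * z)) z" for z
      by (intro continuous_intros cn cf c)
    show "set_integrable lborel (einterval (-\<infinity>) \<infinity>) (\<lambda>z. std_normal_density z * f' z - std_normal_density z * (f z * z))"
      unfolding einterval_eq_UNIV set_integrable_def using i1 i2 by simp
    show "(((\<lambda>z. f z * std_normal_density z) \<circ> real_of_ereal) \<longlongrightarrow> 0) (at_right (-\<infinity>))"
      unfolding ereal_tendsto_simps using std_normal_density_at_bot b by (rule tendsto_0_mult_bounded)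
    show "(((\<lambda>z. f z * std_normal_density z) \<circ> real_of_ereal) \<longlongrightarrow> 0) (at_left \<infinity>)"
      unfolding ereal_tendsto_simps using std_normal_density_at_top b by (rule tendsto_0_mult_bounded)
  qed simp
  then have "(\<integral>z. std_normal_density z * f' z - std_normal_density z * (f z * z) \<partial>lborel) = 0"
    by (simp add: interval_lebesgue_integral_def einterval_eq_UNIV set_lebesgue_integral_def)
  then show ?thesis
    using i1 i2 by (simp add: integral_gauss)
qed

lemma gauss_integrable_abs: "integrable gauss (\<lambda>z. \<bar>z\<bar>)"
  using integrable_std_normal_moment_abs[of 1] by (subst integrable_gauss_iff) auto

text \<open>f (x + r z) is differentiated along r from 0 to sqrt t; Stein's identity turns the
  factor z into r f'', and s = r^2 turns 2 r dr into ds. Working in r avoids the singular factor 1 /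
  sqrt s of a derivative in time.\<close>

lemma gheat_dynkin:
  fixes f f' f'' :: "real \<Rightarrow> real"
  assumes d: "\<And>z. (f has_real_derivative f' z) (at z)" and d': "\<And>z. (f' has_real_derivative f'' z) (at z)"
    and c: "\<And>z. isCont f'' z"
    and b0: "\<And>z. \<bar>f z\<bar> \<le> C" and b1: "\<And>z. \<bar>f' z\<bar> \<le> D" and b2: "\<And>z. \<bar>f'' z\<bar> \<le> E" and t: "t \<ge> 0"
  shows "gheat t f x = f x + duhamel 0 (\<lambda>_ y. f'' y / 2) t x"
proof -
  interpret pair_sigma_finite gauss lborel ..
  have cf: "isCont f z" and cf': "isCont f' z" for z using d d' by (auto intro: DERIV_isCont)
  have [measurable]: "f \<in> borel_measurable borel" "f' \<in> borel_measurable borel" "f'' \<in> borel_measurable borel"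
    using cf cf' c by (auto intro!: borel_measurable_continuous_onI continuous_at_imp_continuous_on)
  define R where "R = sqrt t"
  have R: "R \<ge> 0" "R\<^sup>2 = t" using t by (auto simp: R_def)
  define q where "q z r = indicator {0..R} r * (f' (x + r * z) * z)" for z r
  have mq: "case_prod q \<in> borel_measurable (gauss \<Otimes>\<^sub>M lborel)"
    unfolding q_def split_beta' by measurable
  have q1: "(\<integral>r. q z r \<partial>lborel) = f (x + R * z) - f (x + 0 * z)" for z
  proof -
    have "(\<integral>r. (f' (x + r * z) * z) * indicator {0..R} r \<partial>lborel) = f (x + R * z) - f (x + 0 * z)"
    proof (rule integral_FTC_Icc_real[OF R(1), where F="\<lambda>r. f (x + r * z)"])
      show "((\<lambda>r. f (x + r * z)) has_real_derivative f' (x + r * z) * z) (at r)" for r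
        by (rule DERIV_chain'[OF _ d]) (auto intro!: derivative_eq_intros)
      show "isCont (\<lambda>r. f' (x + r * z) * z) r" for r
        by (intro continuous_intros isCont_o2[OF _ cf'])
    qed
    then show ?thesis by (simp add: q_def mult_ac)
  qed
  have iq: "integrable lborel (q z)" for z
  proof -
    have "set_integrable lborel {0..R} (\<lambda>r. f' (x + r * z) * z)"
      by (rule set_integrable_Icc_bounded[where C="D * \<bar>z\<bar>"]) (auto simp: abs_mult intro!: mult_right_mono b1)
    then show ?thesis unfolding set_integrable_def q_def by simp
  qed
  have nq: "\<bar>q z r\<bar> \<le> indicator {0..R} r * (D * \<bar>z\<bar>)" for z r
    by (auto simp: q_def indicator_def abs_mult intro!: mult_right_mono b1)
  have "integrable (gauss \<Otimes>\<^sub>M lborel) (case_prod q)"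
  proof (rule Fubini_integrable[OF mq])
    \<comment> \<open>The integrand is unbounded in z, so the criterion for bounded rectangles does
      not apply; the first absolute Gaussian moment dominates instead.\<close>
    have "integrable gauss (\<lambda>z. R * (D * \<bar>z\<bar>))"
      by (intro integrable_mult_right gauss_integrable_abs)
    then show "integrable gauss (\<lambda>z. \<integral>r. norm (case_prod q (z, r)) \<partial>lborel)"
    proof (rule Bochner_Integration.integrable_bound)
      show "AE z in gauss. norm (\<integral>r. norm (case_prod q (z, r)) \<partial>lborel) \<le> norm (R * (D * \<bar>z\<bar>))"
      proof (rule AE_I2)
        fix z
        have "(\<integral>r. norm (q z r) \<partial>lborel) \<le> (\<integral>r. indicator {0..R} r * (D * \<bar>z\<bar>) \<partial>lborel)"
        proof (rule integral_mono)
          show "integrable lborel (\<lambda>r. indicator {0..R} r * (D * \<bar>z\<bar>))"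
            using set_integrable_Icc_bounded[of "\<lambda>_. D * \<bar>z\<bar>" 0 R "\<bar>D * \<bar>z\<bar>\<bar>"] by (simp add: set_integrable_def)
        qed (use iq nq in \<open>auto intro: integrable_norm\<close>)
        also have "\<dots> = R * (D * \<bar>z\<bar>)" using R by simp
        finally show "norm (\<integral>r. norm (case_prod q (z, r)) \<partial>lborel) \<le> norm (R * (D * \<bar>z\<bar>))"
          by (simp add: abs_of_nonneg Bochner_Integration.integral_nonneg)
      qed
    qed (use mq in measurable)
    show "AE z in gauss. integrable lborel (\<lambda>r. case_prod q (z, r))" using iq by simp
  qed
  then have "(\<integral>r. (\<integral>z. q z r \<partial>gauss) \<partial>lborel) = (\<integral>z. (\<integral>r. q z r \<partial>lborel) \<partial>gauss)"
    by (rule Fubini_integral)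
  also have "\<dots> = gheat t f x - f x"
    unfolding q1 gheat_def R_def using gauss.prob_space gauss_integrable_shift[of f C x t] b0 by simp
  finally have 1: "gheat t f x - f x = (\<integral>r. (\<integral>z. q z r \<partial>gauss) \<partial>lborel)" ..
  define g where "g s = gheat s f'' x" for s
  have "(\<integral>z. q z r \<partial>gauss) = g (r\<^sup>2) / 2 * (2 * r) * indicator {0..R} r" for r
  proof (cases "r \<in> {0..R}")
    case True
    have "(\<integral>z. f' (x + r * z) * z \<partial>gauss) = (\<integral>z. f'' (x + r * z) * r \<partial>gauss)"
    proof (rule gauss_integral_by_parts)
      show "((\<lambda>z. f' (x + r * z)) has_real_derivative f'' (x + r * z) * r) (at z)" for z
        by (rule DERIV_chain'[OF _ d']) (auto intro!: derivative_eq_intros)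
      show "isCont (\<lambda>z. f'' (x + r * z) * r) z" for z
        by (intro continuous_intros isCont_o2[OF _ c])
      show "\<bar>f' (x + r * z)\<bar> \<le> D" for z by (rule b1)
      show "\<bar>f'' (x + r * z) * r\<bar> \<le> E * \<bar>r\<bar>" for z
        unfolding abs_mult by (intro mult_right_mono b2) simp
    qed
    then show ?thesis using True by (simp add: q_def g_def gheat_def)
  qed (simp add: q_def)
  then have 2: "gheat t f x - f x = (\<integral>r. g (r\<^sup>2) / 2 * (2 * r) * indicator {0..R} r \<partial>lborel)"
    unfolding 1 by simp
  have "set_integrable lborel {0..t} (\<lambda>s. g s / 2)"
    unfolding g_def
  proof (rule set_integrable_Icc_bounded[where C="E / 2"])
    show "(\<lambda>s. gheat s f'' x / 2) \<in> borel_measurable borel"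
      using duhamel_integrand_measurable[of "\<lambda>_. f''" 0 x] by (intro borel_measurable_divide) auto
    show "\<bar>gheat s f'' x / 2\<bar> \<le> E / 2" for s
      using gheat_bound[of f'' E s x] b2 by simp
  qed
  then have 3: "set_integrable lborel {0\<^sup>2..R\<^sup>2} (\<lambda>s. g s / 2)" using R by simp
  have "(\<integral>s. g s / 2 * indicator {0\<^sup>2..R\<^sup>2} s \<partial>lborel) = (\<integral>r. g (r\<^sup>2) / 2 * (2 * r) * indicator {0..R} r \<partial>lborel)"
    by (rule integral_substitution(2)[where g="\<lambda>r. r\<^sup>2" and g'="\<lambda>r. 2 * r" and a=0 and b=R, OF 3]) (use R in \<open>auto intro!: derivative_eq_intros continuous_intros\<close>)
  then have "gheat t f x - f x = (\<integral>s\<in>{0..t}. g s / 2 \<partial>lborel)"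
    using 2 R by (simp add: set_lebesgue_integral_def mult_ac)
  also have "\<dots> = duhamel 0 (\<lambda>_ y. f'' y / 2) t x"
    unfolding duhamel_def g_def using gheat_cmult[of _ "1/2"] by (intro set_lebesgue_integral_cong) auto
  finally show ?thesis by simp
qed

text \<open>Completing the square: the exponential factor shifts the mean of the Gaussian to
  c.\<close>

lemma gauss_exp:
  shows gauss_exp_integrable: "integrable gauss (\<lambda>z. exp (c * z))"
    and gauss_exp_integral: "(\<integral>z. exp (c * z) \<partial>gauss) = exp (c\<^sup>2 / 2)"
proof -
  have eq: "std_normal_density z * exp (c * z) = exp (c\<^sup>2 / 2) * normal_density c 1 z" for z
    by (simp add: normal_density_def exp_add[symmetric] power2_eq_square field_simps)
  show "integrable gauss (\<lambda>z. exp (c * z))"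
    by (subst integrable_gauss_iff) (auto simp: eq)
  show "(\<integral>z. exp (c * z) \<partial>gauss) = exp (c\<^sup>2 / 2)"
    by (subst integral_gauss) (auto simp: eq)
qed

text \<open>An unbounded eigenfunction of the heat flow. For m = sqrt (2 \<lambda>) the factor is
  exp (\<lambda> t), which links the growth rate in time to the decay rate in space.\<close>

lemma gheat_cosh:
  fixes m x t :: real
  assumes t: "t \<ge> 0"
  shows gheat_cosh_integrable: "integrable gauss (\<lambda>z. cosh (m * (x + sqrt t * z)))"
    and gheat_cosh_eq: "gheat t (\<lambda>x. cosh (m * x)) x = exp (m\<^sup>2 * t / 2) * cosh (m * x)"
proof -
  have eq: "cosh (m * (x + sqrt t * z)) = exp (m * x) / 2 * exp ((m * sqrt t) * z) + exp (- (m * x)) / 2 * exp ((- m * sqrt t) * z)" for z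
    by (simp add: cosh_def exp_add[symmetric] algebra_simps add_divide_distrib)
  have i: "integrable gauss (\<lambda>z. exp (m * x) / 2 * exp ((m * sqrt t) * z))"
    "integrable gauss (\<lambda>z. exp (- (m * x)) / 2 * exp ((- m * sqrt t) * z))"
    by (intro integrable_mult_right gauss_exp_integrable)+
  show "integrable gauss (\<lambda>z. cosh (m * (x + sqrt t * z)))"
    unfolding eq using i by (rule Bochner_Integration.integrable_add)
  have s: "(- m * sqrt t)\<^sup>2 = m\<^sup>2 * t" "(m * sqrt t)\<^sup>2 = m\<^sup>2 * t" using t by (auto simp: power_mult_distrib)
  show "gheat t (\<lambda>x. cosh (m * x)) x = exp (m\<^sup>2 * t / 2) * cosh (m * x)"
    unfolding gheat_def eq Bochner_Integration.integral_add[OF i] integral_mult_right_zero gauss_exp_integral s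
    by (simp add: cosh_def field_simps)
qed

section \<open>Comparison with sub- and supersolutions\<close>

context mechanism begin

text \<open>\<open>C\<close> bounds the solution up to \<open>T\<close>, and \<open>L\<close> is a
  Lipschitz constant on [0, C]; since \<open>\<Psi>\<close> vanishes at 0, this makes the reaction
  at most linear along the solution.\<close>

lemma mild_Psi_bound:
  assumes u: "mild_solution \<Psi> f u" and f: "f \<in> borel_measurable borel" and T: "T \<ge> 0"
  obtains C L where "C \<ge> 0" "L \<ge> 0" "\<And>r y. 0 \<le> r \<Longrightarrow> r \<le> T \<Longrightarrow> u r y \<le> C"
    "\<And>r y. 0 \<le> r \<Longrightarrow> r \<le> T \<Longrightarrow> \<bar>\<Psi> y (u r y)\<bar> \<le> L * u r y"
    "\<And>r y. 0 \<le> r \<Longrightarrow> r \<le> T \<Longrightarrow> L * u r y \<le> L * C"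
proof -
  note nn = mild_nonneg[OF u f]
  obtain C where C: "\<And>s x. s \<in> {0..T} \<Longrightarrow> \<bar>u s x\<bar> \<le> C"
    using mild_locally_bdd[OF u f] unfolding locally_bdd_def by blast
  have C0: "C \<ge> 0" using C[of T 0] T by auto
  obtain L where L: "L \<ge> 0" "\<And>x l l'. l\<in>{0..C} \<Longrightarrow> l'\<in>{0..C} \<Longrightarrow> \<bar>\<Psi> x l - \<Psi> x l'\<bar> \<le> L * \<bar>l - l'\<bar>"
    using Psi_Lip[OF C0] by auto
  have uC: "u r y \<le> C" if "0 \<le> r" "r \<le> T" for r y using C[of r y] that by auto
  have "\<bar>\<Psi> y (u r y)\<bar> \<le> L * u r y" "L * u r y \<le> L * C" if "0 \<le> r" "r \<le> T" for r y
    using L(2)[of "u r y" 0 y] L(1) uC[OF that, of y] nn[of r y] C0 by (auto intro: mult_left_mono)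
  then show ?thesis using that C0 L(1) uC by blast
qed

lemma mild_lower_heat:
  assumes u: "mild_solution \<Psi> f u" and f: "f \<in> borel_measurable borel" "\<And>x. 0 \<le> f x" "\<And>x. f x \<le> F"
    and t: "t \<ge> 0"
  shows "\<exists>k. \<forall>x. u t x \<ge> exp (- k) * gheat t f x"
proof -
  note [measurable] = mild_measurable[OF u f(1)]
  note nn = mild_nonneg[OF u f(1)]
  note [measurable] = Psi_comp_measurable[OF mild_measurable[OF u f(1)] nn]
  obtain C L where C: "C \<ge> 0" "\<And>r y. 0 \<le> r \<Longrightarrow> r \<le> t \<Longrightarrow> u r y \<le> C" and L: "L \<ge> 0"
    and P: "\<And>r y. 0 \<le> r \<Longrightarrow> r \<le> t \<Longrightarrow> \<bar>\<Psi> y (u r y)\<bar> \<le> L * u r y"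
      "\<And>r y. 0 \<le> r \<Longrightarrow> r \<le> t \<Longrightarrow> L * u r y \<le> L * C"
    by (rule mild_Psi_bound[OF u f(1) t]) metis
  have "u t x \<ge> exp (- (L * t)) * gheat t f x" for x
  proof -
    have eq: "u t x = exp (- L * t) * gheat t f x + duhamel L (\<lambda>t x. L * u t x - \<Psi> x (u t x)) t x"
      using mild_kform[OF u f(1) _ t, of F x L] f by simp
    have "duhamel L (\<lambda>t x. 0) t x \<le> duhamel L (\<lambda>t x. L * u t x - \<Psi> x (u t x)) t x"
    proof (rule duhamel_mono[where C=0 and D="2 * (L * C)"])
      fix r y assume r: "0 \<le> r" "r \<le> t"
      show "\<bar>L * u r y - \<Psi> y (u r y)\<bar> \<le> 2 * (L * C)"
        using P[OF r, of y] nn[of r y] L by linarith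
      show "0 \<le> L * u r y - \<Psi> y (u r y)" using P[OF r, of y] by linarith
    qed measurable
    moreover have "duhamel L (\<lambda>t x. 0) t x = 0" by (simp add: duhamel_def)
    ultimately show ?thesis using eq by simp
  qed
  then show ?thesis by blast
qed

text \<open>The condition on \<open>v\<close> says that it can only be positive where the reaction term vanishes; its multiples \<open>\<theta> v\<close> are therefore subsolutions for every \<open>\<theta>\<close>.\<close>

lemma mild_lower_subsolution:
  assumes u: "mild_solution \<Psi> f u" and f: "f \<in> borel_measurable borel" "\<And>x. 0 \<le> f x" "\<And>x. f x \<le> F"
    and v[measurable]: "jointly_measurable v"
    and v01: "\<And>t x. 0 \<le> v t x" "\<And>t x. v t x \<le> V"
    and v_sub: "\<And>s t x. 0 \<le> s \<Longrightarrow> s \<le> t \<Longrightarrow> v t x \<le> gheat s (v (t - s)) x"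
    and v_supp: "\<And>t x l. 0 \<le> t \<Longrightarrow> v t x = 0 \<or> (\<forall>l\<ge>0. \<Psi> x l = 0)"
    and v0: "\<And>x. v 0 x \<le> f x"
    and T: "T \<ge> 0"
  shows "v T x \<le> u T x"
proof -
  note [measurable] = f(1) mild_measurable[OF u f(1)]
  note nn = mild_nonneg[OF u f(1)]
  note [measurable] = Psi_comp_measurable[OF mild_measurable[OF u f(1)] nn]
  have V0: "V \<ge> 0" using v01[of 0 0] by linarith
  obtain C L where C: "C \<ge> 0" "\<And>r y. 0 \<le> r \<Longrightarrow> r \<le> T \<Longrightarrow> u r y \<le> C" and L: "L \<ge> 0"
    and P: "\<And>r y. 0 \<le> r \<Longrightarrow> r \<le> T \<Longrightarrow> \<bar>\<Psi> y (u r y)\<bar> \<le> L * u r y"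
      "\<And>r y. 0 \<le> r \<Longrightarrow> r \<le> T \<Longrightarrow> L * u r y \<le> L * C"
    by (rule mild_Psi_bound[OF u f(1) T]) metis
  have "v T x - u T x \<le> 0"
  proof (rule gronwall[where a=L and k=L and T=T and B=V and d="\<lambda>t x. v t x - u t x"])
    fix t x assume t: "0 \<le> t" "t \<le> T"
    show "v t x - u t x \<le> V" using v01[of t x] nn[of t x] by linarith
    have eq: "u t x = exp (- L * t) * gheat t f x + duhamel L (\<lambda>t x. L * u t x - \<Psi> x (u t x)) t x"
      using mild_kform[OF u f(1) _ t(1), of F x L] f by simp
    have bv: "\<bar>L * v r y\<bar> \<le> L * V" for r y
      unfolding abs_mult using v01[of r y] L by (auto intro: mult_left_mono)
    have "v t x \<le> gheat t f x"
    proof -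
      have "v t x \<le> gheat t (v 0) x" using v_sub[of t t x] t by simp
      also have "\<dots> \<le> gheat t f x"
        using v0 v01 f by (intro gheat_mono[where C=V and D=F]) auto
      finally show ?thesis .
    qed
    then have 1: "exp (- L * t) * v t x \<le> exp (- L * t) * gheat t f x" by simp
    \<comment> \<open>The subsolution property at lag s is weighted by L exp (- L s) and integrated;
      with the property at lag t it yields, as an inequality, the discounted equation with source
      \<open>L * v\<close>.\<close>
    have "(\<integral>s\<in>{0..t}. L * v t x * exp (- L * s) \<partial>lborel) \<le> duhamel L (\<lambda>t x. L * v t x) t x"
      unfolding duhamel_def
    proof (rule set_integral_mono)
      show "set_integrable lborel {0..t} (\<lambda>s. L * v t x * exp (- L * s))"
        by (intro borel_integrable_atLeastAtMost' continuous_intros)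
      show "set_integrable lborel {0..t} (\<lambda>s. exp (- L * s) * gheat s (\<lambda>x. L * v (t - s) x) x)"
        by (rule duhamel_integrable[where H="\<lambda>t x. L * v t x" and C="L * V"]) (use bv in auto)
      show "L * v t x * exp (- L * s) \<le> exp (- L * s) * gheat s (\<lambda>x. L * v (t - s) x) x" if "s \<in> {0..t}" for s
      proof -
        have "exp (- L * s) * (L * v t x) \<le> exp (- L * s) * (L * gheat s (v (t - s)) x)"
          using v_sub[of s t x] that L by (intro mult_left_mono) auto
        then show ?thesis by (simp add: gheat_cmult mult_ac)
      qed
    qed
    moreover have "(\<integral>s\<in>{0..t}. L * v t x * exp (- L * s) \<partial>lborel) = v t x * (1 - exp (- L * t))"
    proof -
      have "(\<integral>s\<in>{0..t}. L * v t x * exp (- L * s) \<partial>lborel)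
        = v t x * ((L - 0) * (\<integral>s\<in>{0..t}. exp (- L * s) * exp (- 0 * (t - s)) \<partial>lborel))"
        by simp
      then show ?thesis unfolding FTC_exp_resolvent[OF t(1)] by simp
    qed
    ultimately have 2: "v t x \<le> exp (- L * t) * gheat t f x + duhamel L (\<lambda>t x. L * v t x) t x"
      using 1 right_diff_distrib[of "v t x" 1 "exp (- L * t)"] mult.commute[of "v t x" "exp (- L * t)"] by linarith
    have "duhamel L (\<lambda>t x. L * v t x) t x \<le> duhamel L (\<lambda>t x. (L * u t x - \<Psi> x (u t x)) + L * max 0 (v t x - u t x)) t x"
    proof (rule duhamel_mono[where C="L * V" and D="2 * (L * C) + L * V"])
      fix r y assume r: "0 \<le> r" "r \<le> t"
      have rT: "r \<le> T" using r t by simp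
      show "\<bar>L * v r y\<bar> \<le> L * V" by (rule bv)
      have m: "0 \<le> L * max 0 (v r y - u r y)" "L * max 0 (v r y - u r y) \<le> L * V"
        using L v01[of r y] nn[of r y] V0 by (auto intro!: mult_left_mono)
      have p: "0 \<le> L * u r y - \<Psi> y (u r y)" "L * u r y - \<Psi> y (u r y) \<le> 2 * (L * C)"
        using P[OF r(1) rT, of y] nn[of r y] L by linarith+
      show "\<bar>L * u r y - \<Psi> y (u r y) + L * max 0 (v r y - u r y)\<bar> \<le> 2 * (L * C) + L * V"
        using m p by linarith
      \<comment> \<open>Where \<open>v\<close> vanishes, the source of \<open>u\<close> is
        nonnegative; elsewhere the reaction is absent and the source of \<open>u\<close> is
        \<open>L * u\<close>.\<close>
      show "L * v r y \<le> L * u r y - \<Psi> y (u r y) + L * max 0 (v r y - u r y)"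
        using v_supp[OF r(1), of y]
      proof
        assume "v r y = 0" then show ?thesis using p m by simp
      next
        assume "\<forall>l\<ge>0. \<Psi> y l = 0"
        then have "\<Psi> y (u r y) = 0" using nn by simp
        moreover have "L * v r y \<le> L * (u r y + max 0 (v r y - u r y))"
          using L by (intro mult_left_mono) auto
        ultimately show ?thesis by (simp add: distrib_left)
      qed
    qed measurable
    also have "\<dots> = duhamel L (\<lambda>t x. L * u t x - \<Psi> x (u t x)) t x + duhamel L (\<lambda>t x. L * max 0 (v t x - u t x)) t x"
    proof (rule duhamel_add[where C="2 * (L * C)" and D="L * V"])
      fix r y assume r: "0 \<le> r" "r \<le> t"
      have rT: "r \<le> T" using r t by simp
      show "\<bar>L * u r y - \<Psi> y (u r y)\<bar> \<le> 2 * (L * C)"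
        using P[OF r(1) rT, of y] nn[of r y] L by linarith
      have "0 \<le> L * max 0 (v r y - u r y)" "L * max 0 (v r y - u r y) \<le> L * V"
        using L v01[of r y] nn[of r y] V0 by (auto intro!: mult_left_mono)
      then show "\<bar>L * max 0 (v r y - u r y)\<bar> \<le> L * V" by linarith
    qed measurable
    finally show "v t x - u t x \<le> duhamel L (\<lambda>t x. L * max 0 (v t x - u t x)) t x"
      using 2 eq by linarith
  qed (use T L in auto)
  then show ?thesis by simp
qed

text \<open>With g = A h + cosh, assumption \<open>super\<close> says g''/2 + \<beta> g <= lam g.
  The Gronwall lemma is applied to u minus \<theta> exp (lam t) g. As cosh is unbounded, the Duhamel
  calculus is used for \<open>h\<close> only, and cosh enters through its explicit heat
  flow.\<close>

lemma mild_upper_supersolution: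
  fixes \<beta> h h'' :: "real \<Rightarrow> real"
  assumes u: "mild_solution \<Psi> f u" and f: "f \<in> borel_measurable borel" "\<And>x. 0 \<le> f x" "\<And>x. f x \<le> F"
    and Psi_beta: "\<And>x l. l \<ge> 0 \<Longrightarrow> - \<beta> x * l \<le> \<Psi> x l" and beta: "\<And>x. \<bar>\<beta> x\<bar> \<le> K"
    and h[measurable]: "h \<in> borel_measurable borel" and h0: "\<And>x. 0 \<le> h x" "\<And>x. h x \<le> H"
    and h''[measurable]: "h'' \<in> borel_measurable borel" and h2b: "\<And>x. \<bar>h'' x\<bar> \<le> D"
    and dynkin: "\<And>t x. t \<ge> 0 \<Longrightarrow> gheat t h x = h x + duhamel 0 (\<lambda>_ y. h'' y / 2) t x"
    and A: "A \<ge> 0" and lam: "lam \<ge> 0"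
    and super: "\<And>x. \<beta> x * cosh (sqrt (2 * lam) * x) \<le> A * (lam * h x - h'' x / 2 - \<beta> x * h x)"
    and \<theta>: "\<theta> \<ge> 0" and fg: "\<And>x. f x \<le> \<theta> * (A * h x + cosh (sqrt (2 * lam) * x))"
    and T: "T \<ge> 0"
  shows "u T x \<le> \<theta> * exp (lam * T) * (A * h x + cosh (sqrt (2 * lam) * x))"
proof -
  note [measurable] = f(1) mild_measurable[OF u f(1)]
  note nn = mild_nonneg[OF u f(1)]
  note [measurable] = Psi_comp_measurable[OF mild_measurable[OF u f(1)] nn]
  obtain C L where C: "C \<ge> 0" "\<And>r y. 0 \<le> r \<Longrightarrow> r \<le> T \<Longrightarrow> u r y \<le> C" and L: "L \<ge> 0"
    and P: "\<And>r y. 0 \<le> r \<Longrightarrow> r \<le> T \<Longrightarrow> \<bar>\<Psi> y (u r y)\<bar> \<le> L * u r y"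
      "\<And>r y. 0 \<le> r \<Longrightarrow> r \<le> T \<Longrightarrow> L * u r y \<le> L * C"
    by (rule mild_Psi_bound[OF u f(1) T]) metis
  note C0 = C(1)
  define c where "c x = cosh (sqrt (2 * lam) * x)" for x :: real
  have [measurable]: "c \<in> borel_measurable borel"
    unfolding c_def by (intro borel_measurable_continuous_onI continuous_intros)
  have hc: "gheat s c x = exp (lam * s) * c x" if "s \<ge> 0" for s x
    using gheat_cosh_eq[OF that, of "sqrt (2 * lam)" x] lam by (simp add: c_def[abs_def])
  have ic: "integrable gauss (\<lambda>z. c (x + sqrt s * z))" if "s \<ge> 0" for s x
    using gheat_cosh_integrable[OF that, of "sqrt (2 * lam)" x] by (simp add: c_def)
  have H0: "H \<ge> 0" using h0[of 0] by linarith
  have c1: "c x \<ge> 1" for x unfolding c_def by (rule cosh_real_ge_1)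
  define g where "g x = A * h x + c x" for x
  have g1: "g x \<ge> 0" for x using A h0[of x] c1[of x] by (simp add: g_def)
  have [measurable]: "g \<in> borel_measurable borel" unfolding g_def by measurable
  \<comment> \<open>The rate \<open>K\<close> makes \<open>k + \<beta>\<close> nonnegative and at
    most \<open>2 * K\<close>: the linear source is monotone, and \<open>2 * K\<close> is the
    Gronwall constant.\<close>
  define k where "k = K"
  \<comment> \<open>The factor exp (lam (t - s)) of \<open>w\<close> inside the integral combines
    with exp (- k s) into exp (lam t) exp (- \<kappa> s); hence Dynkin's formula for
    \<open>h\<close> is needed at discount \<kappa>.\<close>
  define \<kappa> where "\<kappa> = k + lam"
  define qh where "qh y = \<kappa> * h y - h'' y / 2" for y
  have [measurable]: "qh \<in> borel_measurable borel" unfolding qh_def by measurable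
  have qhb: "\<bar>qh y\<bar> \<le> \<bar>\<kappa>\<bar> * H + D / 2" for y
  proof -
    have "\<bar>\<kappa> * h y\<bar> \<le> \<bar>\<kappa>\<bar> * H" unfolding abs_mult using h0[of y] by (intro mult_left_mono) auto
    then show ?thesis using h2b[of y] unfolding qh_def by linarith
  qed
  have dyn: "h x = exp (- \<kappa> * t) * gheat t h x + duhamel \<kappa> (\<lambda>_. qh) t x" if "t \<ge> 0" for t x
  proof -
    have "(\<lambda>_::real. h) t x = exp (- \<kappa> * t) * gheat t h x + duhamel \<kappa> (\<lambda>t x. - (h'' x / 2) + (\<kappa> - 0) * (\<lambda>_::real. h) t x) t x"
    proof (rule resolvent_change[where F=H])
      show "\<bar>h x\<bar> \<le> H" for x using h0[of x] by simp
      show "locally_bdd (\<lambda>t x. - (h'' x / 2))" unfolding locally_bdd_def using h2b by (intro allI exI[of _ "D / 2"]) auto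
      show "locally_bdd (\<lambda>t. h)" unfolding locally_bdd_def using h0 by (intro allI exI[of _ "H"]) auto
      fix t x :: real assume "t \<ge> 0"
      then show "h x = exp (- 0 * t) * gheat t h x + duhamel 0 (\<lambda>t x. - (h'' x / 2)) t x"
        using dynkin[of t x] duhamel_cmult[of 0 "-1" "\<lambda>_ y. h'' y / 2" t x] by simp
    qed (use that in measurable)
    then show ?thesis by (simp add: qh_def[abs_def] algebra_simps)
  qed
  define w where "w t x = \<theta> * exp (lam * t) * g x" for t x
  have w0: "w t x \<ge> 0" for t x using \<theta> g1[of x] by (simp add: w_def)
  have [measurable]: "jointly_measurable w" unfolding w_def by measurable
  have "u T x - w T x \<le> 0"
  proof (rule gronwall[where a=k and k="2 * K" and T=T and B=C and d="\<lambda>t x. u t x - w t x"])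
    fix t x assume t: "0 \<le> t" "t \<le> T"
    \<comment> \<open>\<open>w\<close> is unbounded, but the Gronwall lemma asks only for an upper
      bound on the difference, and \<open>w\<close> is nonnegative.\<close>
    show "u t x - w t x \<le> C" using C(2)[OF t, of x] w0[of t x] by linarith
    have eq: "u t x = exp (- k * t) * gheat t f x + duhamel k (\<lambda>t x. k * u t x - \<Psi> x (u t x)) t x"
      using mild_kform[OF u f(1) _ t(1), of F x k] f by simp
    have ig: "integrable gauss (\<lambda>z. g (x + sqrt s * z))" if "s \<ge> 0" for s x
      unfolding g_def using that h0
      by (intro Bochner_Integration.integrable_add ic integrable_mult_right gauss_integrable_shift[where C=H]) auto
    have hsg: "gheat s g x = A * gheat s h x + exp (lam * s) * c x" if "s \<ge> 0" for s x
    proof -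
      have "integrable gauss (\<lambda>z. A * h (x + sqrt s * z))"
        using h0 by (intro integrable_mult_right gauss_integrable_shift[where C=H]) auto
      then have "gheat s g x = gheat s (\<lambda>x. A * h x) x + gheat s c x"
        unfolding gheat_def g_def using ic[OF that] by (rule Bochner_Integration.integral_add)
      then show ?thesis using hc[OF that] by (simp add: gheat_cmult)
    qed
    have "gheat t f x \<le> gheat t (\<lambda>x. \<theta> * g x) x"
    proof (rule gheat_mono_integrable)
      show "integrable gauss (\<lambda>z. f (x + sqrt t * z))"
        using f by (intro gauss_integrable_shift[where C=F]) auto
      show "integrable gauss (\<lambda>z. \<theta> * g (x + sqrt t * z))"
        using t by (intro integrable_mult_right ig)
    qed (use fg in \<open>simp add: g_def c_def\<close>)
    then have f1: "exp (- k * t) * gheat t f x \<le> exp (- k * t) * (\<theta> * (A * gheat t h x + exp (lam * t) * c x))"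
      using t by (simp add: gheat_cmult hsg)
    define d where "d t x = 2 * K * max 0 (u t x - w t x)" for t x
    have [measurable]: "jointly_measurable d" unfolding d_def by measurable
    have db: "\<bar>d r y\<bar> \<le> 2 * K * C" if "0 \<le> r" "r \<le> t" for r y
      unfolding d_def abs_mult using K_nonneg C(2)[of r y] w0[of r y] that t C0 by (auto intro!: mult_left_mono)
    \<comment> \<open>The share of \<open>w\<close> in the source after flowing for time s. Its time
      integral together with the initial term rebuilds \<open>w t x\<close> exactly.\<close>
    define E where "E s = \<theta> * exp (lam * t) * (A * (exp (- \<kappa> * s) * gheat s qh x) + c x * k * exp (- k * s))" for s
    have iE1: "set_integrable lborel {0..t} (\<lambda>s. exp (- \<kappa> * s) * gheat s qh x)"
      using duhamel_integrable[of "\<lambda>_. qh" t "\<bar>\<kappa>\<bar> * H + D / 2" \<kappa> x] qhb by simp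
    have iE2: "set_integrable lborel {0..t} (\<lambda>s. c x * k * exp (- k * s))"
      by (intro borel_integrable_atLeastAtMost' continuous_intros)
    have iE: "set_integrable lborel {0..t} E"
      unfolding E_def by (intro set_integrable_mult_right set_integral_add iE1 iE2)
    have EI: "(\<integral>s\<in>{0..t}. E s \<partial>lborel) = \<theta> * exp (lam * t) * (A * duhamel \<kappa> (\<lambda>_. qh) t x + c x * (1 - exp (- k * t)))"
    proof -
      have "(\<integral>s\<in>{0..t}. c x * k * exp (- k * s) \<partial>lborel) = c x * ((k - 0) * (\<integral>s\<in>{0..t}. exp (- k * s) * exp (- 0 * (t - s)) \<partial>lborel))"
        by simp
      also have "\<dots> = c x * (1 - exp (- k * t))" unfolding FTC_exp_resolvent[OF t(1)] by simp
      finally show ?thesis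
        unfolding E_def set_integral_mult_right
        by (subst set_integral_add(2)) (use iE1 iE2 in \<open>auto simp: duhamel_def\<close>)
    qed
    have "duhamel k (\<lambda>t x. k * u t x - \<Psi> x (u t x)) t x \<le> (\<integral>s\<in>{0..t}. E s + exp (- k * s) * gheat s (d (t - s)) x \<partial>lborel)"
      unfolding duhamel_def
    proof (rule set_integral_mono)
      have Cb: "\<bar>k * u r y - \<Psi> y (u r y)\<bar> \<le> K * C + L * C" if "0 \<le> r" "r \<le> T" for r y
      proof -
        have "\<bar>k * u r y\<bar> \<le> K * C" unfolding abs_mult k_def using K_nonneg C(2)[OF that, of y] nn[of r y] by (auto intro!: mult_left_mono)
        then show ?thesis using P(1,2)[OF that, of y] by linarith
      qed
      show "set_integrable lborel {0..t} (\<lambda>s. exp (- k * s) * gheat s (\<lambda>x. k * u (t - s) x - \<Psi> x (u (t - s) x)) x)"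
        by (rule duhamel_integrable[where H="\<lambda>t x. k * u t x - \<Psi> x (u t x)" and C="K * C + L * C"]) (use Cb t in auto)
      have id: "set_integrable lborel {0..t} (\<lambda>s. exp (- k * s) * gheat s (d (t - s)) x)"
        by (rule duhamel_integrable[where C="2 * K * C"]) (use db in auto)
      show "set_integrable lborel {0..t} (\<lambda>s. E s + exp (- k * s) * gheat s (d (t - s)) x)"
        by (rule set_integral_add(1)[OF iE id])
      fix s assume s: "s \<in> {0..t}"
      define r where "r = t - s"
      have r: "0 \<le> r" "r \<le> t" "r \<le> T" using s t by (auto simp: r_def)
      define q where "q y = A * qh y + k * c y" for y
      have iqh: "integrable gauss (\<lambda>z. A * qh (x + sqrt s * z))"
        using qhb by (intro integrable_mult_right gauss_integrable_shift[where C="\<bar>\<kappa>\<bar> * H + D / 2"]) auto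
      have ikc: "integrable gauss (\<lambda>z. k * c (x + sqrt s * z))"
        using s by (intro integrable_mult_right ic) auto
      have iq: "integrable gauss (\<lambda>z. q (x + sqrt s * z))"
        unfolding q_def by (intro Bochner_Integration.integrable_add iqh ikc)
      have hq: "gheat s q x = A * gheat s qh x + k * (exp (lam * s) * c x)"
      proof -
        have "gheat s q x = gheat s (\<lambda>x. A * qh x) x + gheat s (\<lambda>x. k * c x) x"
          unfolding gheat_def q_def by (rule Bochner_Integration.integral_add[OF iqh ikc])
        then show ?thesis using hc[of s] s by (simp add: gheat_cmult)
      qed
      have idr: "integrable gauss (\<lambda>z. d r (x + sqrt s * z))"
        using db[OF r(1,2)] by (intro gauss_integrable_shift[where C="2 * K * C"]) auto
      have iwq: "integrable gauss (\<lambda>z. \<theta> * exp (lam * r) * q (x + sqrt s * z))"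
        by (intro integrable_mult_right iq)
      have "gheat s (\<lambda>x. k * u r x - \<Psi> x (u r x)) x \<le> gheat s (\<lambda>y. \<theta> * exp (lam * r) * q y + d r y) x"
      proof (rule gheat_mono_integrable)
        show "integrable gauss (\<lambda>z. k * u r (x + sqrt s * z) - \<Psi> (x + sqrt s * z) (u r (x + sqrt s * z)))"
          using Cb[OF r(1,3)] by (intro gauss_integrable_shift[where C="K * C + L * C"]) auto
        show "integrable gauss (\<lambda>z. \<theta> * exp (lam * r) * q (x + sqrt s * z) + d r (x + sqrt s * z))"
          by (rule Bochner_Integration.integrable_add[OF iwq idr])
        fix y
        have kb: "0 \<le> k + \<beta> y" "k + \<beta> y \<le> 2 * K" using beta[of y] by (auto simp: k_def)
        have "k * u r y - \<Psi> y (u r y) \<le> (k + \<beta> y) * u r y"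
          using Psi_beta[OF nn[of r y], of y] by (simp add: algebra_simps)
        also have "\<dots> \<le> (k + \<beta> y) * (w r y + max 0 (u r y - w r y))"
          using kb by (intro mult_left_mono) auto
        also have "\<dots> = (k + \<beta> y) * w r y + (k + \<beta> y) * max 0 (u r y - w r y)"
          by (simp add: distrib_left)
        also have "(k + \<beta> y) * max 0 (u r y - w r y) \<le> d r y"
          unfolding d_def using kb by (intro mult_right_mono) auto
        also have "(k + \<beta> y) * w r y \<le> \<theta> * exp (lam * r) * q y"
        proof -
          \<comment> \<open>This is \<open>super\<close> with \<open>k * g\<close> added to both
            sides.\<close>
          have "(k + \<beta> y) * g y \<le> q y"
            using super[of y] by (simp add: q_def g_def qh_def \<kappa>_def c_def algebra_simps)
          then have "\<theta> * exp (lam * r) * ((k + \<beta> y) * g y) \<le> \<theta> * exp (lam * r) * q y"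
            using \<theta> by (intro mult_left_mono) auto
          then show ?thesis by (simp add: w_def mult_ac)
        qed
        finally show "k * u r y - \<Psi> y (u r y) \<le> \<theta> * exp (lam * r) * q y + d r y" by simp
      qed
      also have "\<dots> = \<theta> * exp (lam * r) * gheat s q x + gheat s (d r) x"
        using Bochner_Integration.integral_add[OF iwq idr] unfolding gheat_def by simp
      finally have "exp (- k * s) * gheat s (\<lambda>x. k * u r x - \<Psi> x (u r x)) x
          \<le> exp (- k * s) * (\<theta> * exp (lam * r) * (A * gheat s qh x + k * (exp (lam * s) * c x)) + gheat s (d r) x)"
        unfolding hq by (intro mult_left_mono) auto
      also have "\<dots> = E s + exp (- k * s) * gheat s (d r) x"
      proof -
        have e1: "exp (- k * s) * exp (lam * r) = exp (lam * t) * exp (- \<kappa> * s)"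
          by (simp add: exp_add[symmetric] r_def \<kappa>_def algebra_simps)
        have e2: "exp (- k * s) * exp (lam * r) * exp (lam * s) = exp (lam * t) * exp (- k * s)"
          by (simp add: exp_add[symmetric] r_def algebra_simps)
        have "exp (- k * s) * (\<theta> * exp (lam * r) * (A * gheat s qh x + k * (exp (lam * s) * c x)))
          = \<theta> * A * gheat s qh x * (exp (- k * s) * exp (lam * r)) + \<theta> * k * c x * (exp (- k * s) * exp (lam * r) * exp (lam * s))"
          by (simp add: algebra_simps)
        also have "\<dots> = E s" unfolding e2 unfolding e1 E_def by (simp add: algebra_simps)
        finally show ?thesis by (simp add: distrib_left)
      qed
      finally show "exp (- k * s) * gheat s (\<lambda>x. k * u (t - s) x - \<Psi> x (u (t - s) x)) x
        \<le> E s + exp (- k * s) * gheat s (d (t - s)) x"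
        unfolding r_def .
    qed
    also have "\<dots> = (\<integral>s\<in>{0..t}. E s \<partial>lborel) + duhamel k d t x"
      unfolding duhamel_def
      by (rule set_integral_add(2)[OF iE]) (rule duhamel_integrable[where C="2 * K * C"], use db in auto)
    finally have f2: "duhamel k (\<lambda>t x. k * u t x - \<Psi> x (u t x)) t x \<le> (\<integral>s\<in>{0..t}. E s \<partial>lborel) + duhamel k d t x" .
    have "exp (- k * t) * (\<theta> * (A * gheat t h x + exp (lam * t) * c x)) + (\<integral>s\<in>{0..t}. E s \<partial>lborel) = w t x"
    proof -
      have e: "exp (- k * t) = exp (lam * t) * exp (- \<kappa> * t)"
        by (simp add: exp_add[symmetric] \<kappa>_def algebra_simps)
      have "w t x = \<theta> * exp (lam * t) * (A * (exp (- \<kappa> * t) * gheat t h x + duhamel \<kappa> (\<lambda>_. qh) t x) + c x)"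
        unfolding w_def g_def using dyn[OF t(1), of x] by simp
      also have "\<dots> = exp (lam * t) * exp (- \<kappa> * t) * (\<theta> * (A * gheat t h x + exp (lam * t) * c x)) 
         + \<theta> * exp (lam * t) * (A * duhamel \<kappa> (\<lambda>_. qh) t x + c x * (1 - exp (lam * t) * exp (- \<kappa> * t)))"
        by (simp add: algebra_simps)
      finally show ?thesis unfolding EI e by simp
    qed
    then have "u t x - w t x \<le> duhamel k d t x" using eq f1 f2 by linarith
    then show "u t x - w t x \<le> duhamel k (\<lambda>t x. 2 * K * max 0 (u t x - w t x)) t x"
      by (simp add: d_def[abs_def])
  qed (use T K_nonneg in \<open>auto simp: k_def\<close>)
  then show ?thesis by (simp add: w_def g_def c_def)
qed

end

section \<open>The branching mechanism\<close>

lemma compact_supp_bounded: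
  assumes "continuous_on UNIV f" "compact_supp f"
  shows "\<exists>C\<ge>0. \<forall>x. \<bar>f x\<bar> \<le> C"
proof -
  obtain R where R: "\<And>x. \<bar>x\<bar> > R \<Longrightarrow> f x = 0" using assms(2) by (auto simp: compact_supp_def)
  have "bounded (f ` {-R..R})"
    by (intro compact_imp_bounded compact_continuous_image continuous_on_subset[OF assms(1)]) auto
  then obtain C where "\<forall>y\<in>f ` {-R..R}. norm y \<le> C" unfolding bounded_iff by blast
  then have C: "\<And>x. x \<in> {-R..R} \<Longrightarrow> \<bar>f x\<bar> \<le> C" by auto
  have "\<bar>f x\<bar> \<le> max 0 C" for x
  proof (cases "\<bar>x\<bar> > R")
    case False
    then have "x \<in> {-R..R}" by auto
    from C[OF this] show ?thesis by simp
  qed (simp add: R)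
  then show ?thesis by (intro exI[of _ "max 0 C"]) auto
qed

text \<open>Induction over measurable functions, since the kernel is given only through
  measurability of each \<open>emeasure (\<kappa> x) A\<close>, and its measures may be infinite, as
  a jump measure near 0 can be.\<close>

lemma kernel_nn_integral_measurable:
  assumes sets: "\<And>x. x \<in> space M \<Longrightarrow> sets (\<kappa> x) = sets N"
    and em: "\<And>A. A \<in> sets N \<Longrightarrow> (\<lambda>x. emeasure (\<kappa> x) A) \<in> borel_measurable M"
    and f: "f \<in> borel_measurable N"
  shows "(\<lambda>x. \<integral>\<^sup>+u. f u \<partial>\<kappa> x) \<in> borel_measurable M"
proof -
  have km: "g \<in> borel_measurable (\<kappa> x)" if "g \<in> borel_measurable N" "x \<in> space M" for g :: "'b \<Rightarrow> ennreal" and x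
    using that(1) measurable_cong_sets[OF sets[OF that(2)] refl] by blast
  show ?thesis
  using f
proof (induction rule: borel_measurable_induct)
  case (cong f g)
  have "(\<integral>\<^sup>+u. f u \<partial>\<kappa> x) = (\<integral>\<^sup>+u. g u \<partial>\<kappa> x)" if "x \<in> space M" for x
    using cong sets_eq_imp_space_eq[OF sets[OF that]] by (intro nn_integral_cong) auto
  then show ?case using cong measurable_cong[of M "\<lambda>x. \<integral>\<^sup>+u. f u \<partial>\<kappa> x"] by simp
next
  case (set A)
  have "(\<integral>\<^sup>+u. indicator A u \<partial>\<kappa> x) = emeasure (\<kappa> x) A" if "x \<in> space M" for x
    using set sets[OF that] by (intro nn_integral_indicator) auto
  then show ?case using em[OF set] measurable_cong[of M "\<lambda>x. \<integral>\<^sup>+u. indicator A u \<partial>\<kappa> x"] by simp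
next
  case (mult f c)
  have "(\<integral>\<^sup>+u. c * f u \<partial>\<kappa> x) = c * (\<integral>\<^sup>+u. f u \<partial>\<kappa> x)" if "x \<in> space M" for x
    by (intro nn_integral_cmult km[OF mult.hyps(2) that])
  then show ?case using mult measurable_cong[of M "\<lambda>x. \<integral>\<^sup>+u. c * f u \<partial>\<kappa> x"] by simp
next
  case (add f g)
  have "(\<integral>\<^sup>+u. f u + g u \<partial>\<kappa> x) = (\<integral>\<^sup>+u. f u \<partial>\<kappa> x) + (\<integral>\<^sup>+u. g u \<partial>\<kappa> x)" if "x \<in> space M" for x
    by (intro nn_integral_add km[OF add.hyps(1) that] km[OF add.hyps(3) that])
  then show ?case using add measurable_cong[of M "\<lambda>x. \<integral>\<^sup>+u. g u + f u \<partial>\<kappa> x"] 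
    by (simp add: add.commute measurable_cong[of M "\<lambda>x. \<integral>\<^sup>+u. f u + g u \<partial>\<kappa> x"])
next
  case (seq U)
  have "(\<integral>\<^sup>+u. (SUP i. U i) u \<partial>\<kappa> x) = (SUP i. \<integral>\<^sup>+u. U i u \<partial>\<kappa> x)" if "x \<in> space M" for x
    unfolding SUP_apply
    by (intro nn_integral_monotone_convergence_SUP km[OF seq.hyps(1) that] seq.hyps)
  then show ?case using seq measurable_cong[of M "\<lambda>x. \<integral>\<^sup>+u. (SUP i. U i) u \<partial>\<kappa> x"] by simp
qed
qed

lemma exp_compensated_nonneg: "0 \<le> exp (- l * u) - 1 + l * (u::real)"
  using exp_ge_add_one_self[of "- l * u"] by simp

text \<open>The compensated exponential exp (- x) - 1 + x has derivative 1 - exp (- x), which lies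
  between 0 and b on [a, b]; the estimates themselves come from
  \<open>exp_ge_add_one_self\<close>.\<close>

lemma exp_compensated_diff:
  fixes a b :: real
  assumes "0 \<le> a" "a \<le> b"
  shows "0 \<le> (exp (- b) - 1 + b) - (exp (- a) - 1 + a)"
    and "(exp (- b) - 1 + b) - (exp (- a) - 1 + a) \<le> b * (b - a)"
proof -
  have "exp (- a) - exp (- b) = exp (- a) * (1 - exp (- (b - a)))"
    by (simp add: exp_diff exp_minus field_simps)
  also have "\<dots> \<le> 1 * (b - a)"
  proof (rule mult_mono)
    show "1 - exp (- (b - a)) \<le> b - a" using exp_ge_add_one_self[of "- (b - a)"] by linarith
  qed (use assms in auto)
  finally show "0 \<le> (exp (- b) - 1 + b) - (exp (- a) - 1 + a)" by simp
  have "(1 - b) * (b - a) \<le> exp (- b) * (b - a)"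
    using assms exp_ge_add_one_self[of "- b"] by (intro mult_right_mono) auto
  also have "\<dots> \<le> exp (- b) * (exp (b - a) - 1)"
  proof (rule mult_left_mono)
    show "b - a \<le> exp (b - a) - 1" using exp_ge_add_one_self[of "b - a"] by linarith
  qed simp
  also have "\<dots> = exp (- a) - exp (- b)"
    by (simp add: exp_diff exp_minus field_simps)
  finally show "(exp (- b) - 1 + b) - (exp (- a) - 1 + a) \<le> b * (b - a)"
    by (simp add: algebra_simps)
qed

text \<open>The Lipschitz constant grows like u^2, exactly what a finite second moment of the jump
  measure can integrate.\<close>

lemma exp_compensated_Lipschitz:
  fixes l l' M u :: real
  assumes "l \<in> {0..M}" "l' \<in> {0..M}" "u \<ge> 0"
  shows "\<bar>(exp (- l * u) - 1 + l * u) - (exp (- l' * u) - 1 + l' * u)\<bar> \<le> M * \<bar>l - l'\<bar> * u\<^sup>2"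
proof -
  have *: "\<bar>(exp (- l * u) - 1 + l * u) - (exp (- l' * u) - 1 + l' * u)\<bar> \<le> M * \<bar>l - l'\<bar> * u\<^sup>2"
    if "l \<in> {0..M}" "l' \<in> {0..M}" "l' \<le> l" for l l'
  proof -
    have a: "0 \<le> l' * u" "l' * u \<le> l * u" using that assms by (auto intro: mult_right_mono)
    have "l * u * (l * u - l' * u) = l * ((l - l') * u\<^sup>2)" by (simp add: power2_eq_square algebra_simps)
    also have "\<dots> \<le> M * ((l - l') * u\<^sup>2)" using that by (intro mult_right_mono) auto
    finally have "l * u * (l * u - l' * u) \<le> M * \<bar>l - l'\<bar> * u\<^sup>2" using that by (simp add: mult_ac)
    then show ?thesis using exp_compensated_diff[OF a] by simp
  qed
  show ?thesis
  proof (cases "l' \<le> l")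
    case True then show ?thesis using *[OF assms(1,2)] by simp
  next
    case False
    then show ?thesis using *[OF assms(2,1)] by (simp add: abs_minus_commute)
  qed
qed

section \<open>Regularity and lower bound of the mechanism \<open>psi\<close>\<close>

context
  fixes \<beta> \<alpha> :: "real \<Rightarrow> real" and \<pi> :: "real \<Rightarrow> real measure"
  assumes bp: "branching_params \<beta> \<alpha> \<pi>"
begin

lemma pi_AE_pos: "AE u in \<pi> x. u > 0"
proof (rule AE_I')
  show "{..0} \<in> null_sets (\<pi> x)" using bp by (auto simp: branching_params_def null_sets_def)
qed auto

lemma pi_sets [simp, measurable_cong]: "sets (\<pi> x) = sets borel"
  using bp by (auto simp: branching_params_def)

lemma pi_square_integrable: "integrable (\<pi> x) (\<lambda>u. u\<^sup>2)"
  using bp by (intro integrableI_bounded) (auto simp: branching_params_def)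

lemma pi_compensated_integrable:
  assumes "l \<ge> 0"
  shows "integrable (\<pi> x) (\<lambda>u. exp (- l * u) - 1 + l * u)"
proof (rule Bochner_Integration.integrable_bound)
  show "integrable (\<pi> x) (\<lambda>u. l * \<bar>l - 0\<bar> * u\<^sup>2)"
    by (intro integrable_mult_right pi_square_integrable)
  show "AE u in \<pi> x. norm (exp (- l * u) - 1 + l * u) \<le> norm (l * \<bar>l - 0\<bar> * u\<^sup>2)"
    using pi_AE_pos
  proof eventually_elim
    case (elim u)
    then show ?case using exp_compensated_Lipschitz[of l l 0 u] assms by simp
  qed
qed measurable

lemma pi_compensated_Lipschitz:
  assumes "l \<in> {0..M}" "l' \<in> {0..M}"
  shows "\<bar>(\<integral>u. (exp (- l * u) - 1 + l * u) \<partial>\<pi> x) - (\<integral>u. (exp (- l' * u) - 1 + l' * u) \<partial>\<pi> x)\<bar>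
    \<le> M * \<bar>l - l'\<bar> * (\<integral>u. u\<^sup>2 \<partial>\<pi> x)"
proof -
  have i: "integrable (\<pi> x) (\<lambda>u. exp (- l * u) - 1 + l * u)" "integrable (\<pi> x) (\<lambda>u. exp (- l' * u) - 1 + l' * u)"
    using assms by (auto intro!: pi_compensated_integrable[unfolded mult_minus_left])
  have "\<bar>\<integral>u. (exp (- l * u) - 1 + l * u) - (exp (- l' * u) - 1 + l' * u) \<partial>\<pi> x\<bar>
     \<le> (\<integral>u. \<bar>(exp (- l * u) - 1 + l * u) - (exp (- l' * u) - 1 + l' * u)\<bar> \<partial>\<pi> x)"
    by (rule integral_abs_bound)
  also have "\<dots> \<le> (\<integral>u. M * \<bar>l - l'\<bar> * u\<^sup>2 \<partial>\<pi> x)"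
  proof (rule integral_mono_AE)
    show "AE u in \<pi> x. \<bar>(exp (- l * u) - 1 + l * u) - (exp (- l' * u) - 1 + l' * u)\<bar> \<le> M * \<bar>l - l'\<bar> * u\<^sup>2"
      using pi_AE_pos by eventually_elim (intro exp_compensated_Lipschitz assms, simp)
  qed (intro integrable_abs Bochner_Integration.integrable_diff i integrable_mult_right pi_square_integrable)+
  finally show ?thesis using Bochner_Integration.integral_diff[OF i] by simp
qed

lemma pi_compensated_measurable:
  "(\<lambda>x. \<integral>u. (exp (- l * u) - 1 + l * u) \<partial>\<pi> x) \<in> borel_measurable borel"
proof -
  have "(\<lambda>x. \<integral>\<^sup>+u. ennreal (exp (- l * u) - 1 + l * u) \<partial>\<pi> x) \<in> borel_measurable borel"
    by (rule kernel_nn_integral_measurable[where N=borel]) (use bp in \<open>auto simp: branching_params_def\<close>)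
  then show ?thesis
    by (subst integral_eq_nn_integral) (auto intro!: AE_I2 exp_compensated_nonneg[unfolded mult_minus_left])
qed

lemma psi_lower: "l \<ge> 0 \<Longrightarrow> - \<beta> x * l \<le> psi \<beta> \<alpha> \<pi> x l"
proof -
  have "0 \<le> \<alpha> x * l\<^sup>2" using bp by (auto simp: branching_params_def)
  moreover have "0 \<le> (\<integral>u. (exp (- l * u) - 1 + l * u) \<partial>\<pi> x)"
    by (intro Bochner_Integration.integral_nonneg exp_compensated_nonneg)
  ultimately show ?thesis by (simp add: psi_def)
qed

text \<open>The linear, quadratic and jump parts each contribute a Lipschitz constant on [0, M]; all
  are uniform in x because the coefficients are continuous with compact support.\<close>

lemma psi_mechanism:
  assumes K: "\<And>x. \<bar>\<beta> x\<bar> \<le> K"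
  shows "mechanism (psi \<beta> \<alpha> \<pi>) K"
proof
  obtain A where A: "A \<ge> 0" "\<And>x. \<bar>\<alpha> x\<bar> \<le> A"
    using compact_supp_bounded[of \<alpha>] bp by (auto simp: branching_params_def)
  obtain Q where Q: "Q \<ge> 0" "\<And>x. (\<integral>u. u\<^sup>2 \<partial>\<pi> x) \<le> Q"
    using compact_supp_bounded[of "\<lambda>x. \<integral>u. u\<^sup>2 \<partial>\<pi> x"] bp by (auto simp: branching_params_def abs_le_iff)
  show K0: "K \<ge> 0" using K[of 0] by linarith
  show "psi \<beta> \<alpha> \<pi> x 0 = 0" for x by (simp add: psi_def)
  show "- K * l \<le> psi \<beta> \<alpha> \<pi> x l" if "l \<ge> 0" for l x
  proof -
    have "\<beta> x * l \<le> K * l" using K[of x] that by (intro mult_right_mono) auto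
    then show ?thesis using psi_lower[OF that, of x] by simp
  qed
  show "\<exists>L\<ge>0. \<forall>x. \<forall>l\<in>{0..M}. \<forall>l'\<in>{0..M}. \<bar>psi \<beta> \<alpha> \<pi> x l - psi \<beta> \<alpha> \<pi> x l'\<bar> \<le> L * \<bar>l - l'\<bar>" if M: "M \<ge> 0" for M
  proof (intro exI[of _ "K + A * (2 * M) + M * Q"] conjI allI ballI)
    show "0 \<le> K + A * (2 * M) + M * Q" using K0 A Q M by simp
    fix x l l' assume l: "l \<in> {0..M}" "l' \<in> {0..M}"
    let ?I = "\<lambda>l. \<integral>u. (exp (- l * u) - 1 + l * u) \<partial>\<pi> x"
    have 1: "\<bar>\<beta> x * (l - l')\<bar> \<le> K * \<bar>l - l'\<bar>" unfolding abs_mult by (intro mult_right_mono K) simp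
    have 2: "\<bar>\<alpha> x * (l\<^sup>2 - l'\<^sup>2)\<bar> \<le> A * (2 * M) * \<bar>l - l'\<bar>"
    proof -
      have "\<bar>\<alpha> x * (l\<^sup>2 - l'\<^sup>2)\<bar> = \<bar>\<alpha> x\<bar> * \<bar>l + l'\<bar> * \<bar>l - l'\<bar>"
        by (simp add: power2_eq_square square_diff_square_factored abs_mult)
      also have "\<dots> \<le> A * (2 * M) * \<bar>l - l'\<bar>"
        using l A by (intro mult_mono) auto
      finally show ?thesis .
    qed
    have 3: "\<bar>?I l - ?I l'\<bar> \<le> M * Q * \<bar>l - l'\<bar>"
    proof -
      have "\<bar>?I l - ?I l'\<bar> \<le> M * \<bar>l - l'\<bar> * (\<integral>u. u\<^sup>2 \<partial>\<pi> x)" by (rule pi_compensated_Lipschitz[OF l])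
      also have "\<dots> \<le> M * \<bar>l - l'\<bar> * Q" using M by (intro mult_left_mono Q) auto
      finally show ?thesis by (simp add: mult_ac)
    qed
    have "psi \<beta> \<alpha> \<pi> x l - psi \<beta> \<alpha> \<pi> x l' = - (\<beta> x * (l - l')) + \<alpha> x * (l\<^sup>2 - l'\<^sup>2) + (?I l - ?I l')"
      by (simp add: psi_def algebra_simps)
    then have "\<bar>psi \<beta> \<alpha> \<pi> x l - psi \<beta> \<alpha> \<pi> x l'\<bar> \<le> \<bar>\<beta> x * (l - l')\<bar> + \<bar>\<alpha> x * (l\<^sup>2 - l'\<^sup>2)\<bar> + \<bar>?I l - ?I l'\<bar>"
      by linarith
    then show "\<bar>psi \<beta> \<alpha> \<pi> x l - psi \<beta> \<alpha> \<pi> x l'\<bar> \<le> (K + A * (2 * M) + M * Q) * \<bar>l - l'\<bar>"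
      using 1 2 3 by (simp add: distrib_right)
  qed
  let ?I = "\<lambda>x l. \<integral>u. (exp (- l * u) - 1 + l * u) \<partial>\<pi> x"
  \<comment> \<open>Joint measurability of a function measurable in x and continuous in l: l is
    rounded down to multiples of 1 / (n + 1), which leaves countably many measurable functions of x,
    and the Lipschitz estimate gives the limit.\<close>
  define a where "a n l = real (nat \<lfloor>real (Suc n) * max 0 l\<rfloor>) / real (Suc n)" for n and l :: real
  have a: "0 \<le> a n l" "a n l \<le> max 0 l" "max 0 l - a n l \<le> 1 / real (Suc n)" for n l
  proof -
    let ?y = "real (Suc n) * max 0 l"
    have y: "0 \<le> ?y" by simp
    then have f: "real (nat \<lfloor>?y\<rfloor>) \<le> ?y" "?y - 1 \<le> real (nat \<lfloor>?y\<rfloor>)" by linarith+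
    show "0 \<le> a n l" by (simp add: a_def)
    show "a n l \<le> max 0 l" using f(1) by (simp add: a_def divide_le_eq mult.commute del: of_nat_Suc)
    have "max 0 l = ?y / real (Suc n)" by simp
    then have "max 0 l - a n l = (?y - real (nat \<lfloor>?y\<rfloor>)) / real (Suc n)"
      unfolding a_def by (simp add: diff_divide_distrib del: of_nat_Suc)
    also have "\<dots> \<le> 1 / real (Suc n)"
    proof (rule divide_right_mono)
      show "?y - real (nat \<lfloor>?y\<rfloor>) \<le> 1" using f(2) by linarith
    qed simp
    finally show "max 0 l - a n l \<le> 1 / real (Suc n)" .
  qed
  have m: "(\<lambda>p. ?I (fst p) (a n (snd p))) \<in> borel_measurable (borel \<Otimes>\<^sub>M borel)" for n
    unfolding a_def
  proof (rule measurable_compose_countable[where f="\<lambda>i p. ?I (fst p) (real i / real (Suc n))" and g="\<lambda>p. nat \<lfloor>real (Suc n) * max 0 (snd p)\<rfloor>"])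
    show "(\<lambda>p. ?I (fst p) (real i / real (Suc n))) \<in> borel_measurable (borel \<Otimes>\<^sub>M borel)" for i
      by (rule measurable_compose[OF measurable_fst pi_compensated_measurable])
  qed measurable
  have "(\<lambda>p. ?I (fst p) (max 0 (snd p))) \<in> borel_measurable (borel \<Otimes>\<^sub>M borel)"
  proof (rule borel_measurable_LIMSEQ_real[OF _ m])
    fix p :: "real \<times> real"
    obtain x l where p: "p = (x, l)" by (cases p)
    have "(\<lambda>n. ?I x (a n l)) \<longlonglongrightarrow> ?I x (max 0 l)"
    proof (rule LIM_zero_cancel[OF Lim_null_comparison])
      have "norm (?I x (a n l) - ?I x (max 0 l)) \<le> max 0 l * (\<integral>u. u\<^sup>2 \<partial>\<pi> x) * (1 / real (Suc n))" for n
      proof -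
        have "norm (?I x (a n l) - ?I x (max 0 l)) \<le> max 0 l * \<bar>a n l - max 0 l\<bar> * (\<integral>u. u\<^sup>2 \<partial>\<pi> x)"
          unfolding real_norm_def using a[where n=n and l=l] by (intro pi_compensated_Lipschitz) auto
        also have "\<dots> = max 0 l * (\<integral>u. u\<^sup>2 \<partial>\<pi> x) * \<bar>a n l - max 0 l\<bar>" by simp
        also have "\<dots> \<le> max 0 l * (\<integral>u. u\<^sup>2 \<partial>\<pi> x) * (1 / real (Suc n))"
          using a[where n=n and l=l] by (intro mult_left_mono) (auto intro!: mult_nonneg_nonneg Bochner_Integration.integral_nonneg)
        finally show ?thesis .
      qed
      then show "\<forall>\<^sub>F n in sequentially. norm (?I x (a n l) - ?I x (max 0 l)) \<le> max 0 l * (\<integral>u. u\<^sup>2 \<partial>\<pi> x) * (1 / real (Suc n))"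
        by (intro always_eventually allI)
      show "(\<lambda>n. max 0 l * (\<integral>u. u\<^sup>2 \<partial>\<pi> x) * (1 / real (Suc n))) \<longlonglongrightarrow> 0"
        by (intro tendsto_mult_right_zero LIMSEQ_Suc[OF lim_1_over_n])
    qed
    then show "(\<lambda>n. ?I (fst p) (a n (snd p))) \<longlonglongrightarrow> ?I (fst p) (max 0 (snd p))" by (simp add: p)
  qed
  moreover have "\<beta> \<in> borel_measurable borel" "\<alpha> \<in> borel_measurable borel"
    using bp by (auto simp: branching_params_def intro: borel_measurable_continuous_onI)
  ultimately show "(\<lambda>(x, l). psi \<beta> \<alpha> \<pi> x (max 0 l)) \<in> borel_measurable (borel \<Otimes>\<^sub>M borel)"
    unfolding psi_def split_beta' by measurable
qed

text \<open>The jump integral vanishes along with the second moment, by the Lipschitz estimate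
  against l = 0.\<close>

lemma psi_eq_0_outside: "\<exists>R\<ge>0. \<forall>x. \<bar>x\<bar> > R \<longrightarrow> (\<forall>l\<ge>0. psi \<beta> \<alpha> \<pi> x l = 0)"
proof -
  obtain R1 where R1: "\<And>x. \<bar>x\<bar> > R1 \<Longrightarrow> \<beta> x = 0" using bp by (auto simp: branching_params_def compact_supp_def)
  obtain R2 where R2: "\<And>x. \<bar>x\<bar> > R2 \<Longrightarrow> \<alpha> x = 0" using bp by (auto simp: branching_params_def compact_supp_def)
  obtain R3 where R3: "\<And>x. \<bar>x\<bar> > R3 \<Longrightarrow> (\<integral>u. u\<^sup>2 \<partial>\<pi> x) = 0" using bp by (auto simp: branching_params_def compact_supp_def)
  have "psi \<beta> \<alpha> \<pi> x l = 0" if "\<bar>x\<bar> > max 0 (max R1 (max R2 R3))" "l \<ge> 0" for x l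
  proof -
    have "\<bar>(\<integral>u. (exp (- l * u) - 1 + l * u) \<partial>\<pi> x) - (\<integral>u. (exp (- 0 * u) - 1 + 0 * u) \<partial>\<pi> x)\<bar> \<le> l * \<bar>l - 0\<bar> * (\<integral>u. u\<^sup>2 \<partial>\<pi> x)"
      using that by (intro pi_compensated_Lipschitz) auto
    then show ?thesis using R1[of x] R2[of x] R3[of x] that by (simp add: psi_def)
  qed
  then show ?thesis by (intro exI[of _ "max 0 (max R1 (max R2 R3))"]) auto
qed

end

section \<open>Heat flow killed on an interval\<close>

text \<open>By the reflection principle the heat flow of this function, which is odd about \<open>R\<close>, agrees on \<open>[R, \<infinity>)\<close> with the flow of the indicator of \<open>[y0, \<infinity>)\<close> killed at \<open>R\<close>.\<close>

definition reflected_step :: "real \<Rightarrow> real \<Rightarrow> real \<Rightarrow> real" where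
  "reflected_step R y0 y = indicator {y0..} y - indicator {..2 * R - y0} y"

text \<open>For R >= 0 the two flows serve the two half-lines outside [-R, R]; each is nonpositive
  inside, so the cut at 0 extends the killed flow by zero.\<close>

definition killed_heat :: "real \<Rightarrow> real \<Rightarrow> real \<Rightarrow> real \<Rightarrow> real" where
  "killed_heat R y0 t x = max 0 (max (gheat t (reflected_step R y0) x) (gheat t (reflected_step R y0) (- x)))"

lemma reflected_step_measurable [measurable]: "reflected_step R y0 \<in> borel_measurable borel"
  unfolding reflected_step_def[abs_def] by measurable

lemma reflected_step_bound: "\<bar>reflected_step R y0 y\<bar> \<le> 1"
  by (simp add: reflected_step_def indicator_def)

lemma killed_heat_measurable [measurable]: "jointly_measurable (killed_heat R y0)"
proof -
  have "(\<lambda>p. gheat (fst p) ((\<lambda>_. reflected_step R y0) 0) (snd p)) \<in> borel_measurable (borel \<Otimes>\<^sub>M borel)"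
    "(\<lambda>p. gheat (fst p) ((\<lambda>_. reflected_step R y0) 0) (- snd p)) \<in> borel_measurable (borel \<Otimes>\<^sub>M borel)"
    by (rule gheat_measurable[where H="\<lambda>_. reflected_step R y0"]; measurable)+
  then show ?thesis unfolding killed_heat_def split_beta' by measurable
qed

lemma killed_heat_nonneg: "0 \<le> killed_heat R y0 t x"
  by (simp add: killed_heat_def)

lemma killed_heat_le_1: "killed_heat R y0 t x \<le> 1"
proof -
  have "\<bar>gheat t (reflected_step R y0) x\<bar> \<le> 1" for x by (intro gheat_bound reflected_step_bound)
  from this[of x] this[of "- x"] show ?thesis by (simp add: killed_heat_def abs_le_iff)
qed

text \<open>A maximum of heat flows is a subsolution: each of the two flows and zero is at most the
  flow of the maximum.\<close>

lemma killed_heat_subsolution: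
  assumes "0 \<le> s" "s \<le> t"
  shows "killed_heat R y0 t x \<le> gheat s (killed_heat R y0 (t - s)) x"
proof -
  let ?F = "reflected_step R y0" and ?v = "killed_heat R y0 (t - s)"
  have F: "gheat t ?F x = gheat s (gheat (t - s) ?F) x" for x
    using assms by (subst gheat_gheat[where C=1]) (auto intro: reflected_step_bound)
  have [measurable]: "?v \<in> borel_measurable borel" by measurable
  have vb: "\<bar>?v y\<bar> \<le> 1" for y using killed_heat_nonneg killed_heat_le_1 by (simp add: abs_of_nonneg)
  have Fb: "\<bar>gheat (t - s) ?F y\<bar> \<le> 1" for y by (intro gheat_bound reflected_step_bound)
  have "gheat t ?F x \<le> gheat s ?v x"
    unfolding F by (rule gheat_mono[where C=1 and D=1]) (use vb Fb in \<open>auto simp: killed_heat_def\<close>)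
  moreover have "gheat t ?F (- x) \<le> gheat s ?v x"
  proof -
    have "gheat t ?F (- x) = (\<integral>z. gheat (t - s) ?F (- x + sqrt s * z) \<partial>gauss)"
      unfolding F gheat_def[of s] ..
    also have "\<dots> = (\<integral>z. gheat (t - s) ?F (- x + sqrt s * (- z)) \<partial>gauss)"
      by (rule gauss_integral_uminus[symmetric]) measurable
    also have "\<dots> = gheat s (\<lambda>y. gheat (t - s) ?F (- y)) x"
      unfolding gheat_def[of s] by simp
    also have "\<dots> \<le> gheat s ?v x"
      by (rule gheat_mono[where C=1 and D=1]) (use vb Fb in \<open>auto simp: killed_heat_def\<close>)
    finally show ?thesis .
  qed
  moreover have "0 \<le> gheat s ?v x" by (intro gheat_nonneg killed_heat_nonneg)
  ultimately show ?thesis by (simp add: killed_heat_def)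
qed

text \<open>The step is odd about R and nondecreasing, so for a start at or below R its values at x
  + sqrt t z and x - sqrt t z have a nonpositive sum.\<close>

lemma gheat_reflected_step_nonpos:
  assumes "x \<le> R"
  shows "gheat t (reflected_step R y0) x \<le> 0"
proof -
  let ?F = "reflected_step R y0"
  have i: "integrable gauss (\<lambda>z. ?F (x + sqrt t * z))"
    by (intro gauss_integrable_shift[where C=1] reflected_step_bound) measurable
  have i': "integrable gauss (\<lambda>z. ?F (x + sqrt t * (- z)))"
    by (intro gauss_integrable_bounded[where C=1] reflected_step_bound) measurable
  have "gheat t ?F x = (\<integral>z. ?F (x + sqrt t * (- z)) \<partial>gauss)"
    unfolding gheat_def by (rule gauss_integral_uminus[symmetric]) measurable
  then have "2 * gheat t ?F x = (\<integral>z. ?F (x + sqrt t * z) + ?F (x + sqrt t * (- z)) \<partial>gauss)"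
    unfolding Bochner_Integration.integral_add[OF i i'] by (simp add: gheat_def)
  also have "\<dots> \<le> (\<integral>z. 0 \<partial>gauss)"
    using i i' assms by (intro integral_mono Bochner_Integration.integrable_add) (auto simp: reflected_step_def indicator_def)
  finally show ?thesis by simp
qed

lemma killed_heat_eq_0: "\<bar>x\<bar> \<le> R \<Longrightarrow> killed_heat R y0 t x = 0"
  using gheat_reflected_step_nonpos[of x R t y0] gheat_reflected_step_nonpos[of "- x" R t y0]
  by (auto simp: killed_heat_def)

lemma killed_heat_0_le: "y0 \<ge> 0 \<Longrightarrow> killed_heat R y0 0 x \<le> indicator {z. \<bar>z\<bar> \<ge> y0} x"
  by (auto simp: killed_heat_def reflected_step_def indicator_def)

lemma gheat_reflected_step_mono:
  assumes "x \<le> x'"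
  shows "gheat t (reflected_step R y0) x \<le> gheat t (reflected_step R y0) x'"
  unfolding gheat_def
proof (rule integral_mono)
  show "reflected_step R y0 (x + sqrt t * z) \<le> reflected_step R y0 (x' + sqrt t * z)" for z
    using assms by (auto simp: reflected_step_def indicator_def)
qed (intro gauss_integrable_shift[where C=1] reflected_step_bound, measurable)+

text \<open>Seen from R + 1, the upward step is at distance y and the reflected downward step at
  distance y + 2. Their difference is the Gaussian mass of an interval of length 2 / sqrt t, bounded
  below by the density at its far end.\<close>

lemma gheat_reflected_step_lower:
  assumes t: "t > 0" and y: "y \<ge> 0"
  shows "2 / sqrt (2 * pi * t) * exp (- (y + 2)\<^sup>2 / (2 * t)) \<le> gheat t (reflected_step R (y + 1 + R)) (R + 1)"
proof -
  define s where "s = sqrt t"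
  have s: "s > 0" "s\<^sup>2 = t" using t by (auto simp: s_def)
  let ?A = "\<lambda>z. indicator {y..} (s * z) :: real" and ?B = "\<lambda>z. indicator {..- (y + 2)} (s * z) :: real"
  have iA: "integrable gauss ?A" "integrable gauss ?B"
    by (auto intro!: gauss_integrable_bounded[where C=1] simp: indicator_def)
  have "gheat t (reflected_step R (y + 1 + R)) (R + 1) = (\<integral>z. ?A z - ?B z \<partial>gauss)"
    unfolding gheat_def s_def[symmetric]
    by (intro Bochner_Integration.integral_cong) (auto simp: reflected_step_def indicator_def)
  also have "\<dots> = (\<integral>z. ?A z \<partial>gauss) - (\<integral>z. ?B z \<partial>gauss)"
    using iA by (rule Bochner_Integration.integral_diff)
  also have "(\<integral>z. ?B z \<partial>gauss) = (\<integral>z. ?B (- z) \<partial>gauss)"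
    by (rule gauss_integral_uminus[symmetric]) measurable
  also have "(\<integral>z. ?A z \<partial>gauss) - (\<integral>z. ?B (- z) \<partial>gauss) = (\<integral>z. ?A z - ?B (- z) \<partial>gauss)"
    by (rule Bochner_Integration.integral_diff[symmetric])
      (auto intro!: gauss_integrable_bounded[where C=1] simp: indicator_def)
  also have "\<dots> = (\<integral>z. indicator {y / s..<(y + 2) / s} z \<partial>gauss)"
    using s by (intro Bochner_Integration.integral_cong) (auto simp: indicator_def field_simps)
  also have "\<dots> = (\<integral>z. std_normal_density z * indicator {y / s..<(y + 2) / s} z \<partial>lborel)"
    by (rule integral_gauss) measurable
  also have "\<dots> \<ge> (\<integral>z. std_normal_density ((y + 2) / s) * indicator {y / s..<(y + 2) / s} z \<partial>lborel)"
  proof (rule integral_mono)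
    have "emeasure lborel {y / s..<(y + 2) / s} < \<infinity>"
      using s by (subst emeasure_lborel_Ico) (auto intro!: divide_right_mono)
    then show "integrable lborel (\<lambda>z. std_normal_density ((y + 2) / s) * indicat_real {y / s..<(y + 2) / s} z)"
      by (intro integrable_mult_right) (auto intro!: integrable_real_indicator)
    show "integrable lborel (\<lambda>z. std_normal_density z * indicat_real {y / s..<(y + 2) / s} z)"
      using integrable_mult_indicator[of "{y / s..<(y + 2) / s}" lborel std_normal_density]
      by (simp add: mult.commute)
    fix z
    show "std_normal_density ((y + 2) / s) * indicat_real {y / s..<(y + 2) / s} z \<le> std_normal_density z * indicat_real {y / s..<(y + 2) / s} z"
    proof (cases "z \<in> {y / s..<(y + 2) / s}")
      case True
      then have "0 \<le> z" "z \<le> (y + 2) / s" using y s order_trans[of 0 "y / s" z] by auto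
      then have "z\<^sup>2 \<le> ((y + 2) / s)\<^sup>2" by (intro power_mono) auto
      then show ?thesis using True by (simp add: std_normal_density_def divide_right_mono)
    qed simp
  qed
  also have "(\<integral>z. std_normal_density ((y + 2) / s) * indicator {y / s..<(y + 2) / s} z \<partial>lborel)
     = std_normal_density ((y + 2) / s) * (2 / s)"
    using s by (subst integral_mult_right_zero) (auto simp: measure_def emeasure_lborel_Ico divide_right_mono diff_divide_distrib[symmetric] enn2real_ennreal)
  also have "\<dots> = 2 / sqrt (2 * pi * t) * exp (- (y + 2)\<^sup>2 / (2 * t))"
    using s by (simp add: std_normal_density_def s_def real_sqrt_mult power_divide mult_ac)
  finally show ?thesis .
qed

lemma killed_heat_lower:
  assumes t: "t > 0" and y: "y \<ge> 0" and x: "\<bar>x\<bar> \<ge> R + 1"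
  shows "2 / sqrt (2 * pi * t) * exp (- (y + 2)\<^sup>2 / (2 * t)) \<le> killed_heat R (y + 1 + R) t x"
proof -
  have "gheat t (reflected_step R (y + 1 + R)) (R + 1) \<le> gheat t (reflected_step R (y + 1 + R)) \<bar>x\<bar>"
    using x by (rule gheat_reflected_step_mono)
  also have "\<dots> \<le> killed_heat R (y + 1 + R) t x"
    by (cases "x \<ge> 0") (auto simp: killed_heat_def)
  finally show ?thesis using gheat_reflected_step_lower[OF t y, of R] by linarith
qed

section \<open>Laplace functional estimates\<close>

lemma integral_measurable_kernel:
  fixes \<kappa> :: "'w \<Rightarrow> real measure" and f :: "real \<Rightarrow> real"
  assumes fin: "\<And>w. w \<in> space M \<Longrightarrow> finite_measure (\<kappa> w)" and sets: "\<And>w. w \<in> space M \<Longrightarrow> sets (\<kappa> w) = sets borel"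
    and m: "\<And>A. A \<in> sets borel \<Longrightarrow> (\<lambda>w. measure (\<kappa> w) A) \<in> borel_measurable M"
    and f: "f \<in> borel_measurable borel" "\<And>x. 0 \<le> f x"
  shows "(\<lambda>w. \<integral>x. f x \<partial>\<kappa> w) \<in> borel_measurable M"
proof -
  have "(\<lambda>w. \<integral>\<^sup>+x. ennreal (f x) \<partial>\<kappa> w) \<in> borel_measurable M"
  proof (rule kernel_nn_integral_measurable[where N=borel])
    fix A :: "real set" assume A: "A \<in> sets borel"
    have "(\<lambda>w. ennreal (measure (\<kappa> w) A)) \<in> borel_measurable M" using m[OF A] by measurable
    then show "(\<lambda>w. emeasure (\<kappa> w) A) \<in> borel_measurable M"
      using fin by (subst measurable_cong[where g="\<lambda>w. ennreal (measure (\<kappa> w) A)"])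
        (auto simp: finite_measure.emeasure_eq_measure)
  qed (use sets f in auto)
  then have "(\<lambda>w. enn2real (\<integral>\<^sup>+x. ennreal (f x) \<partial>\<kappa> w)) \<in> borel_measurable M" by measurable
  moreover have "(\<integral>x. f x \<partial>\<kappa> w) = enn2real (\<integral>\<^sup>+x. ennreal (f x) \<partial>\<kappa> w)" if "w \<in> space M" for w
  proof (rule integral_eq_nn_integral)
    show "f \<in> borel_measurable (\<kappa> w)" using f(1) measurable_cong_sets[OF sets[OF that] refl] by blast
  qed (use f in auto)
  ultimately show ?thesis by (simp cong: measurable_cong)
qed

section \<open>The superprocess, its filtration and its Markov property\<close>

locale super_bm = prob_space P for P :: "'w measure" +
  fixes X :: "real \<Rightarrow> 'w \<Rightarrow> real measure" and \<beta> \<alpha> :: "real \<Rightarrow> real" and \<pi> :: "real \<Rightarrow> real measure" and \<mu> :: "real measure"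
    and K :: real
  assumes params: "branching_params \<beta> \<alpha> \<pi>" and super: "superBM P X \<beta> \<alpha> \<pi> \<mu>"
    and beta_bound: "\<And>x. \<bar>\<beta> x\<bar> \<le> K"
begin

sublocale mechanism "psi \<beta> \<alpha> \<pi>" K
  by (rule psi_mechanism[OF params beta_bound])

abbreviation "\<F> s \<equiv> nat_filtration P X s"
abbreviation "U \<equiv> uf (psi \<beta> \<alpha> \<pi>)"

definition XI :: "real \<Rightarrow> 'w \<Rightarrow> (real \<Rightarrow> real) \<Rightarrow> real" where
  "XI t w f = (\<integral>x. f x \<partial>X t w)"

lemma X_finite: "t \<ge> 0 \<Longrightarrow> w \<in> space P \<Longrightarrow> finite_measure (X t w)"
  and X_sets: "t \<ge> 0 \<Longrightarrow> w \<in> space P \<Longrightarrow> sets (X t w) = sets borel"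
  and X_measurable: "t \<ge> 0 \<Longrightarrow> A \<in> sets borel \<Longrightarrow> (\<lambda>w. measure (X t w) A) \<in> borel_measurable P"
  using super by (auto simp: superBM_def)

lemma X_borel_measurable:
  "t \<ge> 0 \<Longrightarrow> w \<in> space P \<Longrightarrow> f \<in> borel_measurable borel \<Longrightarrow> (f :: real \<Rightarrow> real) \<in> borel_measurable (X t w)"
  using measurable_cong_sets[OF X_sets refl] by blast

lemma X_integrable:
  fixes f :: "real \<Rightarrow> real"
  assumes "t \<ge> 0" "w \<in> space P" "f \<in> borel_measurable borel" "\<And>x. \<bar>f x\<bar> \<le> C"
  shows "integrable (X t w) f"
  by (rule finite_measure.integrable_const_bound[OF X_finite[OF assms(1,2)], where B=C])
    (simp_all add: X_borel_measurable[OF assms(1-3)] assms(4))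

lemma X_space: "t \<ge> 0 \<Longrightarrow> w \<in> space P \<Longrightarrow> space (X t w) = UNIV"
  using sets_eq_imp_space_eq[OF X_sets] by simp

lemma space_F [simp]: "space (\<F> s) = space P"
  unfolding nat_filtration_def by (simp add: space_measure_of_conv)

lemma F_generators:
  "(\<Union>r \<in> {0..s}. \<Union>A \<in> sets borel. \<Union>B \<in> sets (borel :: real measure).
        {(\<lambda>\<omega>. measure (X r \<omega>) A) -` B \<inter> space P}) \<subseteq> Pow (space P)"
  by auto

lemma X_F_measurable:
  assumes "0 \<le> r" "r \<le> s" "A \<in> sets borel"
  shows "(\<lambda>w. measure (X r w) A) \<in> borel_measurable (\<F> s)"
proof (rule measurableI)
  fix B :: "real set" assume "B \<in> sets borel"
  then show "(\<lambda>w. measure (X r w) A) -` B \<inter> space (\<F> s) \<in> sets (\<F> s)"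
    unfolding space_F unfolding nat_filtration_def sets_measure_of[OF F_generators]
    using assms \<open>B \<in> sets borel\<close> by (intro sigma_sets.Basic UN_I[of r] UN_I[of A] UN_I[of B]) auto
qed simp

lemma F_subalgebra: "subalgebra P (\<F> s)"
  unfolding subalgebra_def
proof
  show "sets (\<F> s) \<subseteq> sets P"
    unfolding nat_filtration_def sets_measure_of[OF F_generators]
    by (rule sets.sigma_sets_subset) (auto intro!: measurable_sets[OF X_measurable])
qed simp

lemma XI_F_measurable:
  assumes "0 \<le> r" "r \<le> s" "f \<in> borel_measurable borel" "\<And>x. 0 \<le> f x"
  shows "(\<lambda>w. XI r w f) \<in> borel_measurable (\<F> s)"
  unfolding XI_def using assms
  by (intro integral_measurable_kernel X_F_measurable) (simp_all add: X_finite X_sets)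

lemma XI_measurable:
  assumes "0 \<le> r" "f \<in> borel_measurable borel" "\<And>x. 0 \<le> f x"
  shows "(\<lambda>w. XI r w f) \<in> borel_measurable P"
  using measurable_from_subalg[OF F_subalgebra XI_F_measurable[OF assms(1) order_refl assms(2,3)]] .

lemma XI_nonneg: "(\<And>x. 0 \<le> f x) \<Longrightarrow> 0 \<le> XI r w f"
  unfolding XI_def by (intro Bochner_Integration.integral_nonneg)

lemma XI_mono:
  assumes "t \<ge> 0" "w \<in> space P" "f \<in> borel_measurable borel" "\<And>x. \<bar>f x\<bar> \<le> C" 
    "g \<in> borel_measurable borel" "\<And>x. \<bar>g x\<bar> \<le> D" "\<And>x. f x \<le> g x"
  shows "XI t w f \<le> XI t w g"
  unfolding XI_def by (intro integral_mono X_integrable[where C=C] X_integrable[where C=D] assms)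

lemma XI_cmult: "XI t w (\<lambda>x. c * f x) = c * XI t w f"
  unfolding XI_def by simp

lemma XI_indicator:
  assumes "t \<ge> 0" "w \<in> space P" "A \<in> sets borel"
  shows "XI t w (indicator A) = measure (X t w) A"
  unfolding XI_def using assms X_sets[of t w] X_space[of t w] by simp

lemma U_mild: "bounded_nonneg_fun f \<Longrightarrow> mild_solution (psi \<beta> \<alpha> \<pi>) f (U f)"
  by (rule uf_mild)

lemma bounded_nonneg_measurable: "bounded_nonneg_fun f \<Longrightarrow> f \<in> borel_measurable borel"
  by (simp add: bounded_nonneg_fun_def)

lemma U_nonneg: "bounded_nonneg_fun f \<Longrightarrow> 0 \<le> U f t x"
  using mild_nonneg[OF U_mild bounded_nonneg_measurable] .

lemma U_measurable: "bounded_nonneg_fun f \<Longrightarrow> U f t \<in> borel_measurable borel"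
  using mild_measurable[OF U_mild bounded_nonneg_measurable, of f] by measurable

lemma U_bounded: "bounded_nonneg_fun f \<Longrightarrow> t \<ge> 0 \<Longrightarrow> \<exists>C. \<forall>x. \<bar>U f t x\<bar> \<le> C"
  using mild_locally_bdd[OF U_mild bounded_nonneg_measurable, of f] unfolding locally_bdd_def
  by (meson atLeastAtMost_iff order_refl)

text \<open>The conditional Laplace formula integrated against a bounded variable of the past; later
  arguments use this form and no conditional expectations.\<close>

lemma laplace_test:
  assumes st: "0 \<le> s" "0 \<le> t" and f: "bounded_nonneg_fun f"
    and Y: "Y \<in> borel_measurable (\<F> s)" "\<And>w. \<bar>Y w\<bar> \<le> C"
  shows "(\<integral>w. Y w * exp (- XI (s + t) w f) \<partial>P) = (\<integral>w. Y w * exp (- XI s w (U f t)) \<partial>P)"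
proof -
  interpret F: finite_measure_subalgebra P "\<F> s"
    by unfold_locales (rule F_subalgebra)
  have f': "f \<in> borel_measurable borel" "\<And>x. 0 \<le> f x" using f by (auto simp: bounded_nonneg_fun_def)
  have [measurable]: "Y \<in> borel_measurable P" using measurable_from_subalg[OF F_subalgebra Y(1)] .
  have [measurable]: "(\<lambda>w. XI (s + t) w f) \<in> borel_measurable P"
    using st by (intro XI_measurable f') auto
  have i: "integrable P (\<lambda>w. Y w * exp (- XI (s + t) w f))"
  proof (rule integrable_const_bound[where B=C])
    show "AE w in P. norm (Y w * exp (- XI (s + t) w f)) \<le> C"
    proof (rule AE_I2)
      fix w
      have "\<bar>Y w\<bar> * exp (- XI (s + t) w f) \<le> C * 1"
        using XI_nonneg[of f, OF f'(2)] Y(2)[of w] order_trans[OF abs_ge_zero Y(2)] by (intro mult_mono) auto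
      then show "norm (Y w * exp (- XI (s + t) w f)) \<le> C" by (simp add: abs_mult)
    qed
  qed measurable
  have "(\<integral>w. Y w * exp (- XI (s + t) w f) \<partial>P) = (\<integral>w. Y w * real_cond_exp P (\<F> s) (\<lambda>w. exp (- XI (s + t) w f)) w \<partial>P)"
    by (rule F.real_cond_exp_intg(2)[symmetric]) (use i Y in auto)
  also have "\<dots> = (\<integral>w. Y w * exp (- XI s w (U f t)) \<partial>P)"
  proof (rule integral_cong_AE)
    have "AE w in P. real_cond_exp P (\<F> s) (\<lambda>w. exp (- XI (s + t) w f)) w = exp (- XI s w (U f t))"
      using super st f unfolding superBM_def XI_def by blast
    then show "AE w in P. Y w * real_cond_exp P (\<F> s) (\<lambda>w. exp (- XI (s + t) w f)) w = Y w * exp (- XI s w (U f t))"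
      by eventually_elim simp
    have [measurable]: "(\<lambda>w. XI s w (U f t)) \<in> borel_measurable P"
      using st by (intro XI_measurable U_measurable[OF f] U_nonneg[OF f])
    show "(\<lambda>w. Y w * exp (- XI s w (U f t))) \<in> borel_measurable P" by measurable
  qed measurable
  finally show ?thesis .
qed

text \<open>Chernoff bound: \<open>exp (\<langle>U f t, X\<^sub>s\<rangle> - \<langle>f, X\<^sub>s\<^sub>+\<^sub>t\<rangle>)\<close> has mean at most 1.\<close>

lemma laplace_lower_tail:
  assumes st: "0 \<le> s" "0 \<le> t" and f: "bounded_nonneg_fun f"
  shows "prob {w \<in> space P. XI (s + t) w f \<le> XI s w (U f t) - c} \<le> exp (- c)"
proof -
  have f': "f \<in> borel_measurable borel" "\<And>x. 0 \<le> f x" using f by (auto simp: bounded_nonneg_fun_def)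
  have mU: "(\<lambda>w. XI s w (U f t)) \<in> borel_measurable (\<F> s)"
    using st by (intro XI_F_measurable U_measurable[OF f] U_nonneg[OF f]) auto
  have [measurable]: "(\<lambda>w. XI s w (U f t)) \<in> borel_measurable P" "(\<lambda>w. XI (s + t) w f) \<in> borel_measurable P"
    using st by (auto intro!: XI_measurable U_measurable[OF f] U_nonneg[OF f] f')
  let ?E = "\<lambda>m::nat. {w \<in> space P. XI (s + t) w f \<le> XI s w (U f t) - c \<and> XI s w (U f t) \<le> real m}"
  have bnd: "prob (?E m) \<le> exp (- c)" for m
  proof -
    \<comment> \<open>The exponential weight may be unbounded, so its exponent is capped at m. On
      \<open>?E m\<close> the cap is inactive, and m is removed by continuity from below.\<close>
    define Y where "Y w = exp (min (XI s w (U f t)) (real m))" for w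
    have Y: "Y \<in> borel_measurable (\<F> s)" "\<And>w. \<bar>Y w\<bar> \<le> exp (real m)"
      unfolding Y_def using mU by (intro measurable_compose[OF _ borel_measurable_exp] borel_measurable_min, auto)
    have [measurable]: "Y \<in> borel_measurable P" using measurable_from_subalg[OF F_subalgebra Y(1)] .
    have i: "integrable P (\<lambda>w. Y w * exp (- XI r w g))" if "0 \<le> r" "g \<in> borel_measurable borel" "\<And>x. 0 \<le> g x" for r g
    proof (rule integrable_const_bound[where B="exp (real m)"])
      show "AE w in P. norm (Y w * exp (- XI r w g)) \<le> exp (real m)"
      proof (rule AE_I2)
        fix w
        have "\<bar>Y w\<bar> * exp (- XI r w g) \<le> exp (real m) * 1"
          using XI_nonneg[of g, OF that(3)] by (intro mult_mono Y) auto
        then show "norm (Y w * exp (- XI r w g)) \<le> exp (real m)" by (simp add: abs_mult)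
      qed
      show "(\<lambda>w. Y w * exp (- XI r w g)) \<in> borel_measurable P"
        using XI_measurable[OF that] by measurable
    qed
    have "exp c * prob (?E m) = (\<integral>w. exp c * indicator (?E m) w \<partial>P)"
      by simp
    also have "\<dots> \<le> (\<integral>w. Y w * exp (- XI (s + t) w f) \<partial>P)"
    proof (rule integral_mono)
      show "integrable P (\<lambda>w. exp c * indicat_real (?E m) w)"
        by (intro integrable_mult_right integrable_real_indicator) (auto simp: emeasure_eq_measure)
      show "integrable P (\<lambda>w. Y w * exp (- XI (s + t) w f))" using st by (intro i f') auto
      fix w
      show "exp c * indicat_real (?E m) w \<le> Y w * exp (- XI (s + t) w f)"
      proof (cases "w \<in> ?E m")
        case True
        then have "Y w * exp (- XI (s + t) w f) = exp (XI s w (U f t) - XI (s + t) w f)"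
          by (simp add: Y_def exp_diff exp_minus field_simps)
        then show ?thesis using True by simp
      qed (simp add: Y_def)
    qed
    also have "\<dots> = (\<integral>w. Y w * exp (- XI s w (U f t)) \<partial>P)"
      by (rule laplace_test[OF st f Y])
    also have "\<dots> \<le> (\<integral>w. 1 \<partial>P)"
    proof (rule integral_mono)
      show "integrable P (\<lambda>w. Y w * exp (- XI s w (U f t)))"
        using st by (intro i U_measurable[OF f] U_nonneg[OF f])
      show "Y w * exp (- XI s w (U f t)) \<le> 1" for w
        by (simp add: Y_def exp_add[symmetric] min_def)
    qed simp
    finally show ?thesis by (simp add: exp_minus prob_space field_simps)
  qed
  have "(\<lambda>m. prob (?E m)) \<longlonglongrightarrow> prob (\<Union>m. ?E m)"
    by (rule finite_Lim_measure_incseq) (auto simp: incseq_def)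
  moreover have "(\<Union>m. ?E m) = {w \<in> space P. XI (s + t) w f \<le> XI s w (U f t) - c}"
    by (auto intro: real_arch_simple)
  ultimately show ?thesis using bnd by (intro LIMSEQ_le_const2[where X="\<lambda>m. prob (?E m)"]) auto
qed

text \<open>The tail bound for the test function \<theta> f with deficit \<theta> \<epsilon> shows
  that a deficit of \<epsilon> has probability at most exp (- \<theta> \<epsilon>), for every
  \<theta>.\<close>

lemma deterministic_lower_bound:
  assumes st: "0 \<le> s" "0 \<le> t" and f: "bounded_nonneg_fun f"
    and v[measurable]: "v \<in> borel_measurable borel" and v0: "\<And>x. 0 \<le> v x"
    and vU: "\<And>\<theta> x. \<theta> > 0 \<Longrightarrow> \<theta> * v x \<le> U (\<lambda>x. \<theta> * f x) t x"
  shows "AE w in P. XI s w v \<le> XI (s + t) w f"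
proof -
  have f': "f \<in> borel_measurable borel" "\<And>x. 0 \<le> f x" using f by (auto simp: bounded_nonneg_fun_def)
  have bf: "bounded_nonneg_fun (\<lambda>x. \<theta> * f x)" if "\<theta> \<ge> 0" for \<theta>
  proof -
    from f obtain C where "\<forall>y\<in>range f. norm y \<le> C" unfolding bounded_nonneg_fun_def bounded_iff by blast
    then have "\<bar>f x\<bar> \<le> C" for x by auto
    then have "\<bar>\<theta> * f x\<bar> \<le> \<theta> * C" for x using that by (auto simp: abs_mult intro: mult_left_mono)
    then have "bounded (range (\<lambda>x. \<theta> * f x))" by (intro boundedI[where B="\<theta> * C"]) auto
    then show ?thesis using f' that by (auto simp: bounded_nonneg_fun_def)
  qed
  obtain C where C: "\<And>x. \<bar>U (\<lambda>x. 1 * f x) t x\<bar> \<le> C" using U_bounded[OF bf[of 1] st(2)] by auto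
  \<comment> \<open>The case \<theta> = 1 already bounds \<open>v\<close>, which makes its integrals
    against the process legitimate.\<close>
  have vC: "\<bar>v x\<bar> \<le> C" for x using vU[of 1 x] v0[of x] C[of x] by auto
  have [measurable]: "(\<lambda>w. XI s w v) \<in> borel_measurable P" "(\<lambda>w. XI (s + t) w f) \<in> borel_measurable P"
    using st v0 by (auto intro!: XI_measurable f')
  have null: "prob {w \<in> space P. XI (s + t) w f \<le> XI s w v - \<epsilon>} = 0" if e: "\<epsilon> > 0" for \<epsilon>
  proof -
    have "prob {w \<in> space P. XI (s + t) w f \<le> XI s w v - \<epsilon>} \<le> exp (- (real (Suc n) * \<epsilon>))" for n
    proof -
      define \<theta> where "\<theta> = real (Suc n)"
      have th: "\<theta> > 0" by (simp add: \<theta>_def)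
      let ?g = "\<lambda>x. \<theta> * f x"
      have bg: "bounded_nonneg_fun ?g" using bf[of \<theta>] th by simp
      obtain D where D: "\<And>x. \<bar>U ?g t x\<bar> \<le> D" using U_bounded[OF bg st(2)] by auto
      have [measurable]: "(\<lambda>w. XI s w (U ?g t)) \<in> borel_measurable P" "(\<lambda>w. XI (s + t) w ?g) \<in> borel_measurable P"
        using st bg by (auto intro!: XI_measurable U_measurable[OF bg] U_nonneg[OF bg] bounded_nonneg_measurable simp: bounded_nonneg_fun_def)
      have "prob {w \<in> space P. XI (s + t) w f \<le> XI s w v - \<epsilon>} \<le> prob {w \<in> space P. XI (s + t) w ?g \<le> XI s w (U ?g t) - \<theta> * \<epsilon>}"
      proof (rule finite_measure_mono)
        show "{w \<in> space P. XI (s + t) w f \<le> XI s w v - \<epsilon>} \<subseteq> {w \<in> space P. XI (s + t) w ?g \<le> XI s w (U ?g t) - \<theta> * \<epsilon>}"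
        proof safe
          fix w assume w: "w \<in> space P" "XI (s + t) w f \<le> XI s w v - \<epsilon>"
          have "\<bar>\<theta> * v x\<bar> \<le> \<theta> * C" for x unfolding abs_mult using th vC[of x] by (auto intro: mult_left_mono)
          then have "XI s w (\<lambda>x. \<theta> * v x) \<le> XI s w (U ?g t)"
            using vU[OF th] D by (intro XI_mono[OF st(1) w(1), where C="\<theta> * C" and D=D] U_measurable[OF bg]) auto
          moreover have "\<theta> * XI (s + t) w f \<le> \<theta> * (XI s w v - \<epsilon>)" using th w by (intro mult_left_mono) auto
          ultimately show "XI (s + t) w ?g \<le> XI s w (U ?g t) - \<theta> * \<epsilon>"
            by (simp add: XI_cmult algebra_simps)
        qed
      qed measurable
      also have "\<dots> \<le> exp (- (\<theta> * \<epsilon>))" by (rule laplace_lower_tail[OF st bg])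
      finally show ?thesis by (simp add: \<theta>_def)
    qed
    moreover have "(\<lambda>n. exp (- (real (Suc n) * \<epsilon>))) \<longlonglongrightarrow> 0" using e by real_asymp
    ultimately have "prob {w \<in> space P. XI (s + t) w f \<le> XI s w v - \<epsilon>} \<le> 0"
      by (intro LIMSEQ_le_const) auto
    then show ?thesis by (simp add: measure_le_0_iff)
  qed
  have "AE w in P. \<not> XI (s + t) w f \<le> XI s w v - 1 / real (Suc j)" for j
    using null[of "1 / real (Suc j)"]
    by (intro AE_I[where N="{w \<in> space P. XI (s + t) w f \<le> XI s w v - 1 / real (Suc j)}"]) (auto simp: emeasure_eq_measure)
  then have "AE w in P. \<forall>j. \<not> XI (s + t) w f \<le> XI s w v - 1 / real (Suc j)"
    unfolding AE_all_countable ..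
  then show ?thesis
  proof eventually_elim
    case (elim w)
    have "(\<lambda>j. XI s w v - 1 / real (Suc j)) \<longlonglongrightarrow> XI s w v - 0"
      by (intro tendsto_diff tendsto_const LIMSEQ_Suc[OF lim_1_over_n])
    then show ?case using elim by (intro LIMSEQ_le_const2) (auto simp: not_le intro: less_imp_le)
  qed
qed

end

section \<open>Lower bounds on the mass\<close>

text \<open>A strict violation at t would persist on a right neighbourhood, which contains
  rationals. No information at t itself is used.\<close>

lemma le_from_right_rationals:
  fixes F \<phi> :: "real \<Rightarrow> real"
  assumes "continuous (at_right t) F" "continuous (at_right t) \<phi>"
    and le: "\<And>q. q \<in> \<rat> \<Longrightarrow> q > t \<Longrightarrow> \<phi> q \<le> F q"
  shows "\<phi> t \<le> F t"
proof (rule ccontr)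
  assume "\<not> \<phi> t \<le> F t"
  moreover have "((\<lambda>q. F q - \<phi> q) \<longlongrightarrow> F t - \<phi> t) (at_right t)"
    using assms by (intro tendsto_diff) (auto simp: continuous_within)
  ultimately have "\<forall>\<^sub>F q in at_right t. F q - \<phi> q < 0"
    by (intro order_tendstoD(2)) auto
  then obtain b where b: "b > t" "\<And>q. t < q \<Longrightarrow> q < b \<Longrightarrow> F q - \<phi> q < 0"
    unfolding eventually_at_right_field by auto
  obtain q where "q \<in> \<rat>" "t < q" "q < b" using Rats_dense_in_real[OF b(1)] by blast
  then show False using le[of q] b(2)[of q] by auto
qed

text \<open>Doob's maximal inequality for finitely many times, with the supermartingale property
  given as an inequality of integrals over past events.\<close>

lemma (in prob_space) supermartingale_maximal:
  fixes S :: "nat \<Rightarrow> 'a \<Rightarrow> real" and F :: "nat \<Rightarrow> 'a measure"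
  assumes sub: "\<And>k. subalgebra M (F k)"
    and S: "\<And>j k. j \<le> k \<Longrightarrow> S j \<in> borel_measurable (F k)"
    and S01: "\<And>k w. 0 \<le> S k w" "\<And>k w. S k w \<le> 1"
    and super: "\<And>k B. B \<in> sets (F k) \<Longrightarrow> (\<integral>w. indicator B w * S (Suc k) w \<partial>M) \<le> (\<integral>w. indicator B w * S k w \<partial>M)"
  shows "c * prob {w \<in> space M. \<exists>j\<le>k. c \<le> S j w} \<le> (\<integral>w. S 0 w \<partial>M)"
proof -
  define B where "B k = {w \<in> space M. \<exists>j\<le>k. c \<le> S j w}" for k
  have SM[measurable]: "S k \<in> borel_measurable M" for k
    using measurable_from_subalg[OF sub S[OF order_refl]] .
  have BF: "B k \<in> sets (F k)" for k
  proof -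
    have "{w \<in> space (F k). \<exists>j\<in>{..k}. c \<le> S j w} \<in> sets (F k)"
      by (intro sets.sets_Collect_finite_Ex borel_measurable_le S) auto
    moreover have "{w \<in> space (F k). \<exists>j\<in>{..k}. c \<le> S j w} = B k"
      using sub[of k] by (auto simp: B_def subalgebra_def)
    ultimately show ?thesis by simp
  qed
  have BM[measurable]: "B k \<in> sets M" for k using BF[of k] sub[of k] by (auto simp: subalgebra_def)
  have CF: "space M - B k \<in> sets (F k)" for k
    using sets.compl_sets[OF BF[of k]] sub[of k] by (simp add: subalgebra_def)
  have i: "integrable M (\<lambda>w. indicator A w * S j w)" if [measurable]: "A \<in> sets M" for A j
    using S01 by (intro integrable_const_bound[where B=1]) (auto simp: indicator_def)
  have ind: "integrable M (\<lambda>w. c * indicator (A \<inter> A') w)" if [measurable]: "A \<in> sets M" "A' \<in> sets M" for A A'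
    by (intro integrable_mult_right integrable_real_indicator) (auto simp: emeasure_eq_measure)
  \<comment> \<open>The invariant retains the expectation on the paths that have not yet reached c;
    the supermartingale property is applied there, and the newly arriving paths pay at least c
    each.\<close>
  have "c * prob (B k) + (\<integral>w. indicator (space M - B k) w * S k w \<partial>M) \<le> (\<integral>w. S 0 w \<partial>M)" for k
  proof (induction k)
    case 0
    have "c * prob (B 0) + (\<integral>w. indicator (space M - B 0) w * S 0 w \<partial>M)
        = (\<integral>w. c * indicator (B 0 \<inter> B 0) w \<partial>M) + (\<integral>w. indicator (space M - B 0) w * S 0 w \<partial>M)"
      by simp
    also have "\<dots> = (\<integral>w. c * indicator (B 0 \<inter> B 0) w + indicator (space M - B 0) w * S 0 w \<partial>M)"
      by (rule Bochner_Integration.integral_add[symmetric]) (intro ind i; measurable)+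
    also have "\<dots> \<le> (\<integral>w. S 0 w \<partial>M)"
    proof (rule integral_mono)
      show "integrable M (S 0)" using S01 by (intro integrable_const_bound[where B=1]) auto
      show "c * indicator (B 0 \<inter> B 0) w + indicator (space M - B 0) w * S 0 w \<le> S 0 w" if "w \<in> space M" for w
        using S01(1)[of 0 w] that by (auto simp: indicator_def B_def)
    qed (intro Bochner_Integration.integrable_add ind i; measurable)
    finally show ?case .
  next
    case (Suc k)
    have dis: "B (Suc k) = B k \<union> (B (Suc k) \<inter> (space M - B k))" "B k \<inter> (B (Suc k) \<inter> (space M - B k)) = {}"
      by (auto simp: B_def le_Suc_eq)
    have "prob (B (Suc k)) = prob (B k) + prob (B (Suc k) \<inter> (space M - B k))"
      by (subst dis(1), rule finite_measure_Union) (use dis(2) in auto)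
    then have "c * prob (B (Suc k)) + (\<integral>w. indicator (space M - B (Suc k)) w * S (Suc k) w \<partial>M)
      = c * prob (B k) + ((\<integral>w. c * indicator (B (Suc k) \<inter> (space M - B k)) w \<partial>M) + (\<integral>w. indicator (space M - B (Suc k)) w * S (Suc k) w \<partial>M))"
      by (simp add: distrib_left)
    also have "(\<integral>w. c * indicator (B (Suc k) \<inter> (space M - B k)) w \<partial>M) + (\<integral>w. indicator (space M - B (Suc k)) w * S (Suc k) w \<partial>M)
      = (\<integral>w. c * indicator (B (Suc k) \<inter> (space M - B k)) w + indicator (space M - B (Suc k)) w * S (Suc k) w \<partial>M)"
      by (rule Bochner_Integration.integral_add[symmetric]) (intro ind i; measurable)+
    also have "\<dots> \<le> (\<integral>w. indicator (space M - B k) w * S (Suc k) w \<partial>M)"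
    proof (rule integral_mono)
      show "c * indicator (B (Suc k) \<inter> (space M - B k)) w + indicator (space M - B (Suc k)) w * S (Suc k) w
         \<le> indicator (space M - B k) w * S (Suc k) w" if "w \<in> space M" for w
        using S01(1)[of "Suc k" w] that by (auto simp: indicator_def B_def le_Suc_eq)
    qed (intro Bochner_Integration.integrable_add ind i; measurable)+
    also have "\<dots> \<le> (\<integral>w. indicator (space M - B k) w * S k w \<partial>M)"
      by (rule super[OF CF])
    finally show ?case using Suc by linarith
  qed
  from this[of k] have "c * prob (B k) + 0 \<le> (\<integral>w. S 0 w \<partial>M)"
    using S01 by (elim order_trans[rotated]) (intro add_mono Bochner_Integration.integral_nonneg, auto simp: indicator_def)
  then show ?thesis by (simp add: B_def)
qed

context super_bm begin

lemma XI_right_continuous: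
  assumes "w \<in> space P" "t \<ge> 0" "continuous_on UNIV f" "bounded (range f)"
  shows "continuous (at_right t) (\<lambda>t. XI t w f)"
  using super assms unfolding superBM_def cadlag_on_nonneg_def XI_def by blast

text \<open>A continuous ramp stands in for the indicator of |x| >= y, so that right continuity can
  later extend the bound to all times. The killed flow starts from a step at y + 1 + R, where the
  ramp already equals 1.\<close>

lemma outflow_rational:
  assumes R: "R \<ge> 0" "\<And>x l. \<bar>x\<bar> > R \<Longrightarrow> l \<ge> 0 \<Longrightarrow> psi \<beta> \<alpha> \<pi> x l = 0"
    and y: "y \<ge> 0" and s: "s \<ge> 0" and t: "t > 0"
  shows "AE w in P. 2 / sqrt (2 * pi * t) * exp (- (y + 2)\<^sup>2 / (2 * t)) * measure (X s w) {x. \<bar>x\<bar> \<ge> R + 1}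
    \<le> XI (s + t) w (\<lambda>x. max 0 (min 1 (\<bar>x\<bar> - y)))"
proof -
  define f where "f x = max 0 (min 1 (\<bar>x\<bar> - y))" for x :: real
  have fm[measurable]: "f \<in> borel_measurable borel" unfolding f_def by measurable
  have f01: "0 \<le> f x" "f x \<le> 1" for x by (auto simp: f_def)
  have bf: "bounded_nonneg_fun (\<lambda>x. \<theta> * f x)" if "\<theta> \<ge> 0" for \<theta>
  proof -
    have "norm (\<theta> * f x) \<le> \<theta>" for x using that mult_left_le[OF f01(2)[of x] that] f01(1)[of x] by simp
    then show ?thesis
      unfolding bounded_nonneg_fun_def using that f01 by (auto intro!: boundedI[where B=\<theta>])
  qed
  define v where "v = killed_heat R (y + 1 + R)"
  define c where "c = 2 / sqrt (2 * pi * t) * exp (- (y + 2)\<^sup>2 / (2 * t))"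
  have c0: "c \<ge> 0" using t by (simp add: c_def)
  have vm[measurable]: "jointly_measurable v" unfolding v_def by measurable
  have v01: "0 \<le> v t x" "v t x \<le> 1" for t x unfolding v_def by (rule killed_heat_nonneg killed_heat_le_1)+
  have "AE w in P. XI s w (v t) \<le> XI (s + t) w f"
  proof (rule deterministic_lower_bound)
    show "bounded_nonneg_fun f" using bf[of 1] by simp
    fix \<theta> x :: real assume th: "\<theta> > 0"
    show "\<theta> * v t x \<le> U (\<lambda>x. \<theta> * f x) t x"
    proof (rule mild_lower_subsolution[where v="\<lambda>t x. \<theta> * v t x" and V=\<theta> and F=\<theta>])
      show "mild_solution (psi \<beta> \<alpha> \<pi>) (\<lambda>x. \<theta> * f x) (U (\<lambda>x. \<theta> * f x))" using bf th by (intro U_mild) auto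
      show "\<theta> * f x \<le> \<theta>" "\<theta> * v t x \<le> \<theta>" "0 \<le> \<theta> * f x" "0 \<le> \<theta> * v t x" for t x
        using th f01[of x] v01[of t x] by (auto intro: mult_left_le)
      show "\<theta> * v t x \<le> gheat s (\<lambda>x. \<theta> * v (t - s) x) x" if "0 \<le> s" "s \<le> t" for s t x
        unfolding gheat_cmult v_def using killed_heat_subsolution[OF that] th by (intro mult_left_mono) auto
      show "\<theta> * v t x = 0 \<or> (\<forall>l\<ge>0. psi \<beta> \<alpha> \<pi> x l = 0)" for t x
        using R(2)[of x] killed_heat_eq_0[of x R] by (cases "\<bar>x\<bar> > R") (auto simp: v_def)
      show "\<theta> * v 0 x \<le> \<theta> * f x" for x
      proof (rule mult_left_mono)
        have "v 0 x \<le> indicator {z. \<bar>z\<bar> \<ge> y + 1 + R} x"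
          unfolding v_def using y R by (intro killed_heat_0_le) auto
        also have "\<dots> \<le> f x" using y R by (auto simp: f_def indicator_def)
        finally show "v 0 x \<le> f x" .
      qed (use th in simp)
    qed (use t in auto)
  qed (use s t v01 in auto)
  moreover have "AE w in P. c * measure (X s w) {x. \<bar>x\<bar> \<ge> R + 1} \<le> XI s w (v t)"
  proof (rule AE_I2)
    fix w assume w: "w \<in> space P"
    have "c * measure (X s w) {x. \<bar>x\<bar> \<ge> R + 1} = XI s w (\<lambda>x. c * indicator {x. \<bar>x\<bar> \<ge> R + 1} x)"
      using s w by (simp add: XI_cmult XI_indicator)
    also have "\<dots> \<le> XI s w (v t)"
    proof (rule XI_mono[OF s w, where C=c and D=1])
      show "c * indicator {x. \<bar>x\<bar> \<ge> R + 1} x \<le> v t x" for x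
        using killed_heat_lower[OF t y, of R x] v01[of t x] by (auto simp: indicator_def c_def v_def)
    qed (use c0 v01 in \<open>auto simp: indicator_def\<close>)
    finally show "c * measure (X s w) {x. \<bar>x\<bar> \<ge> R + 1} \<le> XI s w (v t)" .
  qed
  ultimately show ?thesis
    unfolding f_def[abs_def] c_def by eventually_elim linarith
qed

text \<open>One null set has to serve all real t. Rational times and integers n, y are countable,
  and both the ramp integral and the Gaussian factor are right continuous for t > n.\<close>

lemma outflow:
  assumes R: "R \<ge> 0" "\<And>x l. \<bar>x\<bar> > R \<Longrightarrow> l \<ge> 0 \<Longrightarrow> psi \<beta> \<alpha> \<pi> x l = 0"
  shows "AE w in P. \<forall>n y :: nat. \<forall>t. t > real n \<longrightarrow>
     2 / sqrt (2 * pi * (t - n)) * exp (- (real y + 2)\<^sup>2 / (2 * (t - n))) * measure (X n w) {x. \<bar>x\<bar> \<ge> R + 1}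
      \<le> measure (X t w) {x. \<bar>x\<bar> \<ge> y}"
proof -
  let ?f = "\<lambda>y x. max 0 (min 1 (\<bar>x\<bar> - real y))"
  let ?c = "\<lambda>t y. 2 / sqrt (2 * pi * t) * exp (- (real y + 2)\<^sup>2 / (2 * t))"
  have "AE w in P. q > real n \<longrightarrow> ?c (q - n) y * measure (X n w) {x. \<bar>x\<bar> \<ge> R + 1} \<le> XI q w (?f y)" for n y :: nat and q
    using outflow_rational[OF R, of "real y" "real n" "q - n"] by (cases "q > n") auto
  then have "AE w in P. \<forall>q\<in>\<rat>. \<forall>n y :: nat. q > real n \<longrightarrow> ?c (q - n) y * measure (X n w) {x. \<bar>x\<bar> \<ge> R + 1} \<le> XI q w (?f y)"
    by (simp add: AE_ball_countable countable_rat AE_all_countable)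
  then show ?thesis
  proof (rule AE_mp, intro AE_I2 impI allI)
    fix w n y t
    assume w: "w \<in> space P"
      and *: "\<forall>q\<in>\<rat>. \<forall>n y :: nat. q > real n \<longrightarrow> ?c (q - n) y * measure (X n w) {x. \<bar>x\<bar> \<ge> R + 1} \<le> XI q w (?f y)"
      and t: "t > real n"
    have t0: "t \<ge> 0" using t by linarith
    have "?c (t - n) y * measure (X n w) {x. \<bar>x\<bar> \<ge> R + 1} \<le> XI t w (?f y)"
    proof (rule le_from_right_rationals[where \<phi>="\<lambda>t. ?c (t - n) y * measure (X n w) {x. \<bar>x\<bar> \<ge> R + 1}"])
      show "continuous (at_right t) (\<lambda>t. XI t w (?f y))"
        using w t0 by (intro XI_right_continuous continuous_intros boundedI[where B=1]) auto
      show "continuous (at_right t) (\<lambda>t. ?c (t - n) y * measure (X n w) {x. \<bar>x\<bar> \<ge> R + 1})"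
        using t by (intro continuous_intros) auto
    qed (use * t in auto)
    also have "\<dots> \<le> XI t w (indicator {x. \<bar>x\<bar> \<ge> y})"
      by (rule XI_mono[OF t0 w, where C=1 and D=1]) (auto simp: indicator_def)
    also have "\<dots> = measure (X t w) {x. \<bar>x\<bar> \<ge> y}" by (rule XI_indicator[OF t0 w]) measurable
    finally show "?c (t - n) y * measure (X n w) {x. \<bar>x\<bar> \<ge> R + 1} \<le> measure (X t w) {x. \<bar>x\<bar> \<ge> y}" .
  qed
qed

text \<open>Heat flow charges the outer set within unit time uniformly in the starting point, so
  \<open>U f 1\<close> is at least a constant \<kappa>. A deficit n has the summable probability exp
  (- n), and an error n is harmless against exponential growth.\<close>

lemma spreading:
  assumes R: "R \<ge> 0"
  shows "\<exists>\<kappa>>0. AE w in P. \<forall>\<^sub>F n in sequentially. 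
     \<kappa> * measure (X (real n) w) UNIV - real n \<le> measure (X (real n + 1) w) {x. \<bar>x\<bar> \<ge> R + 1}"
proof -
  define f where "f = (indicator {x. \<bar>x\<bar> \<ge> R + 1} :: real \<Rightarrow> real)"
  have [measurable]: "f \<in> borel_measurable borel" unfolding f_def by measurable
  have f01: "0 \<le> f x" "f x \<le> 1" for x by (auto simp: f_def indicator_def)
  have bf: "bounded_nonneg_fun f"
    unfolding bounded_nonneg_fun_def using f01 by (auto intro!: boundedI[where B=1])
  define p where "p = (\<integral>z. indicator {R + 1..} z \<partial>gauss :: real)"
  have p0: "p > 0"
  proof -
    \<comment> \<open>Positivity of the Gaussian tail is taken from the reflected step with barrier
      0: from 1, reaching R + 2 means z >= R + 1.\<close>
    have "0 < 2 / sqrt (2 * pi * 1) * exp (- (R + 1 + 2)\<^sup>2 / (2 * 1))" by simp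
    also have "\<dots> \<le> gheat 1 (reflected_step 0 (R + 1 + 1 + 0)) (0 + 1)"
      using R by (intro gheat_reflected_step_lower) auto
    also have "\<dots> \<le> p"
      unfolding gheat_def p_def
      by (intro integral_mono gauss_integrable_shift[where C=1] gauss_integrable_bounded[where C=1])
         (auto simp: reflected_step_def indicator_def)
    finally show ?thesis .
  qed
  have hsp: "p \<le> gheat 1 f x" for x
  proof (cases "x \<ge> 0")
    case True
    then show ?thesis unfolding gheat_def p_def
      by (intro integral_mono gauss_integrable_shift[where C=1] gauss_integrable_bounded[where C=1])
         (auto simp: f_def indicator_def)
  next
    case False
    have "p = (\<integral>z. indicator {R + 1..} (- z) \<partial>gauss)"
      unfolding p_def by (rule gauss_integral_uminus[symmetric]) measurable
    also have "\<dots> \<le> gheat 1 f x"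
      unfolding gheat_def using False
      by (intro integral_mono gauss_integrable_shift[where C=1] gauss_integrable_bounded[where C=1])
         (auto simp: f_def indicator_def)
    finally show ?thesis .
  qed
  obtain k where k: "\<And>x. exp (- k) * gheat 1 f x \<le> U f 1 x"
    using mild_lower_heat[OF U_mild[OF bf] _ f01, of 1] by auto
  define \<kappa> where "\<kappa> = exp (- k) * p"
  have \<kappa>: "\<kappa> > 0" "\<kappa> \<le> U f 1 x" for x
    unfolding \<kappa>_def using p0 order_trans[OF mult_left_mono[OF hsp[of x]] k[of x]] by simp_all
  obtain C where C: "\<And>x. \<bar>U f 1 x\<bar> \<le> C" using U_bounded[OF bf, of 1] by auto
  let ?A = "\<lambda>n::nat. {w \<in> space P. XI (real n + 1) w f \<le> XI (real n) w (U f 1) - real n}"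
  have [measurable]: "(\<lambda>w. XI (real n) w (U f 1)) \<in> borel_measurable P" "(\<lambda>w. XI (real n + 1) w f) \<in> borel_measurable P" for n
    using f01 by (auto intro!: XI_measurable U_measurable[OF bf] U_nonneg[OF bf])
  have "AE w in P. \<forall>\<^sub>F n in sequentially. w \<in> space P - ?A n"
  proof (rule borel_cantelli_AE1)
    show "summable (\<lambda>n. measure P (?A n))"
    proof (rule summable_comparison_test'[where N=0 and g="\<lambda>n. exp (- 1) ^ n"])
      show "summable (\<lambda>n. exp (- 1 :: real) ^ n)" by (rule summable_geometric) simp
      show "norm (measure P (?A n)) \<le> exp (- 1) ^ n" for n
        using laplace_lower_tail[of "real n" 1 f "real n"] bf by (simp add: exp_of_nat_mult[symmetric])
    qed
  qed (auto simp: emeasure_eq_measure)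
  then have "AE w in P. \<forall>\<^sub>F n in sequentially. \<kappa> * measure (X (real n) w) UNIV - real n \<le> measure (X (real n + 1) w) {x. \<bar>x\<bar> \<ge> R + 1}"
  proof eventually_elim
    case (elim w)
    from elim show ?case
    proof eventually_elim
      case (elim n)
      then have w: "w \<in> space P" by auto
      have "\<kappa> * measure (X (real n) w) UNIV = XI (real n) w (\<lambda>x. \<kappa> * indicator UNIV x)"
        unfolding XI_cmult using w by (subst XI_indicator) auto
      also have "\<dots> \<le> XI (real n) w (U f 1)"
        using \<kappa> C by (intro XI_mono[OF _ w, where C=\<kappa> and D=C] U_measurable[OF bf]) (auto simp: less_imp_le)
      also have "\<dots> \<le> XI (real n + 1) w f + real n" using elim by auto
      also have "XI (real n + 1) w f = measure (X (real n + 1) w) {x. \<bar>x\<bar> \<ge> R + 1}"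
        unfolding f_def using w by (intro XI_indicator) auto
      finally show ?case by simp
    qed
  qed
  then show ?thesis using \<kappa>(1) by blast
qed

end

section \<open>Upper bounds on the mass\<close>

context super_bm begin

text \<open>The weight \<open>g\<close> is unbounded, and a Bochner integral that diverges would
  read as 0. So \<open>E\<close> is defined as a limit over truncations: it stands for exp (-
  \<theta> exp (- lam t) \<langle>g, X_t\<rangle>) with value 0 for an infinite integral, and it is
  a bounded submartingale.\<close>

lemma upper_growth:
  assumes g_def: "g = (\<lambda>x. A * h x + cosh (m * x))" and A: "A \<ge> 0" and m: "m \<ge> 0"
    and h: "continuous_on UNIV h" "\<And>x. 0 \<le> h x"
    and gU: "\<And>f \<theta> t x. bounded_nonneg_fun f \<Longrightarrow> \<theta> \<ge> 0 \<Longrightarrow> t \<ge> 0 \<Longrightarrow> (\<And>x. f x \<le> \<theta> * g x) \<Longrightarrow> U f t x \<le> \<theta> * exp (lam * t) * g x"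
    and mu: "finite_measure \<mu>" "sets \<mu> = sets borel" "\<exists>R. emeasure \<mu> (- {-R..R}) = 0"
  shows "AE w in P. \<exists>C. \<forall>t\<ge>0. \<forall>r\<ge>0. measure (X t w) (- {-r<..<r}) \<le> C * exp (lam * t - m * r)"
proof -
  have cg: "continuous_on UNIV g" unfolding g_def by (intro continuous_intros h)
  have [measurable]: "g \<in> borel_measurable borel" by (rule borel_measurable_continuous_onI[OF cg])
  have g1: "g x \<ge> cosh (m * x)" for x using A h(2)[of x] by (simp add: g_def)
  have g0: "g x \<ge> 1" for x using g1[of x] cosh_real_ge_1[of "m * x"] by linarith
  define f where "f N x = min (g x) (real (Suc N))" for N x
  have f0: "0 \<le> f N x" "f N x \<le> real (Suc N)" "f N x \<le> g x" for N x using g0[of x] by (auto simp: f_def)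
  have cf: "continuous_on UNIV (f N)" for N unfolding f_def[abs_def] by (intro continuous_intros cg)
  have fm[measurable]: "f N \<in> borel_measurable borel" for N unfolding f_def[abs_def] by measurable
  have bf: "bounded_nonneg_fun (\<lambda>x. c * f N x)" if "c \<ge> 0" for c N
  proof -
    have "norm (c * f N x) \<le> c * real (Suc N)" for x using that f0[of N x] by (auto simp: abs_mult intro!: mult_left_mono)
    then show ?thesis
      unfolding bounded_nonneg_fun_def using that f0 by (auto intro!: boundedI[where B="c * real (Suc N)"])
  qed
  define e where "e \<theta> t w N = exp (- (\<theta> * exp (- lam * t) * XI t w (f N)))" for \<theta> t w N
  define E where "E \<theta> t w = lim (e \<theta> t w)" for \<theta> t w
  have e01: "0 \<le> e \<theta> t w N" "e \<theta> t w N \<le> 1" if "\<theta> \<ge> 0" for \<theta> t w N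
    using that XI_nonneg[of "f N" t w] f0 by (auto simp: e_def)
  have e_dec: "e \<theta> t w N' \<le> e \<theta> t w N" if "\<theta> \<ge> 0" "t \<ge> 0" "w \<in> space P" "N \<le> N'" for \<theta> t w N N'
  proof -
    have "XI t w (f N) \<le> XI t w (f N')"
      using that f0 by (intro XI_mono[where C="real (Suc N)" and D="real (Suc N')"]) (auto simp: f_def)
    then show ?thesis using that by (auto simp: e_def intro!: mult_left_mono)
  qed
  have e_lim: "e \<theta> t w \<longlonglongrightarrow> E \<theta> t w" and E_le: "E \<theta> t w \<le> e \<theta> t w N"
    if "\<theta> \<ge> 0" "t \<ge> 0" "w \<in> space P" for \<theta> t w N
  proof -
    have d: "decseq (e \<theta> t w)" using e_dec[OF that] by (auto simp: decseq_def)
    have "convergent (e \<theta> t w)"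
      by (rule Bseq_monoseq_convergent[OF BseqI'[where K=1] decseq_imp_monoseq[OF d]]) (use e01 that in auto)
    then show l: "e \<theta> t w \<longlonglongrightarrow> E \<theta> t w" unfolding E_def by (simp add: convergent_LIMSEQ_iff)
    show "E \<theta> t w \<le> e \<theta> t w N" using decseq_ge[OF d l] .
  qed
  have E01: "0 \<le> E \<theta> t w" "E \<theta> t w \<le> 1" if "\<theta> \<ge> 0" "t \<ge> 0" "w \<in> space P" for \<theta> t w
    using LIMSEQ_le_const[OF e_lim[OF that]] e01[OF that(1)] order_trans[OF E_le[OF that] e01(2)[OF that(1)]] by auto
  have em: "(\<lambda>w. e \<theta> r w N) \<in> borel_measurable (\<F> s)" if "0 \<le> r" "r \<le> s" for \<theta> r s N
  proof -
    have [measurable]: "(\<lambda>w. XI r w (f N)) \<in> borel_measurable (\<F> s)" using that f0 by (intro XI_F_measurable fm)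
    show ?thesis unfolding e_def by measurable
  qed
  have EmF: "E \<theta> r \<in> borel_measurable (\<F> s)" if "0 \<le> r" "r \<le> s" for \<theta> r s
  proof -
    have [measurable]: "(\<lambda>w. e \<theta> r w N) \<in> borel_measurable (\<F> s)" for N by (rule em[OF that])
    show ?thesis unfolding E_def[abs_def] by measurable
  qed
  have Em[measurable]: "E \<theta> r \<in> borel_measurable P" if "0 \<le> r" for \<theta> r
    using measurable_from_subalg[OF F_subalgebra EmF[OF that order_refl]] .
  have emP: "(\<lambda>w. e \<theta> r w N) \<in> borel_measurable P" if "0 \<le> r" for \<theta> r N
    using measurable_from_subalg[OF F_subalgebra em[OF that order_refl]] .
  have submart: "(\<integral>w. indicator B w * E \<theta> s w \<partial>P) \<le> (\<integral>w. indicator B w * E \<theta> (s + t) w \<partial>P)"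
    if th: "\<theta> > 0" and st: "s \<ge> 0" "t \<ge> 0" and B: "B \<in> sets (\<F> s)" for \<theta> s t B
  proof -
    have BP[measurable]: "B \<in> sets P" using B F_subalgebra by (auto simp: subalgebra_def)
    have "(\<integral>w. indicator B w * E \<theta> s w \<partial>P) \<le> (\<integral>w. indicator B w * e \<theta> (s + t) w N \<partial>P)" for N
    proof -
      define c where "c = \<theta> * exp (- lam * (s + t))"
      have c: "c > 0" using th by (simp add: c_def)
      let ?f = "\<lambda>x. c * f N x"
      have bg: "bounded_nonneg_fun ?f" using bf c by simp
      obtain D where D: "\<And>x. \<bar>U ?f t x\<bar> \<le> D" using U_bounded[OF bg st(2)] by auto
      define b where "b = \<theta> * exp (- lam * s)"
      have b: "b > 0" using th by (simp add: b_def)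
      \<comment> \<open>The Laplace exponent lies below both the constant \<open>D\<close> and
        \<open>b * g\<close>, hence below b times a truncation at a level beyond D / b. This keeps
        the comparison among truncated integrals.\<close>
      obtain N' :: nat where N': "D / b \<le> real N'" using real_arch_simple by blast
      have "U ?f t x \<le> b * f N' x" for x
      proof -
        have "U ?f t x \<le> c * exp (lam * t) * g x"
          using c st f0(3) by (intro gU[OF bg]) (auto intro!: mult_left_mono)
        also have "c * exp (lam * t) = b" by (simp add: c_def b_def mult.assoc exp_add[symmetric] algebra_simps)
        finally have 1: "U ?f t x \<le> b * g x" .
        have "D \<le> b * real N'" using N' b by (simp add: field_simps)
        also have "\<dots> \<le> b * real (Suc N')" using b by (intro mult_left_mono) auto
        finally have "U ?f t x \<le> b * real (Suc N')" using D[of x] by linarith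
        then show ?thesis using 1 by (simp add: f_def min_def)
      qed
      note UL = this
      have ptw: "E \<theta> s w \<le> exp (- XI s w (U ?f t))" if w: "w \<in> space P" for w
      proof -
        have "XI s w (U ?f t) \<le> XI s w (\<lambda>x. b * f N' x)"
          using D UL b f0[of N'] by (intro XI_mono[OF st(1) w, where C=D and D="b * real (Suc N')"] U_measurable[OF bg])
             (auto simp: abs_mult intro!: mult_left_mono)
        then have "e \<theta> s w N' \<le> exp (- XI s w (U ?f t))" by (simp add: e_def XI_cmult b_def)
        then show ?thesis using E_le[of \<theta> s w N'] th st w by linarith
      qed
      have [measurable]: "(\<lambda>w. XI s w (U ?f t)) \<in> borel_measurable P"
        using st by (intro XI_measurable U_measurable[OF bg] U_nonneg[OF bg])
      have "(\<integral>w. indicator B w * E \<theta> s w \<partial>P) \<le> (\<integral>w. indicator B w * exp (- XI s w (U ?f t)) \<partial>P)"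
      proof (rule integral_mono)
        show "integrable P (\<lambda>w. indicator B w * E \<theta> s w)"
          by (intro integrable_const_bound[where B=1] AE_I2)
             (use E01[of \<theta> s] th st Em[OF st(1), of \<theta>] in \<open>auto simp: indicator_def\<close>)
        show "integrable P (\<lambda>w. indicator B w * exp (- XI s w (U ?f t)))"
          using XI_nonneg[OF U_nonneg[OF bg]] by (intro integrable_const_bound[where B=1] AE_I2) (auto simp: indicator_def)
        show "indicator B w * E \<theta> s w \<le> indicator B w * exp (- XI s w (U ?f t))" if "w \<in> space P" for w
          using ptw[OF that] by (auto simp: indicator_def)
      qed
      also have "\<dots> = (\<integral>w. indicator B w * exp (- XI (s + t) w ?f) \<partial>P)"
        by (rule laplace_test[OF st bg _, symmetric, where C=1]) (use B in \<open>auto simp: indicator_def\<close>)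
      also have "\<dots> = (\<integral>w. indicator B w * e \<theta> (s + t) w N \<partial>P)"
        by (simp add: e_def XI_cmult c_def)
      finally show ?thesis .
    qed
    moreover have "(\<lambda>N. \<integral>w. indicator B w * e \<theta> (s + t) w N \<partial>P) \<longlonglongrightarrow> (\<integral>w. indicator B w * E \<theta> (s + t) w \<partial>P)"
    proof (rule integral_dominated_convergence[where w="\<lambda>_. 1"])
      show "AE w in P. (\<lambda>N. indicator B w * e \<theta> (s + t) w N) \<longlonglongrightarrow> indicator B w * E \<theta> (s + t) w"
        using th st by (intro AE_I2 tendsto_intros e_lim) auto
      show "AE w in P. norm (indicator B w * e \<theta> (s + t) w N) \<le> 1" for N
        using th e01[of \<theta> "s + t" _ N] by (intro AE_I2) (auto simp: indicator_def)
      show "(\<lambda>w. indicator B w * E \<theta> (s + t) w) \<in> borel_measurable P"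
        by (intro borel_measurable_times borel_measurable_indicator BP Em) (use st in simp)
      show "(\<lambda>w. indicator B w * e \<theta> (s + t) w N) \<in> borel_measurable P" for N
        by (intro borel_measurable_times borel_measurable_indicator BP emP) (use st in simp)
    qed simp
    ultimately show ?thesis by (intro LIMSEQ_le_const) auto
  qed
  obtain R where R: "emeasure \<mu> (- {-R..R}) = 0" using mu by blast
  obtain G where G: "G \<ge> 0" "\<And>x. x \<in> {-R..R} \<Longrightarrow> g x \<le> G"
  proof -
    have "bounded (g ` {-R..R})"
      by (intro compact_imp_bounded compact_continuous_image continuous_on_subset[OF cg]) auto
    then obtain C where "\<forall>y\<in>g ` {-R..R}. norm y \<le> C" unfolding bounded_iff by blast
    then have "g x \<le> max 0 C" if "x \<in> {-R..R}" for x using that by force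
    then show ?thesis using that[of "max 0 C"] by auto
  qed
  \<comment> \<open>A bound on the initial integral that is uniform in the truncation, because \<mu>
    sits on a compact set where \<open>g\<close> is bounded.\<close>
  define C0 where "C0 = G * measure \<mu> UNIV"
  have C0: "C0 \<ge> 0" using G by (simp add: C0_def)
  have X0: "(\<integral>x. f N x \<partial>\<mu>) \<le> C0" for N
  proof -
    interpret mu: finite_measure \<mu> by (rule mu)
    have sp: "space \<mu> = UNIV" using sets_eq_imp_space_eq[OF mu(2)] by simp
    have [measurable]: "f N \<in> borel_measurable \<mu>" using fm measurable_cong_sets[OF mu(2) refl] by blast
    have "AE x in \<mu>. x \<notin> - {-R..R}"
      using R mu(2) by (intro AE_not_in) (auto simp: null_sets_def)
    then have ae: "AE x in \<mu>. f N x \<le> G"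
    proof eventually_elim
      case (elim x)
      then show ?case using G(2)[of x] f0(3)[of N x] by force
    qed
    have "(\<integral>x. f N x \<partial>\<mu>) \<le> (\<integral>x. G \<partial>\<mu>)"
      by (rule integral_mono_AE[OF _ _ ae]) (use f0 in \<open>auto intro!: mu.integrable_const_bound[where B="real (Suc N)"]\<close>)
    then show ?thesis by (simp add: C0_def sp mult.commute)
  qed
  have E0: "(\<integral>w. 1 - E \<theta> 0 w \<partial>P) \<le> \<theta> * C0" if th: "\<theta> > 0" for \<theta>
  proof -
    have "AE w in P. X 0 w = \<mu>" using super by (simp add: superBM_def)
    then have "AE w in P. 1 - E \<theta> 0 w \<le> \<theta> * C0"
    proof (rule AE_mp, intro AE_I2 impI)
      fix w assume w: "w \<in> space P" "X 0 w = \<mu>"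
      have "exp (- (\<theta> * C0)) \<le> e \<theta> 0 w N" for N
        using X0[of N] w th by (simp add: e_def XI_def mult_left_mono)
      then have "exp (- (\<theta> * C0)) \<le> E \<theta> 0 w"
        using th w by (intro LIMSEQ_le_const[OF e_lim]) auto
      then show "1 - E \<theta> 0 w \<le> \<theta> * C0" using exp_ge_add_one_self[of "- (\<theta> * C0)"] by linarith
    qed
    moreover have "integrable P (\<lambda>w. 1 - E \<theta> 0 w)"
      by (intro integrable_const_bound[where B=1] AE_I2)
         (use E01[of \<theta> 0] th Em[of 0 \<theta>] in auto)
    ultimately have "(\<integral>w. 1 - E \<theta> 0 w \<partial>P) \<le> (\<integral>w. \<theta> * C0 \<partial>P)"
      by (intro integral_mono_AE) auto
    then show ?thesis by (simp add: prob_space)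
  qed
  \<comment> \<open>The grids of times j / n! up to n are nested and exhaust the nonnegative
    rationals, so finite maximal inequalities pass to all rational times. The level 1 / 2 reappears
    as ln 2.\<close>
  define bad where "bad \<theta> n = {w \<in> space P. \<exists>j\<le>n * fact n. 1 / 2 \<le> 1 - E \<theta> (real j / fact n) w}" for \<theta> and n :: nat
  have bad_prob: "prob (bad \<theta> n) \<le> 2 * \<theta> * C0" if th: "\<theta> > 0" for \<theta> n
  proof -
    \<comment> \<open>The maximal inequality asks for bounds at every w, so S is set to 0 outside
      the sample space.\<close>
    define S where "S j w = (if w \<in> space P then 1 - E \<theta> (real j / fact n) w else 0)" for j w
    have "1 / 2 * prob {w \<in> space P. \<exists>j\<le>n * fact n. 1 / 2 \<le> S j w} \<le> (\<integral>w. S 0 w \<partial>P)"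
    proof (rule supermartingale_maximal[where F="\<lambda>k. \<F> (real k / fact n)"])
      show "S j \<in> borel_measurable (\<F> (real k / fact n))" if "j \<le> k" for j k
      proof -
        have "(\<lambda>w. 1 - E \<theta> (real j / fact n) w) \<in> borel_measurable (\<F> (real k / fact n))"
          using that by (intro borel_measurable_diff borel_measurable_const EmF divide_right_mono) auto
        then show ?thesis by (subst measurable_cong[where g="\<lambda>w. 1 - E \<theta> (real j / fact n) w"]) (auto simp: S_def)
      qed
      show "0 \<le> S k w" "S k w \<le> 1" for k w using E01[of \<theta> "real k / fact n" w] th by (auto simp: S_def)
      fix k B assume B: "B \<in> sets (\<F> (real k / fact n))"
      have BP[measurable]: "B \<in> sets P" using B F_subalgebra by (auto simp: subalgebra_def)
      have eq: "(\<integral>w. indicator B w * S j w \<partial>P) = prob B - (\<integral>w. indicator B w * E \<theta> (real j / fact n) w \<partial>P)" for j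
      proof -
        have i: "integrable P (\<lambda>w. indicator B w * E \<theta> (real j / fact n) w)"
          by (intro integrable_const_bound[where B=1] AE_I2)
             (use E01[of \<theta> "real j / fact n"] th Em[of "real j / fact n" \<theta>] in \<open>auto simp: indicator_def\<close>)
        have "(\<integral>w. indicator B w * S j w \<partial>P) = (\<integral>w. indicator B w - indicator B w * E \<theta> (real j / fact n) w \<partial>P)"
          by (intro Bochner_Integration.integral_cong) (auto simp: S_def algebra_simps)
        also have "\<dots> = (\<integral>w. indicator B w \<partial>P) - (\<integral>w. indicator B w * E \<theta> (real j / fact n) w \<partial>P)"
          by (rule Bochner_Integration.integral_diff[OF _ i]) (auto intro!: integrable_real_indicator simp: emeasure_eq_measure)
        finally show ?thesis by simp
      qed
      have "real (Suc k) / fact n = real k / fact n + 1 / fact n" by (simp add: add_divide_distrib)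
      then show "(\<integral>w. indicator B w * S (Suc k) w \<partial>P) \<le> (\<integral>w. indicator B w * S k w \<partial>P)"
        unfolding eq using submart[OF th _ _ B, of "1 / fact n"] by simp
    qed (rule F_subalgebra)
    also have "(\<integral>w. S 0 w \<partial>P) = (\<integral>w. 1 - E \<theta> 0 w \<partial>P)"
      by (intro Bochner_Integration.integral_cong) (auto simp: S_def)
    also have "\<dots> \<le> \<theta> * C0" by (rule E0[OF th])
    finally have "prob {w \<in> space P. \<exists>j\<le>n * fact n. 1 / 2 \<le> S j w} \<le> 2 * \<theta> * C0" by simp
    moreover have "{w \<in> space P. \<exists>j\<le>n * fact n. 1 / 2 \<le> S j w} = bad \<theta> n"
      by (auto simp: S_def bad_def)
    ultimately show ?thesis by simp
  qed
  have bad_sets[measurable]: "bad \<theta> n \<in> sets P" for \<theta> n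
  proof -
    have eq: "bad \<theta> n = {w \<in> space P. \<exists>j\<in>{..n * fact n}. 1 / 2 \<le> 1 - E \<theta> (real j / fact n) w}"
      by (auto simp: bad_def)
    show ?thesis
      unfolding eq
      by (intro sets.sets_Collect_finite_Ex borel_measurable_le borel_measurable_diff borel_measurable_const Em) auto
  qed
  have bad_mono: "bad \<theta> n \<subseteq> bad \<theta> (Suc n)" for \<theta> n
  proof
    fix w assume "w \<in> bad \<theta> n"
    then obtain j where j: "w \<in> space P" "j \<le> n * fact n" "1 / 2 \<le> 1 - E \<theta> (real j / fact n) w" by (auto simp: bad_def)
    have "real (j * Suc n) / fact (Suc n) = (real (Suc n) * real j) / (real (Suc n) * fact n)"
      unfolding fact_Suc of_nat_mult by (simp only: mult.commute)
    also have "\<dots> = real j / fact n"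
      by (rule mult_divide_mult_cancel_left) simp
    finally have "real (j * Suc n) / fact (Suc n) = real j / fact n" .
    moreover have "j * Suc n \<le> Suc n * fact (Suc n)"
    proof -
      have "j * Suc n \<le> (n * fact n) * Suc n" using j(2) by (rule mult_right_mono) simp
      also have "\<dots> \<le> Suc n * fact (Suc n)" by (simp add: mult_ac)
      finally show ?thesis .
    qed
    ultimately show "w \<in> bad \<theta> (Suc n)"
      unfolding bad_def using j by (auto intro!: exI[of _ "j * Suc n"])
  qed
  have bad_Un: "prob (\<Union>n. bad \<theta> n) \<le> 2 * \<theta> * C0" if th: "\<theta> > 0" for \<theta>
  proof (rule LIMSEQ_le_const2)
    show "(\<lambda>n. prob (bad \<theta> n)) \<longlonglongrightarrow> prob (\<Union>n. bad \<theta> n)"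
      by (rule finite_Lim_measure_incseq) (auto intro!: incseq_SucI bad_mono)
  qed (use bad_prob[OF th] in auto)
  \<comment> \<open>Failure at \<theta> = 1 / (j + 1) has probability at most 2 \<theta> C0, so
    failure for every j has probability 0.\<close>
  let ?Z = "\<Inter>j::nat. \<Union>n. bad (1 / real (Suc j)) n"
  have "prob ?Z \<le> 2 * (1 / real (Suc j)) * C0" for j
    by (rule order_trans[OF finite_measure_mono bad_Un]) auto
  moreover have "(\<lambda>j. 2 * (1 / real (Suc j)) * C0) \<longlonglongrightarrow> 0" by real_asymp
  ultimately have "prob ?Z \<le> 0" by (intro LIMSEQ_le_const) auto
  then have "?Z \<in> null_sets P" by (auto simp: null_sets_def emeasure_eq_measure measure_le_0_iff)
  then have "AE w in P. w \<notin> ?Z" by (rule AE_not_in)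
  then show ?thesis
  proof (rule AE_mp, intro AE_I2 impI)
    fix w assume w: "w \<in> space P" "w \<notin> ?Z"
    then obtain j where j: "\<And>n. w \<notin> bad (1 / real (Suc j)) n" by auto
    define \<theta> where "\<theta> = 1 / real (Suc j)"
    have th: "\<theta> > 0" by (simp add: \<theta>_def)
    have rat: "XI q w (f N) \<le> ln 2 / \<theta> * exp (lam * q)" if q: "q \<in> \<rat>" "q \<ge> 0" for q N
    proof -
      obtain a b :: nat where ab: "b \<noteq> 0" "q = real a / real b"
        using q by (metis Rats_abs_nat_div_natE abs_of_nonneg)
      define n where "n = max a b"
      have "b dvd fact n" using ab by (intro dvd_fact) (auto simp: n_def)
      then obtain k where k: "fact n = b * k" by (elim dvdE)
      then have k0: "k \<noteq> 0" by (metis fact_nonzero mult_0_right)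
      have "real (a * k) / fact n = real (a * k) / real (b * k)" unfolding k[symmetric] by simp
      also have "\<dots> = q" using k0 ab by simp
      finally have q': "real (a * k) / fact n = q" .
      have "a * k \<le> n * fact n"
      proof -
        have "k \<le> fact n" using k ab by simp
        then show ?thesis by (intro mult_mono) (auto simp: n_def)
      qed
      then have "\<not> 1 / 2 \<le> 1 - E \<theta> (real (a * k) / fact n) w"
        using j[of n] w by (auto simp: bad_def \<theta>_def)
      then have "1 / 2 < E \<theta> q w" unfolding q' by simp
      also have "\<dots> \<le> e \<theta> q w N" using th q w by (intro E_le) auto
      finally have "ln (1 / 2) < ln (e \<theta> q w N)" by (subst ln_less_cancel_iff) (auto simp: e_def)
      then have "\<theta> * exp (- lam * q) * XI q w (f N) < ln 2" by (simp add: e_def ln_div)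
      then show ?thesis using th by (simp add: field_simps exp_minus)
    qed
    have real: "XI t w (f N) \<le> ln 2 / \<theta> * exp (lam * t)" if t: "t \<ge> 0" for t N
    proof -
      have "- (ln 2 / \<theta> * exp (lam * t)) \<le> - XI t w (f N)"
      proof (rule le_from_right_rationals[where \<phi>="\<lambda>t. - (ln 2 / \<theta> * exp (lam * t))"])
        show "continuous (at_right t) (\<lambda>a. - XI a w (f N))"
          using f0[of N] by (intro continuous_minus XI_right_continuous[OF w(1) t cf] boundedI[where B="real (Suc N)"]) auto
        show "continuous (at_right t) (\<lambda>t. - (ln 2 / \<theta> * exp (lam * t)))"
          by (intro continuous_intros)
      qed (use rat t in auto)
      then show ?thesis by simp
    qed
    \<comment> \<open>The factor 2 comes from exp (m r) / 2 <= cosh (m r), and ln 2 / \<theta> from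
      the level 1 / 2.\<close>
    show "\<exists>C. \<forall>t\<ge>0. \<forall>r\<ge>0. measure (X t w) (- {-r<..<r}) \<le> C * exp (lam * t - m * r)"
    proof (intro exI[of _ "2 * (ln 2 / \<theta>)"] allI impI)
      fix t r :: real assume t: "0 \<le> t" and r: "0 \<le> r"
      \<comment> \<open>The truncation level depends on r, but the bound on the truncated integral
        does not depend on N.\<close>
      obtain N :: nat where N: "cosh (m * r) \<le> real N" using real_arch_simple by blast
      have "exp (m * r) / 2 * measure (X t w) (- {-r<..<r}) = XI t w (\<lambda>x. exp (m * r) / 2 * indicator (- {-r<..<r}) x)"
        unfolding XI_cmult using t w by (subst XI_indicator) auto
      also have "\<dots> \<le> XI t w (f N)"
      proof (rule XI_mono[OF t w(1), where C="exp (m * r) / 2" and D="real (Suc N)"])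
        fix x
        show "exp (m * r) / 2 * indicator (- {-r<..<r}) x \<le> f N x"
        proof (cases "x \<in> - {-r<..<r}")
          case True
          then have "m * r \<le> m * \<bar>x\<bar>" using m by (intro mult_left_mono) auto
          then have "cosh (m * r) \<le> cosh (m * \<bar>x\<bar>)" using m r by (intro cosh_real_nonneg_le_iff[THEN iffD2]) auto
          also have "\<dots> = cosh (m * x)" by (cases "x \<ge> 0") auto
          finally have "cosh (m * r) \<le> f N x" using g1[of x] N by (simp add: f_def)
          moreover have "exp (m * r) / 2 \<le> cosh (m * r)" by (simp add: cosh_def)
          ultimately show ?thesis using True by simp
        qed (use f0 in simp)
      qed (use f0[of N] in \<open>auto simp: indicator_def\<close>)
      also have "\<dots> \<le> ln 2 / \<theta> * exp (lam * t)" by (rule real[OF t])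
      finally have le: "exp (m * r) / 2 * measure (X t w) (- {-r<..<r}) \<le> ln 2 / \<theta> * exp (lam * t)" .
      have "measure (X t w) (- {-r<..<r}) = 2 * exp (- (m * r)) * (exp (m * r) / 2 * measure (X t w) (- {-r<..<r}))"
        by (simp add: exp_minus)
      also have "\<dots> \<le> 2 * exp (- (m * r)) * (ln 2 / \<theta> * exp (lam * t))"
        using le by (rule mult_left_mono) simp
      also have "\<dots> = 2 * (ln 2 / \<theta>) * exp (lam * t - m * r)"
        by (simp add: exp_diff exp_minus divide_inverse)
      finally show "measure (X t w) (- {-r<..<r}) \<le> 2 * (ln 2 / \<theta>) * exp (lam * t - m * r)" .
    qed
  qed
qed

text \<open>For lam above the eigenvalue, \<open>h\<close> leaves the strictly positive surplus (lam
  - lambda1) h in the supersolution inequality; a large multiple of it covers the compactly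
  supported term \<beta> cosh.\<close>

lemma ground_state_growth:
  assumes h: "ground_state \<beta> h" and lam: "lam > lambda1 \<beta>" "lambda1 \<beta> > 0"
    and mu: "finite_measure \<mu>" "sets \<mu> = sets borel" "\<exists>R. emeasure \<mu> (- {-R..R}) = 0"
  shows "AE w in P. \<exists>C. \<forall>t\<ge>0. \<forall>r\<ge>0. measure (X t w) (- {-r<..<r}) \<le> C * exp (lam * t - sqrt (2 * lam) * r)"
proof -
  have hp: "\<And>x. h x > 0" and hb: "bounded (range h)" and hc: "continuous_on UNIV h"
    and hd: "\<And>x. h differentiable (at x)" "\<And>x. deriv h differentiable (at x)"
    and heq: "\<And>x. deriv (deriv h) x / 2 + \<beta> x * h x = lambda1 \<beta> * h x"
    using h by (auto simp: ground_state_def)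
  obtain H where "\<forall>y\<in>range h. norm y \<le> H" using hb unfolding bounded_iff by blast
  then have H: "h x \<le> H" for x using hp by (auto dest: abs_le_D1)
  have H0: "H > 0" using H[of 0] hp[of 0] by linarith
  have \<beta>c: "continuous_on UNIV \<beta>" "compact_supp \<beta>" using params unfolding branching_params_def by blast+
  define h1 where "h1 = deriv h"
  \<comment> \<open>The second derivative is read off the eigenvalue equation, which makes its
    continuity and boundedness evident.\<close>
  define h2 where "h2 x = 2 * (lambda1 \<beta> - \<beta> x) * h x" for x
  have d1: "(h has_real_derivative h1 x) (at x)" for x
    unfolding h1_def using hd(1) by (simp add: DERIV_deriv_iff_real_differentiable)
  have d2: "(h1 has_real_derivative h2 x) (at x)" for x
  proof -
    have "h2 x = deriv (deriv h) x" using heq[of x] by (simp add: h2_def field_simps)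
    then show ?thesis unfolding h1_def using hd(2) by (simp add: DERIV_deriv_iff_real_differentiable)
  qed
  have c2: "continuous_on UNIV h2" unfolding h2_def[abs_def] by (intro continuous_intros hc \<beta>c)
  have b2: "\<bar>h2 x\<bar> \<le> 2 * (lambda1 \<beta> + K) * H" for x
    unfolding h2_def abs_mult using beta_bound[of x] lam hp[of x] H[of x] by (intro mult_mono) auto
  \<comment> \<open>A bounded function with bounded second derivative has a bounded derivative: the
    mean value theorem on [x, x + 1] finds a nearby point where the derivative is at most 2
    H.\<close>
  have b1: "\<bar>h1 x\<bar> \<le> 2 * H + 2 * (lambda1 \<beta> + K) * H" for x
  proof -
    obtain z where z: "z > x" "z < x + 1" "h (x + 1) - h x = (x + 1 - x) * h1 z"
      using MVT2[of x "x + 1" h h1] d1 by auto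
    then have "\<bar>h1 z\<bar> \<le> 2 * H" using H[of x] H[of "x + 1"] hp[of x] hp[of "x + 1"] by auto
    moreover obtain y where y: "h1 z - h1 x = (z - x) * h2 y"
      using MVT2[OF z(1), of h1 h2] d2 by auto
    have "\<bar>h1 z - h1 x\<bar> \<le> 1 * (2 * (lambda1 \<beta> + K) * H)"
      unfolding y abs_mult using z b2[of y] by (intro mult_mono) auto
    ultimately show ?thesis by linarith
  qed
  have dyn: "gheat t h x = h x + duhamel 0 (\<lambda>_ y. h2 y / 2) t x" if "t \<ge> 0" for t x
  proof (rule gheat_dynkin[OF d1 d2 _ _ b1 b2 that])
    show "isCont h2 z" for z using c2 by (simp add: continuous_on_eq_continuous_at)
    show "\<bar>h z\<bar> \<le> H" for z using hp[of z] H[of z] by simp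
  qed
  define m where "m = sqrt (2 * lam)"
  \<comment> \<open>The ratio of the term to be covered to the surplus; a bound on it is the
    constant \<open>A\<close>.\<close>
  define \<rho> where "\<rho> x = \<beta> x * cosh (m * x) / ((lam - lambda1 \<beta>) * h x)" for x
  have "continuous_on UNIV \<rho>"
    unfolding \<rho>_def[abs_def] using hp lam by (intro continuous_intros hc \<beta>c) (auto simp: less_imp_neq[symmetric])
  moreover have "compact_supp \<rho>" using \<beta>c(2) by (auto simp: compact_supp_def \<rho>_def)
  ultimately obtain A where A: "A \<ge> 0" "\<And>x. \<bar>\<rho> x\<bar> \<le> A" using compact_supp_bounded by blast
  have super: "\<beta> x * cosh (m * x) \<le> A * (lam * h x - h2 x / 2 - \<beta> x * h x)" for x
  proof -
    have pos: "(lam - lambda1 \<beta>) * h x > 0" using lam hp by simp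
    have "\<beta> x * cosh (m * x) = \<rho> x * ((lam - lambda1 \<beta>) * h x)" using lam hp[of x] by (simp add: \<rho>_def)
    also have "\<dots> \<le> A * ((lam - lambda1 \<beta>) * h x)"
      using A(2)[of x] pos by (intro mult_right_mono) auto
    also have "(lam - lambda1 \<beta>) * h x = lam * h x - h2 x / 2 - \<beta> x * h x" by (simp add: h2_def field_simps)
    finally show ?thesis .
  qed
  have hm: "h \<in> borel_measurable borel" "h2 \<in> borel_measurable borel"
    using hc c2 by (auto intro: borel_measurable_continuous_onI)
  have "AE w in P. \<exists>C. \<forall>t\<ge>0. \<forall>r\<ge>0. measure (X t w) (- {-r<..<r}) \<le> C * exp (lam * t - m * r)"
  proof (rule upper_growth[OF refl A(1) _ hc _ _ mu])
    show "m \<ge> 0" using lam by (simp add: m_def)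
    show "0 \<le> h x" for x using hp[of x] by simp
    fix f \<theta> and t x :: real
    assume f: "bounded_nonneg_fun f" and th: "\<theta> \<ge> 0" and t: "t \<ge> 0" and fg: "\<And>x. f x \<le> \<theta> * (A * h x + cosh (m * x))"
    obtain F where "\<forall>y\<in>range f. norm y \<le> F" using f unfolding bounded_nonneg_fun_def bounded_iff by blast
    then have F: "f x \<le> F" for x by (auto dest: abs_le_D1)
    show "U f t x \<le> \<theta> * exp (lam * t) * (A * h x + cosh (m * x))"
      unfolding m_def
    proof (rule mild_upper_supersolution[OF U_mild[OF f] bounded_nonneg_measurable[OF f] _ F psi_lower[OF params] beta_bound hm(1) _ H hm(2) b2 dyn A(1) _ super[unfolded m_def] th fg[unfolded m_def] t])
      show "0 \<le> f x" for x using f by (simp add: bounded_nonneg_fun_def)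
      show "0 \<le> h x" for x using hp[of x] by simp
    qed (use lam in auto)
  qed
  then show ?thesis by (simp add: m_def)
qed

end

section \<open>Growth rate\<close>

text \<open>After division by t only lam (1 - a) from the growth phase and a s^2 / 2 from the
  Gaussian cost survive; square roots, constants and rounding offsets vanish in the limit.\<close>

lemma lower_rate_tendsto:
  fixes a s c lam :: real
  assumes a: "a \<ge> 0" and c: "c > 0" and lam: "lam = s\<^sup>2 / 2"
  shows "((\<lambda>t. ln (2 / sqrt (2 * pi * (a * t + 2)) * exp (- (a * s * t + 3)\<^sup>2 / (2 * (a * t + 1))) * (c * exp (lam * ((1 - a) * t - 2)))) / t)
     \<longlongrightarrow> lam - s * (a * s)) at_top"
proof -
  have 1: "((\<lambda>t. ln (a * t + 2) / t) \<longlongrightarrow> 0) at_top"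
  proof (cases "a = 0")
    case True then show ?thesis by (simp, real_asymp)
  next
    case False then have "a > 0" using a by simp
    then show ?thesis by real_asymp
  qed
  have 2: "((\<lambda>t. (a * s * t + 3)\<^sup>2 / (2 * (a * t + 1)) / t) \<longlongrightarrow> a * s\<^sup>2 / 2) at_top"
  proof (cases "a = 0")
    \<comment> \<open>For a = 0 the offset 1 keeps the denominator positive, and the quotient is a
      constant over t.\<close>
    case True then show ?thesis by (simp, real_asymp)
  next
    case False then have a: "a > 0" using a by simp
    have "((\<lambda>t. (a * s + 3 / t)\<^sup>2 / (2 * (a + 1 / t))) \<longlongrightarrow> (a * s + 0)\<^sup>2 / (2 * (a + 0))) at_top"
      using a by (intro tendsto_intros tendsto_divide_0[OF tendsto_const] filterlim_at_top_imp_at_infinity filterlim_ident) auto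
    also have "(a * s + 0)\<^sup>2 / (2 * (a + 0)) = a * s\<^sup>2 / 2" using a by (simp add: power2_eq_square field_simps)
    finally show ?thesis
    proof (rule Lim_transform_eventually)
      show "\<forall>\<^sub>F t in at_top. (a * s + 3 / t)\<^sup>2 / (2 * (a + 1 / t)) = (a * s * t + 3)\<^sup>2 / (2 * (a * t + 1)) / t"
        using eventually_gt_at_top[of 0]
      proof eventually_elim
        case (elim t)
        have "a * s + 3 / t = (a * s * t + 3) / t" "a + 1 / t = (a * t + 1) / t" using elim by (auto simp: field_simps)
        moreover have "(p / t)\<^sup>2 / (2 * (q / t)) = p\<^sup>2 / (2 * q) / t" for p q :: real
          using elim by (cases "q = 0") (simp_all add: power2_eq_square field_simps)
        ultimately show ?case by (simp only:)
      qed
    qed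
  qed
  have "((\<lambda>t. ((ln 2 + ln c - ln (2 * pi) / 2 - 2 * lam) / t - ln (a * t + 2) / t / 2 - (a * s * t + 3)\<^sup>2 / (2 * (a * t + 1)) / t) + lam * (1 - a))
    \<longlongrightarrow> (0 - 0 / 2 - a * s\<^sup>2 / 2) + lam * (1 - a)) at_top"
    by (intro tendsto_intros 1 2 tendsto_divide_0[OF tendsto_const] filterlim_at_top_imp_at_infinity filterlim_ident) auto
  also have "(0 - 0 / 2 - a * s\<^sup>2 / 2) + lam * (1 - a) = lam - s * (a * s)"
    unfolding lam by (simp add: power2_eq_square field_simps)
  finally show ?thesis
  proof (rule Lim_transform_eventually)
    show "\<forall>\<^sub>F t in at_top. ((ln 2 + ln c - ln (2 * pi) / 2 - 2 * lam) / t - ln (a * t + 2) / t / 2 - (a * s * t + 3)\<^sup>2 / (2 * (a * t + 1)) / t) + lam * (1 - a)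
      = ln (2 / sqrt (2 * pi * (a * t + 2)) * exp (- (a * s * t + 3)\<^sup>2 / (2 * (a * t + 1))) * (c * exp (lam * ((1 - a) * t - 2)))) / t"
      using eventually_gt_at_top[of 0]
    proof eventually_elim
      case (elim t)
      have p: "a * t + 2 > 0" using a elim by (simp add: add_nonneg_pos)
      define q where "q = (a * s * t + 3)\<^sup>2 / (2 * (a * t + 1))"
      have q: "- (a * s * t + 3)\<^sup>2 / (2 * (a * t + 1)) = - q" by (simp add: q_def)
      have r: "sqrt (2 * pi * (a * t + 2)) > 0" using p by simp
      have "ln (2 / sqrt (2 * pi * (a * t + 2)) * exp (- q) * (c * exp (lam * ((1 - a) * t - 2))))
        = ln (2 / sqrt (2 * pi * (a * t + 2))) - q + (ln c + lam * ((1 - a) * t - 2))"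
        using r c by (subst ln_mult_pos | simp)+
      also have "ln (2 / sqrt (2 * pi * (a * t + 2))) = ln 2 - ln (sqrt (2 * pi * (a * t + 2)))"
        using r by (intro ln_divide_pos) auto
      also have "ln (sqrt (2 * pi * (a * t + 2))) = ln (2 * pi * (a * t + 2)) / 2"
        using p by (intro ln_sqrt) auto
      also have "ln (2 * pi * (a * t + 2)) = ln (2 * pi) + ln (a * t + 2)"
        using p by (intro ln_mult_pos) auto
      finally have eq: "ln (2 / sqrt (2 * pi * (a * t + 2)) * exp (- q) * (c * exp (lam * ((1 - a) * t - 2))))
        = ln 2 - (ln (2 * pi) + ln (a * t + 2)) / 2 - q + (ln c + lam * ((1 - a) * t - 2))" .
      show ?case
        unfolding q eq q_def[symmetric] using elim by (simp add: add_divide_distrib diff_divide_distrib algebra_simps)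
    qed
  qed
qed

text \<open>Each upper rate has its own constant, which disappears after taking logarithms and
  dividing by t; continuity of the rate in lam then closes the gap. Positivity of \<open>low\<close>
  lets logarithms be compared.\<close>

lemma rate_limit:
  fixes M :: "real \<Rightarrow> real"
  assumes lam: "lam > 0" and dl: "\<delta> \<ge> 0"
    and upper: "\<And>j::nat. \<exists>C. \<forall>t\<ge>0. M t \<le> C * exp ((lam + 1 / real (Suc j)) * t - sqrt (2 * (lam + 1 / real (Suc j))) * (\<delta> * t))"
    and lower: "\<forall>\<^sub>F t in at_top. 0 < low t \<and> low t \<le> M t"
    and rate: "((\<lambda>t. ln (low t) / t) \<longlongrightarrow> lam - sqrt (2 * lam) * \<delta>) at_top"
  shows "((\<lambda>t. ln (M t) / t) \<longlongrightarrow> lam - sqrt (2 * lam) * \<delta>) at_top"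
proof (rule order_tendstoI)
  fix x assume "x < lam - sqrt (2 * lam) * \<delta>"
  with rate have "\<forall>\<^sub>F t in at_top. x < ln (low t) / t" by (rule order_tendstoD)
  with lower eventually_gt_at_top[of 0] show "\<forall>\<^sub>F t in at_top. x < ln (M t) / t"
  proof eventually_elim
    case (elim t)
    then have "ln (low t) / t \<le> ln (M t) / t" by (intro divide_right_mono) auto
    then show ?case using elim by linarith
  qed
next
  fix x assume x: "lam - sqrt (2 * lam) * \<delta> < x"
  have "(\<lambda>j. (lam + 1 / real (Suc j)) - sqrt (2 * (lam + 1 / real (Suc j))) * \<delta>) \<longlonglongrightarrow> (lam + 0) - sqrt (2 * (lam + 0)) * \<delta>"
    by (intro tendsto_intros LIMSEQ_Suc[OF lim_1_over_n])
  then have "\<forall>\<^sub>F j in sequentially. (lam + 1 / real (Suc j)) - sqrt (2 * (lam + 1 / real (Suc j))) * \<delta> < x"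
    using x by (intro order_tendstoD(2)) auto
  then obtain j where j: "(lam + 1 / real (Suc j)) - sqrt (2 * (lam + 1 / real (Suc j))) * \<delta> < x"
    by (auto simp: eventually_sequentially)
  define b where "b = (lam + 1 / real (Suc j)) - sqrt (2 * (lam + 1 / real (Suc j))) * \<delta>"
  obtain C where C: "\<And>t. t \<ge> 0 \<Longrightarrow> M t \<le> C * exp (b * t)"
    using upper[of j] unfolding b_def by (auto simp: algebra_simps)
  have "((\<lambda>t. ln (max 1 C) / t + b) \<longlongrightarrow> 0 + b) at_top"
    by (intro tendsto_intros tendsto_divide_0[OF tendsto_const] filterlim_at_top_imp_at_infinity filterlim_ident)
  then have "\<forall>\<^sub>F t in at_top. ln (max 1 C) / t + b < x"
    using j by (intro order_tendstoD(2)) (auto simp: b_def)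
  with lower eventually_gt_at_top[of 0] show "\<forall>\<^sub>F t in at_top. ln (M t) / t < x"
  proof eventually_elim
    case (elim t)
    have "M t \<le> max 1 C * exp (b * t)"
    proof -
      have "M t \<le> C * exp (b * t)" using C[of t] elim by simp
      also have "\<dots> \<le> max 1 C * exp (b * t)" by (intro mult_right_mono) auto
      finally show ?thesis .
    qed
    then have "ln (M t) \<le> ln (max 1 C * exp (b * t))" using elim by (subst ln_le_cancel_iff) auto
    also have "\<dots> = ln (max 1 C) + b * t" by (subst ln_mult_pos) auto
    finally have "ln (M t) / t \<le> (ln (max 1 C) + b * t) / t" using elim by (intro divide_right_mono) auto
    also have "\<dots> = ln (max 1 C) / t + b" using elim by (simp add: field_simps)
    finally show ?case using elim by linarith
  qed
qed

section \<open>Pathwise lower bound from mass growth and outflow\<close>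

context super_bm begin

lemma lower_bound_eventually:
  assumes R: "R \<ge> 0" and lam: "lam > 0"
    and flow: "\<forall>n y :: nat. \<forall>t. t > real n \<longrightarrow>
     2 / sqrt (2 * pi * (t - n)) * exp (- (real y + 2)\<^sup>2 / (2 * (t - n))) * measure (X n w) {x. \<bar>x\<bar> \<ge> R + 1}
      \<le> measure (X t w) {x. \<bar>x\<bar> \<ge> y}"
    and w: "w \<in> space P"
    and c: "c > 0" and mass: "\<forall>\<^sub>F n in sequentially. c * exp (lam * real n) \<le> measure (X (real n) w) {x. \<bar>x\<bar> \<ge> R + 1}"
    and a: "0 \<le> a" "a < 1" and dl: "\<delta> \<ge> 0"
  shows "\<forall>\<^sub>F t in at_top. 2 / sqrt (2 * pi * (a * t + 2)) * exp (- (\<delta> * t + 3)\<^sup>2 / (2 * (a * t + 1))) * (c * exp (lam * ((1 - a) * t - 2)))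
     \<le> measure (X t w) (- {-(\<delta>*t)<..<\<delta>*t})"
proof -
  obtain N0 where N0: "\<And>n. n \<ge> N0 \<Longrightarrow> c * exp (lam * real n) \<le> measure (X (real n) w) {x. \<bar>x\<bar> \<ge> R + 1}"
    using mass by (auto simp: eventually_sequentially)
  have "\<forall>\<^sub>F t in at_top. (real N0 + 3) / (1 - a) \<le> t" by (rule eventually_ge_at_top)
  with eventually_gt_at_top[of 0] show ?thesis
  proof eventually_elim
    case (elim t)
    \<comment> \<open>The outflow starts at integer times. The extra -1 puts the remaining time t -
      n between a t + 1 and a t + 2, so it stays away from 0 even for a = 0.\<close>
    define n where "n = nat \<lfloor>(1 - a) * t\<rfloor> - 1"
    have big: "real N0 + 3 \<le> (1 - a) * t" using elim a by (simp add: pos_divide_le_eq mult.commute)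
    have "real n = real_of_int \<lfloor>(1 - a) * t\<rfloor> - 1" unfolding n_def using big by (simp add: of_nat_diff le_nat_iff le_floor_iff)
    then have n: "(1 - a) * t - 2 \<le> real n" "real n \<le> (1 - a) * t - 1" by linarith+
    have "N0 \<le> n" using n big by linarith
    note mass_n = N0[OF this]
    have r: "a * t + 1 \<le> t - n" "t - n \<le> a * t + 2" using n by (auto simp: algebra_simps)
    have at: "0 \<le> a * t" using a elim by simp
    have dt: "0 \<le> \<delta> * t" using dl elim by simp
    \<comment> \<open>Rounding up costs at most 1; with the 2 of the outflow bound this gives the
      shift 3 in the exponent.\<close>
    define y where "y = nat \<lceil>\<delta> * t\<rceil>"
    have y: "\<delta> * t \<le> real y" "real y \<le> \<delta> * t + 1" unfolding y_def using dt by linarith+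
    have t0: "t \<ge> 0" using elim by simp
    have "2 / sqrt (2 * pi * (a * t + 2)) * exp (- (\<delta> * t + 3)\<^sup>2 / (2 * (a * t + 1))) * (c * exp (lam * ((1 - a) * t - 2)))
      \<le> 2 / sqrt (2 * pi * (t - n)) * exp (- (real y + 2)\<^sup>2 / (2 * (t - n))) * measure (X n w) {x. \<bar>x\<bar> \<ge> R + 1}"
    proof (intro mult_mono)
      show "2 / sqrt (2 * pi * (a * t + 2)) \<le> 2 / sqrt (2 * pi * (t - n))"
        using r at by (intro divide_left_mono) auto
      have "(real y + 2)\<^sup>2 / (2 * (t - n)) \<le> (\<delta> * t + 3)\<^sup>2 / (2 * (a * t + 1))"
        using r at y dt by (intro frac_le power_mono) auto
      then show "exp (- (\<delta> * t + 3)\<^sup>2 / (2 * (a * t + 1))) \<le> exp (- (real y + 2)\<^sup>2 / (2 * (t - n)))" by simp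
      have "c * exp (lam * ((1 - a) * t - 2)) \<le> c * exp (lam * n)"
        using c lam n by (intro mult_left_mono) (auto intro: mult_left_mono)
      then show "c * exp (lam * ((1 - a) * t - 2)) \<le> measure (X n w) {x. \<bar>x\<bar> \<ge> R + 1}" using mass_n by linarith
    qed (use c r at in auto)
    also have "\<dots> \<le> measure (X t w) {x. \<bar>x\<bar> \<ge> y}" using flow r at by auto
    also have "\<dots> \<le> measure (X t w) (- {-(\<delta>*t)<..<\<delta>*t})"
    proof (rule finite_measure.finite_measure_mono[OF X_finite[OF t0 w]])
      show "{x. \<bar>x\<bar> \<ge> real y} \<subseteq> - {-(\<delta>*t)<..<\<delta>*t}" using y by auto
      show "- {-(\<delta>*t)<..<\<delta>*t} \<in> sets (X t w)" using X_sets[OF t0 w] by simp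
    qed
    finally show ?case .
  qed
qed

lemma mass_growth:
  assumes h: "ground_state \<beta> h" and lam: "lam > 0" and \<kappa>: "\<kappa> > 0" and w: "w \<in> space P"
    and spread: "\<forall>\<^sub>F n in sequentially. \<kappa> * measure (X (real n) w) UNIV - real n \<le> measure (X (real n + 1) w) {x. \<bar>x\<bar> \<ge> R + 1}"
    and L: "L > 0" "((\<lambda>t. exp (- lam * t) * (\<integral>x. h x \<partial>X t w)) \<longlongrightarrow> L) at_top"
  shows "\<exists>c>0. \<forall>\<^sub>F n in sequentially. c * exp (lam * real n) \<le> measure (X (real n) w) {x. \<bar>x\<bar> \<ge> R + 1}"
proof -
  have hp: "\<And>x. h x > 0" and hb: "bounded (range h)" and hc: "continuous_on UNIV h"
    using h by (auto simp: ground_state_def)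
  have hm: "h \<in> borel_measurable borel" using hc by (rule borel_measurable_continuous_onI)
  obtain H where "\<forall>y\<in>range h. norm y \<le> H" using hb unfolding bounded_iff by blast
  then have H: "h x \<le> H" for x using hp by (auto dest: abs_le_D1)
  have H0: "H > 0" using H[of 0] hp[of 0] by linarith
  have "\<forall>\<^sub>F t in at_top. L / 2 < exp (- lam * t) * XI t w h"
    using L by (intro order_tendstoD(1)[OF L(2)[folded XI_def]]) auto
  then have "\<forall>\<^sub>F n in sequentially. L / 2 < exp (- lam * real n) * XI (real n) w h"
    by (rule eventually_compose_filterlim[OF _ filterlim_real_sequentially])
  then have tot: "\<forall>\<^sub>F n in sequentially. L / (2 * H) * exp (lam * real n) \<le> measure (X (real n) w) UNIV"
  proof eventually_elim
    case (elim n)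
    have "XI (real n) w h \<le> XI (real n) w (\<lambda>x. H * indicator UNIV x)"
      using H hp H0 by (intro XI_mono[where C=H and D=H] hm w) (auto simp: less_imp_le abs_of_pos)
    also have "\<dots> = H * measure (X (real n) w) UNIV" unfolding XI_cmult using w by (subst XI_indicator) auto
    finally have "exp (- lam * real n) * XI (real n) w h \<le> exp (- lam * real n) * (H * measure (X (real n) w) UNIV)"
      by (rule mult_left_mono) simp
    then have "L / 2 \<le> exp (- lam * real n) * (H * measure (X (real n) w) UNIV)" using elim by linarith
    then show ?case using H0 by (simp add: exp_minus field_simps)
  qed
  \<comment> \<open>Half of \<kappa> L / (2 H), the proportion that spreads out; the other half
    absorbs the error n.\<close>
  define c1 where "c1 = \<kappa> * L / (4 * H)"
  have c1: "c1 > 0" using \<kappa> L H0 by (simp add: c1_def)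
  have "\<forall>\<^sub>F n in sequentially. real n \<le> c1 * exp (lam * real n)"
    using c1 lam by real_asymp
  with tot spread have "\<forall>\<^sub>F n in sequentially. c1 * exp (lam * real n) \<le> measure (X (real n + 1) w) {x. \<bar>x\<bar> \<ge> R + 1}"
  proof eventually_elim
    case (elim n)
    have "\<kappa> * (L / (2 * H) * exp (lam * real n)) \<le> \<kappa> * measure (X (real n) w) UNIV"
      using elim \<kappa> by (intro mult_left_mono) auto
    moreover have "\<kappa> * (L / (2 * H) * exp (lam * real n)) = 2 * (c1 * exp (lam * real n))" by (simp add: c1_def)
    ultimately show ?case using elim by linarith
  qed
  \<comment> \<open>Spreading takes one unit of time, and the shift from n to n + 1 is paid by the
    factor exp (- lam).\<close>
  then have "\<forall>\<^sub>F n in sequentially. (c1 * exp (- lam)) * exp (lam * real (Suc n)) \<le> measure (X (real (Suc n)) w) {x. \<bar>x\<bar> \<ge> R + 1}"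
    by eventually_elim (simp add: mult.assoc exp_add[symmetric] algebra_simps)
  then have "\<forall>\<^sub>F n in sequentially. (c1 * exp (- lam)) * exp (lam * real n) \<le> measure (X (real n) w) {x. \<bar>x\<bar> \<ge> R + 1}"
    by (rule eventually_sequentially_Suc[THEN iffD1])
  then show ?thesis using c1 by (intro exI[of _ "c1 * exp (- lam)"]) auto
qed

end

theorem theorem1p1:
  fixes \<beta> \<alpha> h :: "real \<Rightarrow> real" and \<pi> :: "real \<Rightarrow> real measure"
    and P :: "'w measure" and X :: "real \<Rightarrow> 'w \<Rightarrow> real measure" and \<mu> :: "real measure"
  assumes params: "branching_params \<beta> \<alpha> \<pi>"
    and lam_pos: "lambda1 \<beta> > 0"
    and h: "ground_state \<beta> h"
    and mu_fin: "finite_measure \<mu>" and mu_sets: "sets \<mu> = sets borel"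
    and mu_cpt: "\<exists>R. emeasure \<mu> (- {-R..R}) = 0"
    and X: "superBM P X \<beta> \<alpha> \<pi> \<mu>"
  shows "(\<forall>\<delta>. \<delta> > sqrt (lambda1 \<beta> / 2) \<longrightarrow>
            (AE \<omega> in P. ((\<lambda>t. measure (X t \<omega>) (- {-(\<delta>*t)<..<\<delta>*t})) \<longlongrightarrow> 0) at_top))
       \<and> (\<forall>\<delta>. 0 \<le> \<delta> \<and> \<delta> < sqrt (lambda1 \<beta> / 2) \<longrightarrow>
            (AE \<omega> in P.
               (\<exists>L > 0. ((\<lambda>t. exp (- lambda1 \<beta> * t) * (\<integral>x. h x \<partial>(X t \<omega>))) \<longlongrightarrow> L) at_top)
               \<longrightarrow> ((\<lambda>t. ln (measure (X t \<omega>) (- {-(\<delta>*t)<..<\<delta>*t})) / t)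
                     \<longlongrightarrow> lambda1 \<beta> - sqrt (2 * lambda1 \<beta>) * \<delta>) at_top))"
proof -
  obtain K where K: "\<And>x. \<bar>\<beta> x\<bar> \<le> K"
    using compact_supp_bounded[of \<beta>] params unfolding branching_params_def by blast
  have "prob_space P" using X unfolding superBM_def by blast
  then interpret super_bm P X \<beta> \<alpha> \<pi> \<mu> K
    by (intro super_bm.intro super_bm_axioms.intro params X K)
  define lam where "lam = lambda1 \<beta>"
  have lam: "lam > 0" using lam_pos by (simp add: lam_def)
  define s where "s = sqrt (2 * lam)"
  have s: "s > 0" "s\<^sup>2 = 2 * lam" "sqrt (lam / 2) = s / 2"
    using lam by (auto simp: s_def real_sqrt_divide real_sqrt_mult field_simps)
  \<comment> \<open>The countable intersection over j and the uniformity in r come before \<delta>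
    enters, so one null set serves all \<delta>.\<close>
  have "AE w in P. \<forall>j::nat. \<exists>C. \<forall>t\<ge>0. \<forall>r\<ge>0. measure (X t w) (- {-r<..<r})
      \<le> C * exp ((lam + 1 / real (Suc j)) * t - sqrt (2 * (lam + 1 / real (Suc j))) * r)"
    unfolding AE_all_countable using lam
    by (intro allI ground_state_growth[OF h] mu_fin mu_sets mu_cpt) (auto simp: lam_def)
  then have up: "AE w in P. \<forall>\<delta>\<ge>0. \<forall>j::nat. \<exists>C. \<forall>t\<ge>0. measure (X t w) (- {-(\<delta>*t)<..<\<delta>*t})
      \<le> C * exp ((lam + 1 / real (Suc j)) * t - sqrt (2 * (lam + 1 / real (Suc j))) * (\<delta> * t))"
    by eventually_elim (meson mult_nonneg_nonneg)
  have part1: "AE w in P. ((\<lambda>t. measure (X t w) (- {-(\<delta>*t)<..<\<delta>*t})) \<longlongrightarrow> 0) at_top" if dl: "\<delta> > sqrt (lam / 2)" for \<delta>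
    using up
  proof eventually_elim
    case (elim w)
    have d0: "\<delta> > 0" using dl s by linarith
    have "(\<lambda>j. (lam + 1 / real (Suc j)) - sqrt (2 * (lam + 1 / real (Suc j))) * \<delta>) \<longlonglongrightarrow> (lam + 0) - sqrt (2 * (lam + 0)) * \<delta>"
      by (intro tendsto_intros LIMSEQ_Suc[OF lim_1_over_n])
    \<comment> \<open>The threshold sqrt (lam / 2) is the zero of lam - sqrt (2 lam) \<delta>;
      strict negativity leaves room for a rate slightly above lam.\<close>
    moreover have "(lam + 0) - sqrt (2 * (lam + 0)) * \<delta> < 0"
    proof -
      have "s * (s / 2) < s * \<delta>" using dl s by (intro mult_strict_left_mono) auto
      moreover have "s * (s / 2) = lam" using s(2) by (simp add: power2_eq_square)
      ultimately show ?thesis by (simp add: s_def)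
    qed
    ultimately have "\<forall>\<^sub>F j in sequentially. (lam + 1 / real (Suc j)) - sqrt (2 * (lam + 1 / real (Suc j))) * \<delta> < 0"
      by (rule order_tendstoD(2))
    then obtain j where j: "(lam + 1 / real (Suc j)) - sqrt (2 * (lam + 1 / real (Suc j))) * \<delta> < 0"
      by (auto simp: eventually_sequentially)
    define b where "b = - ((lam + 1 / real (Suc j)) - sqrt (2 * (lam + 1 / real (Suc j))) * \<delta>)"
    have b: "b > 0" using j by (simp add: b_def)
    obtain C where C: "\<And>t. t \<ge> 0 \<Longrightarrow> measure (X t w) (- {-(\<delta>*t)<..<\<delta>*t}) \<le> C * exp (- b * t)"
      using elim[rule_format, of \<delta> j] d0 by (auto simp: b_def algebra_simps)
    show ?case
    proof (rule tendsto_sandwich[of "\<lambda>_. 0"])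
      show "\<forall>\<^sub>F t in at_top. measure (X t w) (- {-(\<delta>*t)<..<\<delta>*t}) \<le> C * exp (- b * t)"
        using eventually_ge_at_top[of 0] by eventually_elim (rule C)
      have "((\<lambda>t. exp (- b * t)) \<longlongrightarrow> 0) at_top" using b by real_asymp
      then show "((\<lambda>t. C * exp (- b * t)) \<longlongrightarrow> 0) at_top" by (rule tendsto_mult_right_zero)
    qed auto
  qed
  obtain R where R: "R \<ge> 0" "\<And>x l. \<bar>x\<bar> > R \<Longrightarrow> l \<ge> 0 \<Longrightarrow> psi \<beta> \<alpha> \<pi> x l = 0"
    using psi_eq_0_outside[OF params] by blast
  have flow: "AE w in P. \<forall>n y :: nat. \<forall>t. t > real n \<longrightarrow>
     2 / sqrt (2 * pi * (t - n)) * exp (- (real y + 2)\<^sup>2 / (2 * (t - n))) * measure (X n w) {x. \<bar>x\<bar> \<ge> R + 1}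
      \<le> measure (X t w) {x. \<bar>x\<bar> \<ge> y}"
    using R by (rule outflow)
  obtain \<kappa> where \<kappa>: "\<kappa> > 0" and spread: "AE w in P. \<forall>\<^sub>F n in sequentially. 
     \<kappa> * measure (X (real n) w) UNIV - real n \<le> measure (X (real n + 1) w) {x. \<bar>x\<bar> \<ge> R + 1}"
    using spreading[OF R(1)] by blast
  have part2: "AE w in P. (\<exists>L > 0. ((\<lambda>t. exp (- lam * t) * (\<integral>x. h x \<partial>(X t w))) \<longlongrightarrow> L) at_top)
       \<longrightarrow> ((\<lambda>t. ln (measure (X t w) (- {-(\<delta>*t)<..<\<delta>*t})) / t) \<longlongrightarrow> lam - sqrt (2 * lam) * \<delta>) at_top"
    if dl: "0 \<le> \<delta>" "\<delta> < sqrt (lam / 2)" for \<delta>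
    using up spread flow AE_space
  proof eventually_elim
    case (elim w)
    show ?case
    proof (intro impI, elim exE conjE)
      fix L assume L: "L > 0" "((\<lambda>t. exp (- lam * t) * (\<integral>x. h x \<partial>(X t w))) \<longlongrightarrow> L) at_top"
      obtain c where c: "c > 0" "\<forall>\<^sub>F n in sequentially. c * exp (lam * real n) \<le> measure (X (real n) w) {x. \<bar>x\<bar> \<ge> R + 1}"
        using mass_growth[OF h lam \<kappa> elim(4) elim(2) L] by blast
      define a where "a = \<delta> / s"
      \<comment> \<open>Since \<delta> < s / 2, the fraction a is even below 1 / 2, and a positive
        share of the time remains for growth.\<close>
      have a: "0 \<le> a" "a < 1" "a * s = \<delta>" using dl s by (auto simp: a_def field_simps)
      define low where "low t = 2 / sqrt (2 * pi * (a * t + 2)) * exp (- (a * s * t + 3)\<^sup>2 / (2 * (a * t + 1))) * (c * exp (lam * ((1 - a) * t - 2)))" for t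
      have rate: "((\<lambda>t. ln (low t) / t) \<longlongrightarrow> lam - sqrt (2 * lam) * \<delta>) at_top"
      proof -
        have "((\<lambda>t. ln (low t) / t) \<longlongrightarrow> lam - s * (a * s)) at_top"
          unfolding low_def by (rule lower_rate_tendsto[OF a(1) c(1)]) (simp add: s(2))
        also have "lam - s * (a * s) = lam - sqrt (2 * lam) * \<delta>" unfolding a(3) by (simp add: s_def)
        finally show ?thesis .
      qed
      have "\<forall>\<^sub>F t in at_top. low t \<le> measure (X t w) (- {-(\<delta>*t)<..<\<delta>*t})"
        using lower_bound_eventually[OF R(1) lam elim(3) elim(4) c a(1,2) dl(1)] unfolding low_def a(3) .
      then have "\<forall>\<^sub>F t in at_top. 0 < low t \<and> low t \<le> measure (X t w) (- {-(\<delta>*t)<..<\<delta>*t})"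
        using eventually_ge_at_top[of 0]
      proof eventually_elim
        case (elim t)
        have "0 < a * t + 2" using a elim by (simp add: add_nonneg_pos)
        then have "0 < low t" using c by (simp add: low_def)
        then show ?case using elim by simp
      qed
      then show "((\<lambda>t. ln (measure (X t w) (- {-(\<delta>*t)<..<\<delta>*t})) / t) \<longlongrightarrow> lam - sqrt (2 * lam) * \<delta>) at_top"
        using elim(1) dl(1) by (intro rate_limit[OF lam dl(1) _ _ rate]) auto
    qed
  qed
  show ?thesis using part1 part2 unfolding lam_def by blast
qed

end
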